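(* Let $E$ be a Banach space such that $E'$ has type 2 and let $1<p<\infty$. Then for any $1\le p_1<p$, and $r$ given by $$\frac1r=\frac12+\Big(\frac1{p_1}-\frac1p\Big)\frac{p'}{2},$$ where $\frac1p+\frac1{p'}=1$, the restriction to $\ell_{p_1}\times E$ of every continuous bilinear form $A\in\mathcal{L}(\ell_p,E;\mathbb{K})$ belongs to $\Pi_{(r;2,1)}(\ell_{p_1},E;\mathbb{K})$.
   Context: Banach spaces are over $\mathbb{K}=\mathbb{R}$ or $\mathbb{C}$; $E'$ is the topological dual of $E$ and $B_{E'}$ its closed unit ball. $\mathcal{L}(E_1,E_2;\mathbb{K})$ is the space of continuous bilinear forms on $E_1\times E_2$. For a finite family, $\|(x_j)\|_{\ell_p^w(E)}=\sup_{\varphi\in B_{E'}}(\sum_j|\varphi(x_j)|^p)^{1/p}$. For $0<p,p_1,p_2<\infty$ with $\frac1p\le\frac1{p_1}+\frac1{p_2}$, $\Pi_{(p;p_1,p_2)}(E_1,E_2;\mathbb{K})$ is the space of absolutely $(p;p_1,p_2)$-summing bilinear forms, i.e. those $A\in\mathcal{L}(E_1,E_2;\mathbb{K})$ for which there is $C>0$ with $\big(\sum_{j=1}^m|A(x_j^1,x_j^2)|^p\big)^{1/p}\le C\prod_{i=1}^2\|(x_j^i)_{j=1}^m\|_{\ell_{p_i}^w(E_i)}$ for all finite families $x_1^i,\ldots,x_m^i\in E_i$, $i=1,2$. *)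

theory Defs
  imports "HOL-Analysis.Analysis" "HOL-Probability.Probability" "HOL-Library.Function_Algebras"
begin

section \<open>The scalar field\<close>

text \<open>
  The library has normed spaces over the reals only. This class is the field \<open>\<real>\<close> or the
  field \<open>\<complex>\<close>, with the usual absolute value as \<^term>\<open>norm\<close>; \<^typ>\<open>real\<close> and \<^typ>\<open>complex\<close>
  are instances.
\<close>

class real_or_complex = real_normed_field +
  assumes real_or_complex:
    "(\<forall>z. \<exists>a. z = a *\<^sub>R 1) \<or>
     (\<exists>i. i * i = - 1 \<and> (\<forall>z. \<exists>a b. z = a *\<^sub>R 1 + b *\<^sub>R i) \<and>
          (\<forall>a b. norm (a *\<^sub>R 1 + b *\<^sub>R i) = sqrt (a\<^sup>2 + b\<^sup>2)))"

instance real :: real_or_complex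
  by standard simp

instance complex :: real_or_complex
proof
  have "\<i> * \<i> = - 1 \<and> (\<forall>z. \<exists>a b. z = a *\<^sub>R 1 + b *\<^sub>R \<i>) \<and>
        (\<forall>a b. norm (a *\<^sub>R 1 + b *\<^sub>R \<i>) = sqrt (a\<^sup>2 + b\<^sup>2))"
    by (auto simp: complex_eq_iff cmod_def)
  then show "(\<forall>z::complex. \<exists>a. z = a *\<^sub>R 1) \<or>
     (\<exists>i::complex. i * i = - 1 \<and> (\<forall>z. \<exists>a b. z = a *\<^sub>R 1 + b *\<^sub>R i) \<and>
          (\<forall>a b. norm (a *\<^sub>R 1 + b *\<^sub>R i) = sqrt (a\<^sup>2 + b\<^sup>2)))"
    by blast
qed

section \<open>Normed spaces, Banach spaces and duals\<close>

text \<open>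
  A normed space over \<open>'k\<close> is a subspace of an ambient \<open>'k\<close>-vector space on the type \<open>'a\<close>, so
  that the sequence spaces, which depend on a real exponent, and dual spaces are covered. The
  values of \<open>nrm\<close> outside \<open>car\<close> are irrelevant.
\<close>

record ('k, 'a) nspace =
  car :: "'a set"
  nrm :: "'a \<Rightarrow> real"
  scl :: "'k \<Rightarrow> 'a \<Rightarrow> 'a"

definition normed_space :: "('k::real_or_complex, 'a::ab_group_add) nspace \<Rightarrow> bool" where
  "normed_space X \<longleftrightarrow>
     vector_space (scl X) \<and> module.subspace (scl X) (car X) \<and>
     (\<forall>x\<in>car X. 0 \<le> nrm X x) \<and>
     (\<forall>x\<in>car X. nrm X x = 0 \<longleftrightarrow> x = 0) \<and>
     (\<forall>c. \<forall>x\<in>car X. nrm X (scl X c x) = norm c * nrm X x) \<and>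
     (\<forall>x\<in>car X. \<forall>y\<in>car X. nrm X (x + y) \<le> nrm X x + nrm X y)"

text \<open>The value off the carrier is set to 0 because \<^locale>\<open>Metric_space\<close> asks for
  nonnegativity and symmetry on the whole type.\<close>

definition ndist :: "('k, 'a::ab_group_add) nspace \<Rightarrow> 'a \<Rightarrow> 'a \<Rightarrow> real" where
  "ndist X x y = (if x \<in> car X \<and> y \<in> car X then nrm X (x - y) else 0)"

definition norm_topology :: "('k, 'a::ab_group_add) nspace \<Rightarrow> 'a topology" where
  "norm_topology X = Metric_space.mtopology (car X) (ndist X)"

lemma normed_space_Metric_space:
  assumes "normed_space X"
  shows "Metric_space (car X) (ndist X)"
proof -
  interpret vector_space "scl X"
    using assms by (simp add: normed_space_def)
  have sub: "subspace (car X)"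
    and nonneg: "\<And>x. x \<in> car X \<Longrightarrow> 0 \<le> nrm X x"
    and zero: "\<And>x. x \<in> car X \<Longrightarrow> nrm X x = 0 \<longleftrightarrow> x = 0"
    and hom: "\<And>c x. x \<in> car X \<Longrightarrow> nrm X (scl X c x) = norm c * nrm X x"
    and tri: "\<And>x y. x \<in> car X \<Longrightarrow> y \<in> car X \<Longrightarrow> nrm X (x + y) \<le> nrm X x + nrm X y"
    using assms by (auto simp: normed_space_def)
  have diff: "x - y \<in> car X" if "x \<in> car X" "y \<in> car X" for x y
    using that sub by (simp add: subspace_diff)
  show ?thesis
  proof
    fix x y z
    show "0 \<le> ndist X x y"
      by (simp add: ndist_def nonneg diff)
    show "ndist X x y = ndist X y x"
      using hom[of "x - y" "- 1"] by (simp add: ndist_def diff)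
    show "ndist X x y = 0 \<longleftrightarrow> x = y" if "x \<in> car X" "y \<in> car X"
      using that by (simp add: ndist_def zero diff)
    show "ndist X x z \<le> ndist X x y + ndist X y z"
      if "x \<in> car X" "y \<in> car X" "z \<in> car X"
      using that tri[of "x - y" "y - z"] by (simp add: ndist_def diff)
  qed
qed

definition banach_space :: "('k::real_or_complex, 'a::ab_group_add) nspace \<Rightarrow> bool" where
  "banach_space X \<longleftrightarrow> normed_space X \<and> Metric_space.mcomplete (car X) (ndist X)"

definition unit_ball :: "('k, 'a) nspace \<Rightarrow> 'a set" where
  "unit_ball X = {x \<in> car X. nrm X x \<le> 1}"

text \<open>
  The topological dual with the operator norm. Functionals are represented by functions on the
  whole type that vanish off the carrier, so that each functional has one representative and
  the representatives form a vector space.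
\<close>

definition dual :: "('k::real_or_complex, 'a::ab_group_add) nspace \<Rightarrow> ('k, 'a \<Rightarrow> 'k) nspace" where
  "dual X = \<lparr>
     car = {\<phi>. (\<forall>x\<in>car X. \<forall>y\<in>car X. \<phi> (x + y) = \<phi> x + \<phi> y) \<and>
               (\<forall>c. \<forall>x\<in>car X. \<phi> (scl X c x) = c * \<phi> x) \<and>
               continuous_map (norm_topology X) euclidean \<phi> \<and>
               (\<forall>x. x \<notin> car X \<longrightarrow> \<phi> x = 0)},
     nrm = (\<lambda>\<phi>. SUP x\<in>unit_ball X. norm (\<phi> x)),
     scl = (\<lambda>c \<phi> x. c * \<phi> x) \<rparr>"

definition lp :: "real \<Rightarrow> ('k::real_or_complex, nat \<Rightarrow> 'k) nspace" where
  "lp p = \<lparr>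
     car = {x. summable (\<lambda>n. norm (x n) powr p)},
     nrm = (\<lambda>x. (\<Sum>n. norm (x n) powr p) powr (1 / p)),
     scl = (\<lambda>c x n. c * x n) \<rparr>"

section \<open>Type\<close>

text \<open>The family \<open>\<epsilon>\<close> consists of \<open>m\<close> independent Rademacher variables, i.e.\ uniformly
  distributed signs.\<close>

definition rademacher :: "nat \<Rightarrow> (nat \<Rightarrow> 'k::real_or_complex) pmf" where
  "rademacher m = Pi_pmf {..<m} 0 (\<lambda>_. pmf_of_set {1, - 1})"

definition has_type :: "real \<Rightarrow> ('k::real_or_complex, 'a::ab_group_add) nspace \<Rightarrow> bool" where
  "has_type q X \<longleftrightarrow>
     (\<exists>C>0. \<forall>m x. (\<forall>j<m. x j \<in> car X) \<longrightarrow>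
        sqrt (measure_pmf.expectation (rademacher m)
                (\<lambda>\<epsilon>. (nrm X (\<Sum>j<m. scl X (\<epsilon> j) (x j)))\<^sup>2))
          \<le> C * (\<Sum>j<m. nrm X (x j) powr q) powr (1 / q))"

section \<open>Bilinear forms and absolutely summing bilinear forms\<close>

definition bilinear_forms ::
  "('k::real_or_complex, 'a::ab_group_add) nspace \<Rightarrow> ('k, 'b::ab_group_add) nspace \<Rightarrow>
   ('a \<times> 'b \<Rightarrow> 'k) set" where
  "bilinear_forms X Y =
     {A \<in> extensional (car X \<times> car Y).
        (\<forall>x\<in>car X. \<forall>x'\<in>car X. \<forall>y\<in>car Y. A (x + x', y) = A (x, y) + A (x', y)) \<and>
        (\<forall>x\<in>car X. \<forall>y\<in>car Y. \<forall>y'\<in>car Y. A (x, y + y') = A (x, y) + A (x, y')) \<and>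
        (\<forall>c. \<forall>x\<in>car X. \<forall>y\<in>car Y. A (scl X c x, y) = c * A (x, y)) \<and>
        (\<forall>c. \<forall>x\<in>car X. \<forall>y\<in>car Y. A (x, scl Y c y) = c * A (x, y)) \<and>
        continuous_map (prod_topology (norm_topology X) (norm_topology Y)) euclidean A}"

text \<open>The weak norm of the finite family \<open>x 0, \<dots>, x (m - 1)\<close>.\<close>

definition weak_norm ::
  "real \<Rightarrow> ('k::real_or_complex, 'a::ab_group_add) nspace \<Rightarrow> nat \<Rightarrow> (nat \<Rightarrow> 'a) \<Rightarrow> real" where
  "weak_norm p X m x =
     (SUP \<phi>\<in>unit_ball (dual X). (\<Sum>j<m. norm (\<phi> (x j)) powr p) powr (1 / p))"

definition summing_forms ::
  "real \<Rightarrow> real \<Rightarrow> real \<Rightarrow>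
   ('k::real_or_complex, 'a::ab_group_add) nspace \<Rightarrow> ('k, 'b::ab_group_add) nspace \<Rightarrow>
   ('a \<times> 'b \<Rightarrow> 'k) set" where
  "summing_forms p p1 p2 X Y =
     {A \<in> bilinear_forms X Y.
        \<exists>C>0. \<forall>m x y. (\<forall>j<m. x j \<in> car X \<and> y j \<in> car Y) \<longrightarrow>
          (\<Sum>j<m. norm (A (x j, y j)) powr p) powr (1 / p)
            \<le> C * (weak_norm p1 X m x * weak_norm p2 Y m y)}"

end

(*
  The form A maps E into l_p', so with a_jk = x_j(k) and D_jk = A(e_k, y_j) one has to bound the
  l_r norm of j |-> sum_k a_jk D_jk. Maurey's factorization theorem says that an operator from a
  space of type 2 into l_q, q < 2, is an operator into l_2 followed by multiplication with
  kappa_k^(1/q - 1/2) for some probability weights kappa. Applied to the operator from E' to l_1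
  given by phi |-> (phi(y_j))_j, it splits off a factor sqrt(mu_j) from y_j; this factor accounts
  for the 1/2 in 1/r and turns D into sqrt(mu_j) d_jk, where both a and d are now bounded as
  operators from l_2 into l_p1 and into l_p'. It remains to show that t_j = sum_k a_jk d_jk is
  bounded in l_(2/theta) with theta = (1/p1 - 1/p) p'. If p1 < 2 or p' < 2, the theorem applies
  again, now with domain l_2, and Hoelder's inequality interpolates between the bounds for the
  columns and for the rows of the remaining factors. Only the first N coordinates of the x_j are
  treated; N tends to infinity at the end.
*)
theory Submission
  imports Defs
begin

section \<open>The Khintchine inequality\<close>

text \<open>Taking absolute values of the entries of a matrix destroys its operator norm on l_2, but
  not the l_2 norms of its rows and columns; these are all that is kept after a factorization. The
  weights \<kappa> make the column bounds, which are uniform in k, summable over k. Row bounds are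
  uniform in j, the end \<theta> = 0 of the interpolation; weighted column bounds are summable in j,
  the end \<theta> = 1. Indeed \<theta> = 1 - p' (1 - 1/p1) falls from 1 at p1 = 1 to 0 as p1 tends
  to p, and r = 2 / (1 + \<theta>) moves from 1 to 2.

  Maurey's theorem is derived here from the Khintchine inequality by maximising a concave
  functional. Having only finitely many coordinates makes that functional continuous and its domain
  relatively compact; this is the reason for the cut at N. No constant depends on N: a factorization
  costs 8, which is 4 from Khintchine times 2 from a comparison of moments; two factorizations and a
  merging of their weights cost 8 * 8 * 2 = 128; with the factorization of the y_j the total is
  1024.\<close>

lemma finite_rademacher: "finite (set_pmf (rademacher m :: (nat \<Rightarrow> 'k::real_or_complex) pmf))"
  unfolding rademacher_def by (simp add: set_Pi_pmf finite_PiE_dflt)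

lemma integrable_rademacher [simp]:
  fixes f :: "(nat \<Rightarrow> 'k::real_or_complex) \<Rightarrow> real"
  shows "integrable (measure_pmf (rademacher m)) f"
  by (rule integrable_measure_pmf_finite [OF finite_rademacher])

lemma expectation_rademacher_mono:
  fixes f g :: "(nat \<Rightarrow> 'k::real_or_complex) \<Rightarrow> real"
  assumes "\<And>\<epsilon>. \<epsilon> \<in> set_pmf (rademacher m) \<Longrightarrow> f \<epsilon> \<le> g \<epsilon>"
  shows "measure_pmf.expectation (rademacher m) f \<le> measure_pmf.expectation (rademacher m) g"
  using assms by (intro integral_mono_AE) (auto simp: AE_measure_pmf_iff)

lemma expectation_rademacher_0:
  fixes f :: "(nat \<Rightarrow> 'k::real_or_complex) \<Rightarrow> real"
  shows "measure_pmf.expectation (rademacher 0) f = f (\<lambda>_. 0)"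
  by (simp add: rademacher_def)

text \<open>Conditioning on all signs but the last. The moment computations below are inductions
  along this identity and use independence only through it.\<close>

lemma expectation_rademacher_Suc:
  fixes f :: "(nat \<Rightarrow> 'k::real_or_complex) \<Rightarrow> real"
  shows "measure_pmf.expectation (rademacher (Suc m)) f =
    measure_pmf.expectation (rademacher m) (\<lambda>\<epsilon>. (f (\<epsilon>(m := 1)) + f (\<epsilon>(m := - 1))) / 2)"
proof -
  have ne: "(1::'k) \<noteq> - 1"
    by (metis one_neq_neg_one)
  have "rademacher (Suc m) = map_pmf (\<lambda>(y, g). g(m := y)) (pair_pmf (pmf_of_set {1, - 1 :: 'k}) (rademacher m))"
    unfolding rademacher_def lessThan_Suc by (subst Pi_pmf_insert) auto
  also have "\<dots> = bind_pmf (rademacher m) (\<lambda>g. map_pmf (\<lambda>y. g(m := y)) (pmf_of_set {1, - 1 :: 'k}))"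
    by (simp add: pair_pmf_def map_pmf_def bind_assoc_pmf bind_return_pmf) (rule bind_commute_pmf)
  finally have eq: "rademacher (Suc m) = bind_pmf (rademacher m) (\<lambda>g. map_pmf (\<lambda>y. g(m := y)) (pmf_of_set {1, - 1 :: 'k}))" .
  have "measure_pmf.expectation (rademacher (Suc m)) f =
    measure_pmf.expectation (rademacher m) (\<lambda>g. measure_pmf.expectation (map_pmf (\<lambda>y. g(m := y)) (pmf_of_set {1, - 1 :: 'k})) f)"
    unfolding eq
    by (subst pmf_expectation_bind[OF finite_rademacher _ order_refl])
       (auto simp: integral_measure_pmf[OF finite_rademacher])
  also have "\<dots> = measure_pmf.expectation (rademacher m) (\<lambda>\<epsilon>. (f (\<epsilon>(m := 1)) + f (\<epsilon>(m := - 1))) / 2)"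
    using ne by (simp add: integral_pmf_of_set)
  finally show ?thesis .
qed

text \<open>This is where the alternative in the class axiom enters: in both cases the absolute
  value comes from a real inner product.\<close>

lemma parallelogram:
  fixes z w :: "'k::real_or_complex"
  shows "(norm (z + w))\<^sup>2 + (norm (z - w))\<^sup>2 = 2 * (norm z)\<^sup>2 + 2 * (norm w)\<^sup>2"
  using real_or_complex[where ?'a = 'k]
proof
  assume "\<forall>z::'k. \<exists>a. z = a *\<^sub>R 1"
  then obtain a b where "z = a *\<^sub>R 1" "w = b *\<^sub>R 1" by metis
  then have "norm (z + w) = \<bar>a + b\<bar>" "norm (z - w) = \<bar>a - b\<bar>" "norm z = \<bar>a\<bar>" "norm w = \<bar>b\<bar>"
    by (metis norm_scaleR norm_one mult.right_neutral scaleR_add_left scaleR_diff_left)+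
  then show ?thesis
    by (simp add: power2_sum power2_diff)
next
  assume "\<exists>i::'k. i * i = - 1 \<and> (\<forall>z. \<exists>a b. z = a *\<^sub>R 1 + b *\<^sub>R i) \<and>
          (\<forall>a b. norm (a *\<^sub>R 1 + b *\<^sub>R i) = sqrt (a\<^sup>2 + b\<^sup>2))"
  then obtain i :: 'k where rep: "\<And>z. \<exists>a b. z = a *\<^sub>R 1 + b *\<^sub>R i"
    and nrm: "\<And>a b. norm (a *\<^sub>R 1 + b *\<^sub>R i) = sqrt (a\<^sup>2 + b\<^sup>2)" by blast
  obtain a b where z: "z = a *\<^sub>R 1 + b *\<^sub>R i" using rep by blast
  obtain c d where w: "w = c *\<^sub>R 1 + d *\<^sub>R i" using rep by blast
  have "z + w = (a + c) *\<^sub>R 1 + (b + d) *\<^sub>R i" "z - w = (a - c) *\<^sub>R 1 + (b - d) *\<^sub>R i"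
    unfolding z w by (simp_all add: algebra_simps)
  then show ?thesis
    by (simp only: z w nrm real_sqrt_pow2 sum_power2_ge_zero) (simp add: power2_eq_square algebra_simps)
qed

text \<open>The parallelogram law fixes the sum of the two squares \<open>P\<close> and
  \<open>Q\<close>, the triangle inequality limits their difference to 4 s t, and
  \<open>P\<^sup>2 + Q\<^sup>2\<close> is half of \<open>(P + Q)\<^sup>2 + (P - Q)\<^sup>2\<close>.
  For real scalars equality holds.\<close>

lemma fourth_powers_parallelogram:
  fixes z w :: "'k::real_or_complex"
  shows "norm (z + w) ^ 4 + norm (z - w) ^ 4
    \<le> 2 * norm z ^ 4 + 12 * (norm z)\<^sup>2 * (norm w)\<^sup>2 + 2 * norm w ^ 4"
proof -
  define P Q s t where "P = (norm (z + w))\<^sup>2" and "Q = (norm (z - w))\<^sup>2" and "s = norm z" and "t = norm w"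
  have sum: "P + Q = 2 * s\<^sup>2 + 2 * t\<^sup>2"
    unfolding P_def Q_def s_def t_def by (rule parallelogram)
  have "P \<le> (s + t)\<^sup>2" "Q \<le> (s + t)\<^sup>2"
    unfolding P_def Q_def s_def t_def
    by (auto intro!: power_mono norm_triangle_ineq norm_triangle_ineq4)
  with sum have "\<bar>P - Q\<bar> \<le> 4 * (s * t)"
    by (auto simp: power2_sum abs_le_iff)
  then have "(P - Q)\<^sup>2 \<le> (4 * (s * t))\<^sup>2"
    using abs_le_square_iff[of "P - Q" "4 * (s * t)"] by (simp add: s_def t_def)
  moreover have "2 * (P\<^sup>2 + Q\<^sup>2) = (P + Q)\<^sup>2 + (P - Q)\<^sup>2"
    by (simp add: power2_eq_square algebra_simps)
  ultimately have "2 * (P\<^sup>2 + Q\<^sup>2) \<le> (2 * s\<^sup>2 + 2 * t\<^sup>2)\<^sup>2 + (4 * (s * t))\<^sup>2"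
    using sum by simp
  also have "\<dots> = 2 * (2 * s ^ 4 + 12 * s\<^sup>2 * t\<^sup>2 + 2 * t ^ 4)"
    by (simp add: power2_eq_square power4_eq_xxxx algebra_simps)
  finally show ?thesis
    by (simp add: P_def Q_def s_def t_def flip: power_mult)
qed

lemma sum_fun_upd_lessThan:
  fixes c :: "nat \<Rightarrow> 'k::real_or_complex"
  shows "(\<Sum>i<Suc m. (\<epsilon>(m := s)) i * c i) = (\<Sum>i<m. \<epsilon> i * c i) + s * c m"
  by (simp add: sum.lessThan_Suc)

lemma rademacher_second_moment:
  fixes c :: "nat \<Rightarrow> 'k::real_or_complex"
  shows "measure_pmf.expectation (rademacher m) (\<lambda>\<epsilon>. (norm (\<Sum>i<m. \<epsilon> i * c i))\<^sup>2) = (\<Sum>i<m. (norm (c i))\<^sup>2)"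
proof (induction m)
  case (Suc m)
  have "(norm (z + 1 * w))\<^sup>2 + (norm (z + - 1 * w))\<^sup>2 = 2 * ((norm z)\<^sup>2 + (norm w)\<^sup>2)" for z w :: 'k
    using parallelogram[of z w] by simp
  then show ?case
    using Suc by (simp only: expectation_rademacher_Suc sum_fun_upd_lessThan) simp
qed (simp add: expectation_rademacher_0)

lemma rademacher_fourth_moment:
  fixes c :: "nat \<Rightarrow> 'k::real_or_complex"
  shows "measure_pmf.expectation (rademacher m) (\<lambda>\<epsilon>. norm (\<Sum>i<m. \<epsilon> i * c i) ^ 4) \<le> 3 * (\<Sum>i<m. (norm (c i))\<^sup>2)\<^sup>2"
proof (induction m)
  case (Suc m)
  let ?E = "measure_pmf.expectation (rademacher m)" and ?S = "\<lambda>\<epsilon>. \<Sum>i<m. \<epsilon> i * c i" and ?\<sigma> = "\<Sum>i<m. (norm (c i))\<^sup>2"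
  have "(norm (z + 1 * w) ^ 4 + norm (z + - 1 * w) ^ 4) / 2
      \<le> norm z ^ 4 + (6 * (norm w)\<^sup>2) * (norm z)\<^sup>2 + norm w ^ 4" for z w :: 'k
    using fourth_powers_parallelogram[of z w] by (simp add: mult_ac)
  then have "measure_pmf.expectation (rademacher (Suc m)) (\<lambda>\<epsilon>. norm (\<Sum>i<Suc m. \<epsilon> i * c i) ^ 4)
      \<le> ?E (\<lambda>\<epsilon>. norm (?S \<epsilon>) ^ 4 + (6 * (norm (c m))\<^sup>2) * (norm (?S \<epsilon>))\<^sup>2 + norm (c m) ^ 4)"
    unfolding expectation_rademacher_Suc sum_fun_upd_lessThan
    by (intro expectation_rademacher_mono) blast
  also have "\<dots> = ?E (\<lambda>\<epsilon>. norm (?S \<epsilon>) ^ 4) + (6 * (norm (c m))\<^sup>2) * ?\<sigma> + norm (c m) ^ 4"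
    by (simp add: rademacher_second_moment)
  \<comment> \<open>The coefficient of the last term is raised from 1 to 3 so that the three terms
    form 3 times a square.\<close>
  also have "\<dots> \<le> 3 * ?\<sigma>\<^sup>2 + (6 * (norm (c m))\<^sup>2) * ?\<sigma> + 3 * norm (c m) ^ 4"
    using Suc by (simp add: add_mono)
  also have "\<dots> = 3 * (\<Sum>i<Suc m. (norm (c i))\<^sup>2)\<^sup>2"
    by (simp add: power2_sum power2_eq_square power4_eq_xxxx algebra_simps)
  finally show ?case .
qed (simp add: expectation_rademacher_0)

text \<open>A pointwise substitute for interpolating the second moment between the q-th and the
  fourth. For t <= 1 already t^2 is below t^q; for t > 1 the left side is at most 1 because (t^2 / 2
  - 1)^2 >= 0.\<close>

lemma powr_ge_quartic:
  fixes t q :: real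
  assumes "0 \<le> t" "0 < q" "q \<le> 2"
  shows "t\<^sup>2 - t ^ 4 / 4 \<le> t powr q"
proof (cases "t \<le> 1")
  case True
  have "t powr 2 \<le> t powr q"
    using assms True by (intro powr_mono') auto
  moreover have "t powr 2 = t\<^sup>2" using assms by simp
  moreover have "0 \<le> t ^ 4" by simp
  ultimately show ?thesis by linarith
next
  case False
  have "0 \<le> (t\<^sup>2 / 2 - 1)\<^sup>2" by simp
  then have "t\<^sup>2 - t ^ 4 / 4 \<le> 1"
    by (simp add: power2_eq_square power4_eq_xxxx algebra_simps)
  also have "1 \<le> t powr q" using False assms by (simp add: ge_one_powr_ge_zero)
  finally show ?thesis .
qed

text \<open>After division by the standard deviation \<sigma> the second moment is 1 and the fourth
  at most 3, so \<open>powr_ge_quartic\<close> leaves 1 - 3/4. Hence the constant 4, for every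
  q.\<close>

lemma khinchine:
  fixes c :: "nat \<Rightarrow> 'k::real_or_complex"
  assumes "0 < q" "q \<le> 2"
  shows "(\<Sum>i<m. (norm (c i))\<^sup>2) powr (q / 2)
    \<le> 4 * measure_pmf.expectation (rademacher m) (\<lambda>\<epsilon>. norm (\<Sum>i<m. \<epsilon> i * c i) powr q)"
proof (cases "(\<Sum>i<m. (norm (c i))\<^sup>2) = 0")
  case True
  then show ?thesis by (simp add: integral_nonneg)
next
  case False
  let ?E = "measure_pmf.expectation (rademacher m)" and ?S = "\<lambda>\<epsilon>. \<Sum>i<m. \<epsilon> i * c i"
  define \<sigma> where "\<sigma> = sqrt (\<Sum>i<m. (norm (c i))\<^sup>2)"
  have nn: "0 \<le> (\<Sum>i<m. (norm (c i))\<^sup>2)" by (simp add: sum_nonneg)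
  then have \<sigma>: "0 < \<sigma>" "\<sigma>\<^sup>2 = (\<Sum>i<m. (norm (c i))\<^sup>2)"
    using False by (simp_all add: \<sigma>_def)
  have "1 / 4 \<le> ?E (\<lambda>\<epsilon>. (norm (?S \<epsilon>))\<^sup>2) / \<sigma>\<^sup>2 - ?E (\<lambda>\<epsilon>. norm (?S \<epsilon>) ^ 4) / (4 * \<sigma> ^ 4)"
  proof -
    have "?E (\<lambda>\<epsilon>. (norm (?S \<epsilon>))\<^sup>2) / \<sigma>\<^sup>2 = 1"
      using \<sigma>(2) False by (simp only: rademacher_second_moment) simp
    moreover have "?E (\<lambda>\<epsilon>. norm (?S \<epsilon>) ^ 4) \<le> 3 * \<sigma> ^ 4"
      using rademacher_fourth_moment[of m c] unfolding \<sigma>(2)[symmetric] by simp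
    then have "?E (\<lambda>\<epsilon>. norm (?S \<epsilon>) ^ 4) / (4 * \<sigma> ^ 4) \<le> 3 / 4"
      using \<sigma>(1) by (simp add: divide_le_eq)
    ultimately show ?thesis by linarith
  qed
  also have "\<dots> = ?E (\<lambda>\<epsilon>. (norm (?S \<epsilon>) / \<sigma>)\<^sup>2 - (norm (?S \<epsilon>) / \<sigma>) ^ 4 / 4)"
    by (simp add: power_divide)
  also have "\<dots> \<le> ?E (\<lambda>\<epsilon>. (norm (?S \<epsilon>) / \<sigma>) powr q)"
    using \<sigma> assms by (intro expectation_rademacher_mono powr_ge_quartic) auto
  also have "\<dots> = ?E (\<lambda>\<epsilon>. norm (?S \<epsilon>) powr q) / \<sigma> powr q"
    using \<sigma> by (simp add: powr_divide)
  finally have "\<sigma> powr q \<le> 4 * ?E (\<lambda>\<epsilon>. norm (?S \<epsilon>) powr q)"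
    using \<sigma> by (simp add: field_simps)
  moreover have "(\<sigma>\<^sup>2) powr (q / 2) = \<sigma> powr q"
    using \<sigma>(1) powr_powr[of \<sigma> 2 "q / 2"] by simp
  ultimately show ?thesis
    using \<sigma> by simp
qed

section \<open>Maurey factorization\<close>

lemma closed_Collect_box: "closed {w :: nat \<Rightarrow> real. \<forall>k. 0 \<le> w k \<and> w k \<le> B}"
  by (intro closed_Collect_all closed_Collect_conj closed_Collect_le continuous_intros continuous_on_product_coordinates)

text \<open>Tychonoff's theorem, used to find the maximiser in \<open>optimal_weights\<close>
  without leaving the type \<open>nat \<Rightarrow> real\<close>.\<close>

lemma compact_Collect_box: "compact {w :: nat \<Rightarrow> real. \<forall>k. 0 \<le> w k \<and> w k \<le> B}"
proof -
  have "compactin (product_topology (\<lambda>_::nat. euclidean) UNIV) (PiE UNIV (\<lambda>_::nat. {0..B::real}))"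
    unfolding compactin_PiE by (auto simp: PiE_iff)
  moreover have "PiE UNIV (\<lambda>_::nat. {0..B::real}) = {w. \<forall>k. 0 \<le> w k \<and> w k \<le> B}"
    by (auto simp: PiE_iff)
  ultimately show ?thesis
    by (simp add: euclidean_product_topology)
qed

text \<open>The weights are read off a maximiser of the concave function \<open>v \<mapsto> \<Sum>k<N. v k powr (q / 2)\<close>
  over the closure of \<open>S\<close>: the inequality is its first-order optimality condition.\<close>

lemma optimal_weights:
  fixes S :: "(nat \<Rightarrow> real) set" and N :: nat and q C :: real
  assumes q: "0 < q" "q < 2" and "0 \<le> C"
    and conv: "\<And>v w t. v \<in> S \<Longrightarrow> w \<in> S \<Longrightarrow> 0 \<le> t \<Longrightarrow> t \<le> 1 \<Longrightarrow> (\<lambda>k. (1 - t) * v k + t * w k) \<in> S"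
    and nonneg: "\<And>v k. v \<in> S \<Longrightarrow> 0 \<le> v k"
    and supp: "\<And>v k. v \<in> S \<Longrightarrow> N \<le> k \<Longrightarrow> v k = 0"
    and bound: "\<And>v. v \<in> S \<Longrightarrow> (\<Sum>k<N. v k powr (q / 2)) \<le> C"
  obtains \<kappa> :: "nat \<Rightarrow> real" where "\<And>k. 0 \<le> \<kappa> k" "(\<Sum>k<N. \<kappa> k) \<le> 1"
    "\<And>v k. v \<in> S \<Longrightarrow> k < N \<Longrightarrow> \<kappa> k = 0 \<Longrightarrow> v k = 0"
    "\<And>v. v \<in> S \<Longrightarrow> (\<Sum>k<N. v k * \<kappa> k powr (1 - 2 / q)) \<le> C powr (2 / q)"
proof (cases "S = {}")
  case True
  show ?thesis by (rule that[of "\<lambda>_. 0"]) (auto simp: True)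
next
  case False
  define s where "s = q / 2"
  have s: "0 < s" "s < 1" "2 / q = 1 / s" using q by (auto simp: s_def)
  \<comment> \<open>The absolute values make \<open>F\<close> continuous on the whole space; on
    nonnegative vectors it is the sum in \<open>bound\<close>.\<close>
  define F where "F w = (\<Sum>k<N. \<bar>w k\<bar> powr s)" for w :: "nat \<Rightarrow> real"
  define K where "K = {w :: nat \<Rightarrow> real. \<forall>k. 0 \<le> w k \<and> w k \<le> C powr (1 / s)}"
  have contF: "continuous_on UNIV F"
    unfolding F_def using s by (intro continuous_intros continuous_on_powr' continuous_on_product_coordinates) auto
  have "S \<subseteq> K"
  proof
    fix v assume v: "v \<in> S"
    have "v k \<le> C powr (1 / s)" for k
    proof (cases "k < N")
      case True
      have "v k powr s \<le> (\<Sum>k<N. v k powr s)"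
        using True by (intro member_le_sum) auto
      also have "\<dots> \<le> C" using bound[OF v] by (simp add: s_def)
      finally have "(v k powr s) powr (1 / s) \<le> C powr (1 / s)"
        using s by (intro powr_mono2) auto
      then show ?thesis using s nonneg[OF v, of k] by (simp add: powr_powr)
    next
      case False
      then show ?thesis using supp[OF v, of k] by simp
    qed
    then show "v \<in> K" using nonneg[OF v] by (simp add: K_def)
  qed
  then have clK: "closure S \<subseteq> K"
    unfolding K_def by (intro closure_minimal closed_Collect_box) simp
  have "compact (closure S)"
    using compact_Int_closed[OF compact_Collect_box[of "C powr (1 / s)"] closed_closure[of S]] clK
    by (simp add: K_def Int_absorb1)
  moreover have "continuous_on (closure S) F"
    using contF continuous_on_subset by blast
  moreover have "closure S \<noteq> {}" using False by simp
  ultimately obtain u where u: "u \<in> closure S" and umax: "\<And>w. w \<in> closure S \<Longrightarrow> F w \<le> F u"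
    using continuous_attains_sup by metis
  define M where "M = F u"
  have u0: "0 \<le> u k" for k using u clK by (auto simp: K_def)
  have "closure S \<subseteq> {w. F w \<le> C}"
    using bound nonneg
    by (intro closure_minimal closed_Collect_le contF continuous_intros) (auto simp: F_def s_def)
  then have MC: "M \<le> C" using u by (auto simp: M_def)
  have M0: "0 \<le> M" by (simp add: M_def F_def sum_nonneg)
  \<comment> \<open>\<open>u\<close> lies only in the closure of \<open>S\<close>. For fixed
    \<open>v\<close> and \<open>t\<close> the inequality is a closed condition on the other
    endpoint, so it passes from points of \<open>S\<close> to \<open>u\<close>.\<close>
  have line: "F (\<lambda>k. (1 - t) * u k + t * v k) \<le> M" if v: "v \<in> S" and t: "0 \<le> t" "t \<le> 1" for v t
  proof -
    have cont: "continuous_on UNIV (\<lambda>w. F (\<lambda>k. (1 - t) * w k + t * v k))"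
      unfolding F_def using s by (intro continuous_intros continuous_on_powr' continuous_on_product_coordinates) auto
    have "closure S \<subseteq> {w. F (\<lambda>k. (1 - t) * w k + t * v k) \<le> M}"
    proof (intro closure_minimal closed_Collect_le cont continuous_intros subsetI CollectI)
      fix w assume "w \<in> S"
      then show "F (\<lambda>k. (1 - t) * w k + t * v k) \<le> M"
        unfolding M_def using conv[OF _ v t] closure_subset by (intro umax) blast
    qed
    then show ?thesis using u by blast
  qed
  \<comment> \<open>If \<open>u k = 0 < v k\<close>, moving a fraction t from \<open>u\<close>
    towards \<open>v\<close> gains t^s a at k and loses at most t M elsewhere. Since s < 1, the gain
    wins for small t, against maximality.\<close>
  have zero: "v k = 0" if v: "v \<in> S" and k: "k < N" "u k = 0" for v k
  proof (rule ccontr)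
    assume "v k \<noteq> 0"
    then have vk: "0 < v k" using nonneg[OF v, of k] by simp
    define a where "a = v k powr s"
    have a: "0 < a" using vk by (simp add: a_def)
    \<comment> \<open>Chosen so that t^(1 - s) M is at most a M / (2 (M + 1)), which is less than a;
      the 1 added to \<open>M\<close> allows \<open>M = 0\<close>.\<close>
    define t where "t = min 1 ((a / (2 * (M + 1))) powr (1 / (1 - s)))"
    have t: "0 < t" "t \<le> 1" using a M0 by (auto simp: t_def)
    have "(\<Sum>j<N. (if j = k then t powr s * a else (1 - t) * u j powr s)) \<le> F (\<lambda>j. (1 - t) * u j + t * v j)"
      unfolding F_def
    proof (rule sum_mono)
      fix j assume "j \<in> {..<N}"
      have "(1 - t) * u j powr s \<le> (1 - t) powr s * u j powr s"
      proof -
        have "(1 - t) powr 1 \<le> (1 - t) powr s" using t s by (intro powr_mono') auto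
        then show ?thesis using t by (intro mult_right_mono) auto
      qed
      also have "\<dots> = ((1 - t) * u j) powr s" using t u0 by (simp add: powr_mult)
      also have "\<dots> \<le> \<bar>(1 - t) * u j + t * v j\<bar> powr s"
        using t u0[of j] nonneg[OF v, of j] s by (intro powr_mono2) auto
      finally show "(if j = k then t powr s * a else (1 - t) * u j powr s) \<le> \<bar>(1 - t) * u j + t * v j\<bar> powr s"
        using k vk t by (auto simp: a_def powr_mult abs_mult)
    qed
    also have "(\<Sum>j<N. (if j = k then t powr s * a else (1 - t) * u j powr s)) = t powr s * a + (1 - t) * M"
    proof -
      have "(\<Sum>j<N. (if j = k then t powr s * a else (1 - t) * u j powr s))
          = (\<Sum>j<N. (if j = k then t powr s * a else 0) + (1 - t) * u j powr s)"
        using k s by (intro sum.cong) auto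
      also have "\<dots> = t powr s * a + (1 - t) * M"
        using k u0 by (simp add: sum.distrib M_def F_def sum_distrib_left)
      finally show ?thesis .
    qed
    finally have "t powr s * a + (1 - t) * M \<le> M" using line[OF v, of t] t by linarith
    then have "t powr s * a \<le> t * M" by (simp add: algebra_simps)
    also have "t * M = t powr s * (t powr (1 - s) * M)"
      using t by (simp flip: powr_add)
    finally have "a \<le> t powr (1 - s) * M" using t by simp
    also have "\<dots> \<le> (a / (2 * (M + 1))) * M"
    proof -
      have "t powr (1 - s) \<le> ((a / (2 * (M + 1))) powr (1 / (1 - s))) powr (1 - s)"
        using t s by (intro powr_mono2) (auto simp: t_def)
      also have "\<dots> = a / (2 * (M + 1))" using s a M0 by (simp add: powr_powr)
      finally show ?thesis using M0 by (intro mult_right_mono) auto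
    qed
    also have "\<dots> < a" using a M0 by (simp add: field_simps add_nonneg_pos)
    finally show False by simp
  qed
  \<comment> \<open>x^s has no derivative at 0, so the first-order condition is taken on the
    positive coordinates of \<open>u\<close>; the others are covered by \<open>zero\<close>.\<close>
  define P where "P = {k. k < N \<and> 0 < u k}"
  have P: "finite P" "P \<subseteq> {..<N}" by (auto simp: P_def)
  have sumP: "(\<Sum>k\<in>P. f k) = (\<Sum>k<N. f k)" if "\<And>k. k < N \<Longrightarrow> u k = 0 \<Longrightarrow> f k = 0" for f :: "nat \<Rightarrow> real"
    using that u0 by (intro sum.mono_neutral_left) (force simp: P_def less_le)+
  have M_eq: "M = (\<Sum>k\<in>P. u k powr s)" using u0 by (subst sumP) (auto simp: M_def F_def)
  have first_order: "(\<Sum>k\<in>P. v k * u k powr (s - 1)) \<le> M" if v: "v \<in> S" for v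
  proof -
    define g where "g t = (\<Sum>k\<in>P. (u k + t * (v k - u k)) powr s)" for t
    \<comment> \<open>The derivative at \<open>u\<close>, towards \<open>v\<close>, of the part of
      \<open>F\<close> over \<open>P\<close>. Maximality forces it to be at most 0, and it is s
      times the difference of the two sides of the claim.\<close>
    define D where "D = (\<Sum>k\<in>P. s * u k powr (s - 1) * (v k - u k))"
    have "(g has_real_derivative D) (at 0)"
      unfolding g_def D_def
      by (rule DERIV_sum) (auto intro!: derivative_eq_intros simp: P_def)
    moreover have "g t \<le> g 0" if t: "0 \<le> t" "t \<le> 1" for t
    proof -
      have "g t = (\<Sum>k\<in>P. \<bar>(1 - t) * u k + t * v k\<bar> powr s)"
        unfolding g_def
      proof (intro sum.cong refl arg_cong[where f = "\<lambda>x. x powr s"])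
        fix k
        have "0 \<le> (1 - t) * u k + t * v k" using t u0[of k] nonneg[OF v, of k] by simp
        then show "u k + t * (v k - u k) = \<bar>(1 - t) * u k + t * v k\<bar>" by (simp add: algebra_simps)
      qed
      also have "\<dots> \<le> F (\<lambda>k. (1 - t) * u k + t * v k)"
        unfolding F_def using P by (intro sum_mono2) auto
      also have "\<dots> \<le> M" using line[OF v] t by simp
      finally show ?thesis by (simp add: g_def M_eq)
    qed
    ultimately have "D \<le> 0"
      using DERIV_pos_inc_right[of g D 0]
      by (metis add_0 dual_order.strict_iff_not field_lbound_gt_zero not_le order_less_imp_le zero_less_one)
    moreover have "D = s * ((\<Sum>k\<in>P. v k * u k powr (s - 1)) - M)"
    proof -
      have "u k powr (s - 1) * u k = u k powr s" if "k \<in> P" for k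
        using that powr_add[of "u k" "s - 1" 1] by (simp add: P_def)
      then have "D = (\<Sum>k\<in>P. s * (v k * u k powr (s - 1) - u k powr s))"
        unfolding D_def by (intro sum.cong refl) (simp add: algebra_simps)
      then show ?thesis by (simp add: M_eq sum_subtractf flip: sum_distrib_left)
    qed
    ultimately show ?thesis using s by (simp add: mult_le_0_iff)
  qed
  show ?thesis
  \<comment> \<open>The weights are the normalised terms of F u. With them \<kappa>^(1 - 2/q)
    becomes M^(1/s - 1) u^(s - 1), and the first-order condition gives the bound M^(1/s). If M = 0,
    division by zero makes all weights 0.\<close>
  proof (rule that[of "\<lambda>k. u k powr s / M"])
    show "0 \<le> u k powr s / M" for k using M0 by simp
    have M_sum: "(\<Sum>k<N. u k powr s) = M" using u0 by (simp add: M_def F_def)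
    show "(\<Sum>k<N. u k powr s / M) \<le> 1"
      by (simp add: M_sum flip: sum_divide_distrib)
    show "v k = 0" if "v \<in> S" "k < N" "u k powr s / M = 0" for v k
    proof -
      have "u k = 0"
      proof (cases "M = 0")
        case True
        then have "u k powr s = 0" using M_sum that(2) sum_nonneg_eq_0_iff[of "{..<N}" "\<lambda>k. u k powr s"] by simp
        then show ?thesis by simp
      next
        case False
        then show ?thesis using that(3) by simp
      qed
      then show ?thesis using zero that by blast
    qed
    fix v assume v: "v \<in> S"
    show "(\<Sum>k<N. v k * (u k powr s / M) powr (1 - 2 / q)) \<le> C powr (2 / q)"
    proof (cases "M = 0")
      case True
      then show ?thesis by simp
    next
      case False
      then have M: "0 < M" using M0 by simp
      have "v k * (u k powr s / M) powr (1 - 2 / q) = M powr (1 / s - 1) * (v k * u k powr (s - 1))" for k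
      proof -
        have "(u k powr s / M) powr (1 - 2 / q) = (u k powr s) powr (1 - 1 / s) / M powr (1 - 1 / s)"
          unfolding s(3) by (rule powr_divide)
        also have "(u k powr s) powr (1 - 1 / s) = u k powr (s - 1)"
          using s by (simp add: powr_powr right_diff_distrib)
        also have "u k powr (s - 1) / M powr (1 - 1 / s) = M powr (1 / s - 1) * u k powr (s - 1)"
          using powr_minus_divide[of M "1 - 1 / s"] by simp
        finally show ?thesis by simp
      qed
      then have "(\<Sum>k<N. v k * (u k powr s / M) powr (1 - 2 / q))
          = M powr (1 / s - 1) * (\<Sum>k<N. v k * u k powr (s - 1))"
        by (simp only: sum_distrib_left)
      also have "\<dots> = M powr (1 / s - 1) * (\<Sum>k\<in>P. v k * u k powr (s - 1))"
        by (subst sumP) auto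
      also have "\<dots> \<le> M powr (1 / s - 1) * M"
        using first_order[OF v] by (intro mult_left_mono) auto
      also have "\<dots> = M powr (1 / s)" using M by (simp add: powr_diff)
      also have "\<dots> \<le> C powr (2 / q)" using M MC s by (simp add: powr_mono2)
      finally show ?thesis .
    qed
  qed
qed

section \<open>Factorization through l_2 from type 2\<close>

lemma sum_lessThan_add: "(\<Sum>i<n + n'. f i) = (\<Sum>i<n. f i) + (\<Sum>i<n'. f (n + i))"
  for f :: "nat \<Rightarrow> 'a::comm_monoid_add"
  by (induction n') (simp_all add: add.assoc)

text \<open>Compares the q-th moment with the second at the cost of a factor 2, in place of
  Hoelder's inequality for expectations.\<close>

lemma powr_le_one_plus_square:
  fixes t q :: real
  assumes "0 \<le> t" "0 < q" "q \<le> 2"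
  shows "t powr q \<le> 1 + t\<^sup>2"
proof (cases "t \<le> 1")
  case True
  then have "t powr q \<le> 1" using assms by (simp add: powr_le1)
  then show ?thesis by (smt (verit) zero_le_power2)
next
  case False
  then have "t powr q \<le> t powr 2" using assms by (intro powr_mono) auto
  then show ?thesis using False by simp
qed

text \<open>The square functions of finite families with sum of squared norms at most 1 form a
  convex set, and Khintchine together with type 2 bounds the sums of their (q/2)-th powers, so
  \<open>optimal_weights\<close> applies; one-term families give the conclusion. Coordinates of
  weight 0 get a clause of their own because \<open>0 powr e = 0\<close> removes them from the
  weighted sum. The laws of the space are listed one by one so that the seminorm in
  \<open>l2_into_lq_factor\<close> is covered as well as a dual norm.\<close>

lemma maurey_factorization:
  fixes X :: "('k::real_or_complex, 'a::ab_group_add) nspace" and T :: "'a \<Rightarrow> nat \<Rightarrow> 'k"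
    and N :: nat and q B R :: real
  assumes q: "0 < q" "q < 2" and "0 \<le> B" "0 < R"
    and type2: "\<And>m x. (\<And>j. j < m \<Longrightarrow> x j \<in> car X) \<Longrightarrow>
       measure_pmf.expectation (rademacher m) (\<lambda>\<epsilon>. (nrm X (\<Sum>j<m. scl X (\<epsilon> j) (x j)))\<^sup>2)
         \<le> R\<^sup>2 * (\<Sum>j<m. (nrm X (x j))\<^sup>2)"
    and zero: "0 \<in> car X" "\<And>k. T 0 k = 0"
    and add: "\<And>x y. x \<in> car X \<Longrightarrow> y \<in> car X \<Longrightarrow> x + y \<in> car X"
      "\<And>x y k. x \<in> car X \<Longrightarrow> y \<in> car X \<Longrightarrow> T (x + y) k = T x k + T y k"
    and scl: "\<And>c x. x \<in> car X \<Longrightarrow> scl X c x \<in> car X"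
      "\<And>c x k. x \<in> car X \<Longrightarrow> T (scl X c x) k = c * T x k"
    and nrm: "\<And>x. x \<in> car X \<Longrightarrow> 0 \<le> nrm X x"
      "\<And>c x. x \<in> car X \<Longrightarrow> nrm X (scl X c x) \<le> norm c * nrm X x"
    and bounded: "\<And>x. x \<in> car X \<Longrightarrow> (\<Sum>k<N. norm (T x k) powr q) \<le> (B * nrm X x) powr q"
  obtains \<kappa> :: "nat \<Rightarrow> real" where "\<And>k. 0 \<le> \<kappa> k" "(\<Sum>k<N. \<kappa> k) \<le> 1"
    "\<And>x k. x \<in> car X \<Longrightarrow> nrm X x \<le> 1 \<Longrightarrow> k < N \<Longrightarrow> \<kappa> k = 0 \<Longrightarrow> T x k = 0"
    "\<And>x. x \<in> car X \<Longrightarrow> nrm X x \<le> 1 \<Longrightarrow>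
       (\<Sum>k<N. (norm (T x k))\<^sup>2 * \<kappa> k powr (1 - 2 / q)) \<le> 8 powr (2 / q) * (B * R)\<^sup>2"
proof -
  \<comment> \<open>The value 0 from N on is what the support condition of
    \<open>optimal_weights\<close> asks for. The length n of the family is left free so that
    families can be concatenated.\<close>
  define sq where "sq n \<phi> k = (if k < N then \<Sum>i<n. (norm (T (\<phi> i) k))\<^sup>2 else 0)" for n :: nat and \<phi> k
  define S where "S = {sq n \<phi> | n \<phi>. (\<forall>i<n. \<phi> i \<in> car X) \<and> (\<Sum>i<n. (nrm X (\<phi> i))\<^sup>2) \<le> 1}"
  have bound: "(\<Sum>k<N. v k powr (q / 2)) \<le> 8 * (B * R) powr q" if "v \<in> S" for v
  proof -
    obtain n \<phi> where \<phi>: "\<And>i. i < n \<Longrightarrow> \<phi> i \<in> car X" "(\<Sum>i<n. (nrm X (\<phi> i))\<^sup>2) \<le> 1" and v: "v = sq n \<phi>"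
      using \<open>v \<in> S\<close> by (auto simp: S_def)
    let ?E = "measure_pmf.expectation (rademacher n)" and ?z = "\<lambda>\<epsilon>. \<Sum>i<n. scl X (\<epsilon> i) (\<phi> i)"
    have z: "(\<Sum>i<m. scl X (\<epsilon> i) (\<phi> i)) \<in> car X
        \<and> (\<forall>k. T (\<Sum>i<m. scl X (\<epsilon> i) (\<phi> i)) k = (\<Sum>i<m. \<epsilon> i * T (\<phi> i) k))"
      if "m \<le> n" for \<epsilon> m
      using that by (induction m) (auto simp: zero add scl \<phi>)
    have "(\<Sum>k<N. v k powr (q / 2)) = (\<Sum>k<N. (\<Sum>i<n. (norm (T (\<phi> i) k))\<^sup>2) powr (q / 2))"
      by (simp add: v sq_def)
    also have "\<dots> \<le> (\<Sum>k<N. 4 * ?E (\<lambda>\<epsilon>. norm (\<Sum>i<n. \<epsilon> i * T (\<phi> i) k) powr q))"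
      using q by (intro sum_mono khinchine) auto
    also have "\<dots> = 4 * ?E (\<lambda>\<epsilon>. \<Sum>k<N. norm (T (?z \<epsilon>) k) powr q)"
      using z[of n] by (simp add: sum_distrib_left)
    also have "?E (\<lambda>\<epsilon>. \<Sum>k<N. norm (T (?z \<epsilon>) k) powr q)
        \<le> ?E (\<lambda>\<epsilon>. (B * R) powr q * (1 + (nrm X (?z \<epsilon>))\<^sup>2 / R\<^sup>2))"
    proof (rule expectation_rademacher_mono)
      fix \<epsilon> :: "nat \<Rightarrow> 'k"
      have zc: "?z \<epsilon> \<in> car X" using z[of n] by simp
      \<comment> \<open>Dividing by R makes the second moment of the norm at most 1, so that the
        moment comparison costs exactly the factor 2.\<close>
      have "(\<Sum>k<N. norm (T (?z \<epsilon>) k) powr q) \<le> ((B * R) * (nrm X (?z \<epsilon>) / R)) powr q"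
        using bounded[OF zc] \<open>0 < R\<close> by simp
      also have "\<dots> = (B * R) powr q * (nrm X (?z \<epsilon>) / R) powr q"
        by (rule powr_mult)
      also have "\<dots> \<le> (B * R) powr q * (1 + (nrm X (?z \<epsilon>) / R)\<^sup>2)"
        using \<open>0 < R\<close> nrm(1)[OF zc] q by (intro mult_left_mono powr_le_one_plus_square) auto
      finally show "(\<Sum>k<N. norm (T (?z \<epsilon>) k) powr q) \<le> (B * R) powr q * (1 + (nrm X (?z \<epsilon>))\<^sup>2 / R\<^sup>2)"
        by (simp add: power_divide)
    qed
    also have "\<dots> = (B * R) powr q * (1 + ?E (\<lambda>\<epsilon>. (nrm X (?z \<epsilon>))\<^sup>2) / R\<^sup>2)"
      by simp
    also have "\<dots> \<le> (B * R) powr q * 2"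
    proof -
      have "?E (\<lambda>\<epsilon>. (nrm X (?z \<epsilon>))\<^sup>2) \<le> R\<^sup>2 * (\<Sum>i<n. (nrm X (\<phi> i))\<^sup>2)"
        by (intro type2 \<phi>)
      also have "\<dots> \<le> R\<^sup>2 * 1" using \<phi>(2) by (intro mult_left_mono) auto
      finally show ?thesis using \<open>0 < R\<close> by (intro mult_left_mono) auto
    qed
    finally show ?thesis by simp
  qed
  have conv: "(\<lambda>k. (1 - t) * v k + t * w k) \<in> S" if "v \<in> S" "w \<in> S" and t: "0 \<le> t" "t \<le> 1" for v w t
  proof -
    obtain n \<phi> where \<phi>: "\<And>i. i < n \<Longrightarrow> \<phi> i \<in> car X" "(\<Sum>i<n. (nrm X (\<phi> i))\<^sup>2) \<le> 1" and v: "v = sq n \<phi>"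
      using \<open>v \<in> S\<close> by (auto simp: S_def)
    obtain n' \<psi> where \<psi>: "\<And>i. i < n' \<Longrightarrow> \<psi> i \<in> car X" "(\<Sum>i<n'. (nrm X (\<psi> i))\<^sup>2) \<le> 1" and w: "w = sq n' \<psi>"
      using \<open>w \<in> S\<close> by (auto simp: S_def)
    \<comment> \<open>Concatenation with factors sqrt (1 - t) and sqrt t; squaring turns these into
      the coefficients of the convex combination.\<close>
    define \<eta> where "\<eta> i = (if i < n then scl X (of_real (sqrt (1 - t))) (\<phi> i)
      else scl X (of_real (sqrt t)) (\<psi> (i - n)))" for i
    have \<eta>: "\<forall>i<n + n'. \<eta> i \<in> car X" using \<phi>(1) \<psi>(1) by (auto simp: \<eta>_def scl)
    have sqn: "(nrm X (scl X (of_real (sqrt s)) x))\<^sup>2 \<le> s * (nrm X x)\<^sup>2" if "0 \<le> s" "x \<in> car X" for s x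
    proof -
      have "(nrm X (scl X (of_real (sqrt s)) x))\<^sup>2 \<le> (sqrt s * nrm X x)\<^sup>2"
        using nrm(2)[OF that(2), of "of_real (sqrt s)"] nrm(1)[OF scl(1)[OF that(2)]] that(1)
        by (intro power_mono) auto
      then show ?thesis using that(1) by (simp add: power_mult_distrib)
    qed
    have "(\<Sum>i<n + n'. (nrm X (\<eta> i))\<^sup>2) \<le> (\<Sum>i<n. (1 - t) * (nrm X (\<phi> i))\<^sup>2) + (\<Sum>i<n'. t * (nrm X (\<psi> i))\<^sup>2)"
      unfolding sum_lessThan_add using t \<phi>(1) \<psi>(1)
      by (intro add_mono sum_mono) (auto simp: \<eta>_def intro!: sqn)
    also have "\<dots> \<le> (1 - t) * 1 + t * 1"
      unfolding sum_distrib_left[symmetric] using t \<phi>(2) \<psi>(2) by (intro add_mono mult_left_mono) auto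
    finally have "(\<Sum>i<n + n'. (nrm X (\<eta> i))\<^sup>2) \<le> 1" by simp
    moreover have "(\<lambda>k. (1 - t) * v k + t * w k) = sq (n + n') \<eta>"
      using t \<phi>(1) \<psi>(1)
      by (auto simp: fun_eq_iff v w sq_def \<eta>_def sum_lessThan_add scl norm_mult power_mult_distrib sum_distrib_left)
    ultimately show ?thesis using \<eta> unfolding S_def by blast
  qed
  obtain \<kappa> :: "nat \<Rightarrow> real" where \<kappa>: "\<And>k. 0 \<le> \<kappa> k" "(\<Sum>k<N. \<kappa> k) \<le> 1"
    "\<And>v k. v \<in> S \<Longrightarrow> k < N \<Longrightarrow> \<kappa> k = 0 \<Longrightarrow> v k = 0"
    "\<And>v. v \<in> S \<Longrightarrow> (\<Sum>k<N. v k * \<kappa> k powr (1 - 2 / q)) \<le> (8 * (B * R) powr q) powr (2 / q)"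
    by (rule optimal_weights[OF q _ conv _ _ bound])
       (auto simp: S_def sq_def intro!: sum_nonneg)
  have single: "sq 1 (\<lambda>_. x) \<in> S" if "x \<in> car X" "nrm X x \<le> 1" for x
    unfolding S_def using that nrm(1)[OF that(1)] by (auto intro!: exI[of _ 1] exI[of _ "\<lambda>_. x"] simp: power_le_one)
  have const: "(8 * (B * R) powr q) powr (2 / q) = 8 powr (2 / q) * (B * R)\<^sup>2"
    using q \<open>0 \<le> B\<close> \<open>0 < R\<close> by (simp add: powr_mult powr_powr power_mult_distrib)
  show ?thesis
  proof (rule that[OF \<kappa>(1,2)])
    show "T x k = 0" if "x \<in> car X" "nrm X x \<le> 1" "k < N" "\<kappa> k = 0" for x k
      using \<kappa>(3)[OF single[OF that(1,2)] that(3,4)] that(3) by (simp add: sq_def)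
    show "(\<Sum>k<N. (norm (T x k))\<^sup>2 * \<kappa> k powr (1 - 2 / q)) \<le> 8 powr (2 / q) * (B * R)\<^sup>2"
      if "x \<in> car X" "nrm X x \<le> 1" for x
      using \<kappa>(4)[OF single[OF that]] by (simp add: sq_def const)
  qed
qed

section \<open>Duals and bilinear forms on normed spaces\<close>

lemma normed_spaceD:
  assumes "normed_space X"
  shows "0 \<in> car X" "\<And>x y. x \<in> car X \<Longrightarrow> y \<in> car X \<Longrightarrow> x + y \<in> car X"
    "\<And>x y. x \<in> car X \<Longrightarrow> y \<in> car X \<Longrightarrow> x - y \<in> car X"
    "\<And>c x. x \<in> car X \<Longrightarrow> scl X c x \<in> car X" "\<And>x. x \<in> car X \<Longrightarrow> 0 \<le> nrm X x"
    "\<And>x. x \<in> car X \<Longrightarrow> nrm X x = 0 \<longleftrightarrow> x = 0" "nrm X 0 = 0"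
    "\<And>c x. x \<in> car X \<Longrightarrow> nrm X (scl X c x) = norm c * nrm X x" "scl X 0 x = 0"
    "scl X (- 1) x = - x"
proof -
  interpret vector_space "scl X"
    using assms by (simp add: normed_space_def)
  have sub: "subspace (car X)" using assms by (simp add: normed_space_def)
  show "0 \<in> car X" using sub by (simp add: subspace_0)
  then show "nrm X 0 = 0" using assms by (simp add: normed_space_def)
  show "\<And>x y. x \<in> car X \<Longrightarrow> y \<in> car X \<Longrightarrow> x + y \<in> car X"
    "\<And>x y. x \<in> car X \<Longrightarrow> y \<in> car X \<Longrightarrow> x - y \<in> car X"
    "\<And>c x. x \<in> car X \<Longrightarrow> scl X c x \<in> car X"
    using sub by (simp_all add: subspace_add subspace_diff subspace_scale)
  show "scl X 0 x = 0" "scl X (- 1) x = - x"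
    by simp_all
qed (use assms in \<open>auto simp: normed_space_def\<close>)

lemma norm_topology_ball:
  assumes X: "normed_space X" and U: "openin (norm_topology X) U" "x \<in> U"
  obtains r where "0 < r" "\<And>y. y \<in> car X \<Longrightarrow> nrm X (x - y) < r \<Longrightarrow> y \<in> U"
proof -
  interpret Metric_space "car X" "ndist X" using X by (rule normed_space_Metric_space)
  obtain r where r: "0 < r" "mball x r \<subseteq> U" and x: "x \<in> car X"
    using U unfolding norm_topology_def openin_mtopology by blast
  show ?thesis
    by (rule that[OF r(1)]) (use r(2) x in \<open>auto simp: subset_iff ndist_def\<close>)
qed

lemma openin_norm_ball:
  assumes X: "normed_space X" and "x \<in> car X"
  shows "openin (norm_topology X) {y \<in> car X. nrm X (x - y) < r}"
proof -
  interpret Metric_space "car X" "ndist X" using X by (rule normed_space_Metric_space)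
  have "mball x r = {y \<in> car X. nrm X (x - y) < r}"
    using assms(2) by (auto simp: ndist_def)
  then show ?thesis unfolding norm_topology_def using openin_mball[of x r] by simp
qed

lemma topspace_norm_topology [simp]:
  "normed_space X \<Longrightarrow> topspace (norm_topology X) = car X"
  by (simp add: norm_topology_def Metric_space.topspace_mtopology normed_space_Metric_space)

text \<open>Carries a bound on a small ball over to all vectors by homogeneity; the factor 2 puts
  the scaled vector strictly inside the ball.\<close>

lemma normalise_below:
  fixes X :: "('k::real_or_complex, 'a::ab_group_add) nspace"
  assumes X: "normed_space X" and x: "x \<in> car X" "x \<noteq> 0" and "0 < r"
  obtains c :: 'k where "c \<noteq> 0" "norm c = r / (2 * nrm X x)" "scl X c x \<in> car X" "nrm X (scl X c x) < r"
proof -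
  have pos: "0 < nrm X x" using normed_spaceD(5,6)[OF X x(1)] x(2) by simp
  show ?thesis
    by (rule that[of "of_real (r / (2 * nrm X x))"])
       (use pos \<open>0 < r\<close> x in \<open>auto simp: normed_spaceD(4,8)[OF X] norm_divide\<close>)
qed

lemma nrm_minus:
  assumes "normed_space X" "x \<in> car X"
  shows "nrm X (- x) = nrm X x"
  using normed_spaceD(8)[OF assms, of "- 1"] normed_spaceD(10)[OF assms(1), of x] by simp

lemma linear_form_bounded:
  fixes f :: "'a::ab_group_add \<Rightarrow> 'k::real_or_complex"
  assumes X: "normed_space X" and f: "\<And>c x. x \<in> car X \<Longrightarrow> f (scl X c x) = c * f x"
    and cont: "continuous_map (norm_topology X) euclidean f"
  obtains M where "0 < M" "\<And>x. x \<in> car X \<Longrightarrow> norm (f x) \<le> M * nrm X x"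
proof -
  have f0: "f 0 = 0" using f[of 0 0] normed_spaceD(1,9)[OF X] by simp
  have "openin (norm_topology X) {x \<in> car X. f x \<in> ball 0 1}"
    using openin_continuous_map_preimage[OF cont, of "ball 0 1"] X by simp
  then obtain r where r: "0 < r" "\<And>y. y \<in> car X \<Longrightarrow> nrm X (0 - y) < r \<Longrightarrow> y \<in> {x \<in> car X. f x \<in> ball 0 1}"
    using norm_topology_ball[OF X, of "{x \<in> car X. f x \<in> ball 0 1}" 0] f0 normed_spaceD(1)[OF X]
    by (metis (mono_tags, lifting) centre_in_ball mem_Collect_eq zero_less_one)
  show ?thesis
  proof (rule that[of "2 / r"])
    fix x assume x: "x \<in> car X"
    show "norm (f x) \<le> 2 / r * nrm X x"
    proof (cases "x = 0")
      case True
      then show ?thesis using f0 normed_spaceD(7)[OF X] by simp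
    next
      case False
      obtain c where c: "c \<noteq> 0" "norm c = r / (2 * nrm X x)" "scl X c x \<in> car X" "nrm X (scl X c x) < r"
        using normalise_below[OF X x False r(1)] .
      have "norm (c * f x) < 1"
        using r(2)[OF c(3)] c(4) f[OF x, of c] nrm_minus[OF X c(3)] by simp
      moreover have "0 < nrm X x" using normed_spaceD(5,6)[OF X x] False by simp
      ultimately show ?thesis using c(2) r(1) by (simp add: norm_mult field_simps)
    qed
  qed (use r in simp)
qed

lemma linear_form_continuous:
  fixes f :: "'a::ab_group_add \<Rightarrow> 'k::real_or_complex"
  assumes X: "normed_space X" and add: "\<And>x y. x \<in> car X \<Longrightarrow> y \<in> car X \<Longrightarrow> f (x + y) = f x + f y"
    and bd: "\<And>x. x \<in> car X \<Longrightarrow> norm (f x) \<le> M * nrm X x"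
  shows "continuous_map (norm_topology X) euclidean f"
  unfolding mtopology_is_euclidean[symmetric] Met_TC.continuous_map_to_metric
proof (intro ballI allI impI)
  fix x and \<epsilon> :: real assume "x \<in> topspace (norm_topology X)" and \<epsilon>: "0 < \<epsilon>"
  then have x: "x \<in> car X" using X by simp
  \<comment> \<open>\<open>\<bar>M\<bar> + 1\<close> is positive whatever the sign of
    \<open>M\<close>.\<close>
  let ?U = "{y \<in> car X. nrm X (x - y) < \<epsilon> / (\<bar>M\<bar> + 1)}"
  have "dist (f x) (f y) < \<epsilon>" if "y \<in> ?U" for y
  proof -
    have y: "y \<in> car X" "nrm X (x - y) < \<epsilon> / (\<bar>M\<bar> + 1)" using that by auto
    have d: "x - y \<in> car X" using normed_spaceD(3)[OF X x y(1)] .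
    have "f x = f (x - y) + f y" using add[OF d y(1)] by simp
    then have "dist (f x) (f y) = norm (f (x - y))" by (simp add: dist_norm)
    also have "\<dots> \<le> M * nrm X (x - y)" by (rule bd[OF d])
    also have "\<dots> \<le> (\<bar>M\<bar> + 1) * nrm X (x - y)"
      using normed_spaceD(5)[OF X d] by (intro mult_right_mono) auto
    also have "\<dots> < \<epsilon>" using y(2) by (simp add: field_simps add_pos_nonneg pos_less_divide_eq)
    finally show ?thesis .
  qed
  moreover have "x \<in> ?U" using x \<epsilon> normed_spaceD(7)[OF X] by simp
  ultimately show "\<exists>U. openin (norm_topology X) U \<and> x \<in> U \<and> (\<forall>y\<in>U. f y \<in> Met_TC.mball (f x) \<epsilon>)"
    using openin_norm_ball[OF X x] by (intro exI[of _ ?U]) auto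
qed

section \<open>The dual norm and weak norms\<close>

lemma dual_memD:
  assumes "\<phi> \<in> car (dual X)"
  shows "\<And>x y. x \<in> car X \<Longrightarrow> y \<in> car X \<Longrightarrow> \<phi> (x + y) = \<phi> x + \<phi> y"
    "\<And>c x. x \<in> car X \<Longrightarrow> \<phi> (scl X c x) = c * \<phi> x"
    "continuous_map (norm_topology X) euclidean \<phi>" "\<And>x. x \<notin> car X \<Longrightarrow> \<phi> x = 0"
  using assms by (auto simp: dual_def)

lemma dual_bdd_above:
  assumes X: "normed_space X" and \<phi>: "\<phi> \<in> car (dual X)"
  shows "bdd_above ((\<lambda>x. norm (\<phi> x)) ` unit_ball X)"
proof -
  obtain M where M: "0 < M" "\<And>x. x \<in> car X \<Longrightarrow> norm (\<phi> x) \<le> M * nrm X x"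
    using linear_form_bounded[OF X dual_memD(2,3)[OF \<phi>]] by blast
  show ?thesis
  proof (rule bdd_aboveI2[of _ _ M])
    fix x assume "x \<in> unit_ball X"
    then have x: "x \<in> car X" "nrm X x \<le> 1" by (auto simp: unit_ball_def)
    have "norm (\<phi> x) \<le> M * nrm X x" using M(2) x(1) .
    also have "\<dots> \<le> M * 1" using x(2) M(1) by (intro mult_left_mono) auto
    finally show "norm (\<phi> x) \<le> M" by simp
  qed
qed

lemma zero_in_unit_ball: "normed_space X \<Longrightarrow> 0 \<in> unit_ball X"
  by (simp add: unit_ball_def normed_spaceD)

lemma nrm_dual: "nrm (dual X) \<phi> = (SUP x\<in>unit_ball X. norm (\<phi> x))"
  by (simp add: dual_def)

lemma nrm_dual_nonneg:
  assumes "normed_space X" "\<phi> \<in> car (dual X)"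
  shows "0 \<le> nrm (dual X) \<phi>"
  unfolding nrm_dual
  using cSUP_upper[OF zero_in_unit_ball[OF assms(1)] dual_bdd_above[OF assms]]
  by (rule order_trans[OF norm_ge_zero])

lemma dual_bound:
  assumes X: "normed_space X" and \<phi>: "\<phi> \<in> car (dual X)" and x: "x \<in> car X"
  shows "norm (\<phi> x) \<le> nrm (dual X) \<phi> * nrm X x"
proof (cases "x = 0")
  case True
  have "\<phi> 0 = 0"
    using dual_memD(2)[OF \<phi>, of 0 0] normed_spaceD(1,9)[OF X] by simp
  then show ?thesis using True normed_spaceD(7)[OF X] by simp
next
  case False
  then have pos: "0 < nrm X x" using normed_spaceD(5,6)[OF X x] by simp
  have "scl X (of_real (1 / nrm X x)) x \<in> unit_ball X"
    using pos x by (simp add: unit_ball_def normed_spaceD(4,8)[OF X] norm_divide)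
  from cSUP_upper[OF this dual_bdd_above[OF X \<phi>]]
  have "norm (of_real (1 / nrm X x) * \<phi> x) \<le> nrm (dual X) \<phi>"
    by (simp add: nrm_dual dual_memD(2)[OF \<phi> x])
  then show ?thesis using pos by (simp add: norm_mult norm_divide field_simps)
qed

lemma dual_nrm_le:
  assumes "normed_space X" "\<And>x. x \<in> unit_ball X \<Longrightarrow> norm (\<phi> x) \<le> M"
  shows "nrm (dual X) \<phi> \<le> M"
  unfolding nrm_dual using zero_in_unit_ball[OF assms(1)] assms(2) by (intro cSUP_least) auto

lemma dual_memI:
  fixes f :: "'a::ab_group_add \<Rightarrow> 'k::real_or_complex"
  assumes X: "normed_space X" and add: "\<And>x y. x \<in> car X \<Longrightarrow> y \<in> car X \<Longrightarrow> f (x + y) = f x + f y"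
    and scl: "\<And>c x. x \<in> car X \<Longrightarrow> f (scl X c x) = c * f x"
    and bd: "\<And>x. x \<in> car X \<Longrightarrow> norm (f x) \<le> M * nrm X x" and "0 \<le> M"
    and off: "\<And>x. x \<notin> car X \<Longrightarrow> f x = 0"
  shows "f \<in> car (dual X)" "nrm (dual X) f \<le> M"
proof -
  show "f \<in> car (dual X)"
    using add scl off linear_form_continuous[OF X add bd] by (simp add: dual_def)
  show "nrm (dual X) f \<le> M"
  proof (rule dual_nrm_le[OF X])
    fix x assume "x \<in> unit_ball X"
    then have x: "x \<in> car X" "nrm X x \<le> 1" by (auto simp: unit_ball_def)
    have "norm (f x) \<le> M * nrm X x" by (rule bd[OF x(1)])
    also have "\<dots> \<le> M" using x(2) \<open>0 \<le> M\<close> by (simp add: mult_left_le)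
    finally show "norm (f x) \<le> M" .
  qed
qed

lemma dual_zero: "normed_space X \<Longrightarrow> 0 \<in> car (dual X)"
  by (rule dual_memI[where M = 0]) (auto simp: normed_spaceD)

lemma dual_add:
  assumes X: "normed_space X" and \<phi>: "\<phi> \<in> car (dual X)" and \<psi>: "\<psi> \<in> car (dual X)"
  shows "\<phi> + \<psi> \<in> car (dual X)"
proof (rule dual_memI[OF X])
  show "norm ((\<phi> + \<psi>) x) \<le> (nrm (dual X) \<phi> + nrm (dual X) \<psi>) * nrm X x" if x: "x \<in> car X" for x
    using norm_triangle_ineq[of "\<phi> x" "\<psi> x"] dual_bound[OF X \<phi> x] dual_bound[OF X \<psi> x]
    by (simp add: distrib_right)
  show "0 \<le> nrm (dual X) \<phi> + nrm (dual X) \<psi>"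
    by (simp add: nrm_dual_nonneg[OF X] \<phi> \<psi>)
qed (auto simp: dual_memD[OF \<phi>] dual_memD[OF \<psi>] algebra_simps)

lemma dual_scl:
  assumes X: "normed_space X" and \<phi>: "\<phi> \<in> car (dual X)"
  shows "scl (dual X) c \<phi> \<in> car (dual X)"
    and "nrm (dual X) (scl (dual X) c \<phi>) \<le> norm c * nrm (dual X) \<phi>"
proof -
  have eq: "scl (dual X) c \<phi> = (\<lambda>x. c * \<phi> x)" by (simp add: dual_def)
  have "norm (c * \<phi> x) \<le> (norm c * nrm (dual X) \<phi>) * nrm X x" if x: "x \<in> car X" for x
    using mult_left_mono[OF dual_bound[OF X \<phi> x], of "norm c"] by (simp add: norm_mult mult.assoc)
  then show "scl (dual X) c \<phi> \<in> car (dual X)" "nrm (dual X) (scl (dual X) c \<phi>) \<le> norm c * nrm (dual X) \<phi>"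
    unfolding eq using nrm_dual_nonneg[OF X \<phi>]
    by (intro dual_memI[OF X, where M = "norm c * nrm (dual X) \<phi>"];
        simp add: dual_memD[OF \<phi>] algebra_simps)+
qed

text \<open>A real supremum dominates its members only if they are bounded above; here the
  corresponding sum of the norms of the x j is a bound.\<close>

lemma weak_norm_upper:
  assumes X: "normed_space X" and x: "\<And>j. j < m \<Longrightarrow> x j \<in> car X"
    and \<phi>: "\<phi> \<in> car (dual X)" "nrm (dual X) \<phi> \<le> 1" and "0 < q"
  shows "(\<Sum>j<m. norm (\<phi> (x j)) powr q) powr (1 / q) \<le> weak_norm q X m x"
  unfolding weak_norm_def
proof (rule cSUP_upper)
  show "\<phi> \<in> unit_ball (dual X)" using \<phi> by (simp add: unit_ball_def)
  show "bdd_above ((\<lambda>\<phi>. (\<Sum>j<m. norm (\<phi> (x j)) powr q) powr (1 / q)) ` unit_ball (dual X))"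
  proof (rule bdd_aboveI2)
    fix \<psi> assume "\<psi> \<in> unit_ball (dual X)"
    then have \<psi>: "\<psi> \<in> car (dual X)" "nrm (dual X) \<psi> \<le> 1" by (auto simp: unit_ball_def)
    have "norm (\<psi> (x j)) \<le> nrm X (x j)" if "j < m" for j
      using dual_bound[OF X \<psi>(1) x[OF that]] \<psi>(2) normed_spaceD(5)[OF X x[OF that]]
      by (meson mult_left_le_one_le nrm_dual_nonneg[OF X \<psi>(1)] order_trans)
    then show "(\<Sum>j<m. norm (\<psi> (x j)) powr q) powr (1 / q) \<le> (\<Sum>j<m. nrm X (x j) powr q) powr (1 / q)"
      using \<open>0 < q\<close> by (intro powr_mono2 sum_mono) (auto intro!: sum_nonneg)
  qed
qed

lemma weak_norm_nonneg:
  assumes "normed_space X" "\<And>j. j < m \<Longrightarrow> x j \<in> car X" "0 < q"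
  shows "0 \<le> weak_norm q X m x"
proof -
  have "nrm (dual X) 0 \<le> 1" using assms(1) by (rule dual_nrm_le) simp
  from weak_norm_upper[OF assms(1,2) dual_zero[OF assms(1)] this assms(3)]
  show ?thesis by (meson order_trans powr_ge_zero)
qed

section \<open>Boundedness and joint continuity of bilinear forms\<close>

lemma bilinear_form_bounded:
  assumes X: "normed_space X" and Y: "normed_space Y" and A: "A \<in> bilinear_forms X Y"
  obtains M where "0 < M" "\<And>x y. x \<in> car X \<Longrightarrow> y \<in> car Y \<Longrightarrow> norm (A (x, y)) \<le> M * nrm X x * nrm Y y"
proof -
  have scl1: "\<And>c x y. x \<in> car X \<Longrightarrow> y \<in> car Y \<Longrightarrow> A (scl X c x, y) = c * A (x, y)"
    and scl2: "\<And>c x y. x \<in> car X \<Longrightarrow> y \<in> car Y \<Longrightarrow> A (x, scl Y c y) = c * A (x, y)"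
    and cont: "continuous_map (prod_topology (norm_topology X) (norm_topology Y)) euclidean A"
    using A by (auto simp: bilinear_forms_def)
  have A1: "A (0, y) = 0" if "y \<in> car Y" for y
    using scl1[OF normed_spaceD(1)[OF X] that, of 0] normed_spaceD(9)[OF X] by simp
  have A2: "A (x, 0) = 0" if "x \<in> car X" for x
    using scl2[OF that normed_spaceD(1)[OF Y], of 0] normed_spaceD(9)[OF Y] by simp
  let ?V = "{z \<in> car X \<times> car Y. A z \<in> ball 0 1}"
  have "openin (prod_topology (norm_topology X) (norm_topology Y)) ?V"
    using openin_continuous_map_preimage[OF cont, of "ball 0 1"] X Y by simp
  moreover have "(0, 0) \<in> ?V" using A1 normed_spaceD(1)[OF X] normed_spaceD(1)[OF Y] by simp
  ultimately obtain U W where U: "openin (norm_topology X) U" "0 \<in> U"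
    and W: "openin (norm_topology Y) W" "0 \<in> W" and UW: "U \<times> W \<subseteq> ?V"
    unfolding openin_prod_topology_alt by meson
  obtain r where r: "0 < r" "\<And>y. y \<in> car X \<Longrightarrow> nrm X (0 - y) < r \<Longrightarrow> y \<in> U"
    using norm_topology_ball[OF X U] by blast
  obtain s where s: "0 < s" "\<And>y. y \<in> car Y \<Longrightarrow> nrm Y (0 - y) < s \<Longrightarrow> y \<in> W"
    using norm_topology_ball[OF Y W] by blast
  show ?thesis
  \<comment> \<open>Both arguments are scaled to half of the radii r and s, hence the 4.\<close>
  proof (rule that[of "4 / (r * s)"])
    fix x y assume x: "x \<in> car X" and y: "y \<in> car Y"
    show "norm (A (x, y)) \<le> 4 / (r * s) * nrm X x * nrm Y y"
    proof (cases "x = 0 \<or> y = 0")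
      case True
      then show ?thesis using A1 A2 x y normed_spaceD(7)[OF X] normed_spaceD(7)[OF Y] by auto
    next
      case False
      obtain c where c: "c \<noteq> 0" "norm c = r / (2 * nrm X x)" "scl X c x \<in> car X" "nrm X (scl X c x) < r"
        using normalise_below[OF X x _ r(1)] False by blast
      obtain d where d: "d \<noteq> 0" "norm d = s / (2 * nrm Y y)" "scl Y d y \<in> car Y" "nrm Y (scl Y d y) < s"
        using normalise_below[OF Y y _ s(1)] False by blast
      have "(scl X c x, scl Y d y) \<in> ?V"
        using r(2)[OF c(3)] s(2)[OF d(3)] c(4) d(4) nrm_minus[OF X c(3)] nrm_minus[OF Y d(3)] UW by auto
      then have "norm (c * d * A (x, y)) < 1"
        using scl1[OF x d(3)] scl2[OF x y] by (simp add: mult.assoc)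
      moreover have "0 < nrm X x" "0 < nrm Y y"
        using normed_spaceD(5,6)[OF X x] normed_spaceD(5,6)[OF Y y] False by auto
      ultimately show ?thesis using c(2) d(2) r(1) s(1) by (simp add: norm_mult field_simps)
    qed
  qed (use r s in simp)
qed

lemma bilinear_form_continuous:
  fixes A :: "'a::ab_group_add \<times> 'b::ab_group_add \<Rightarrow> 'k::real_or_complex"
  assumes X: "normed_space X" and Y: "normed_space Y"
    and add1: "\<And>x x' y. x \<in> car X \<Longrightarrow> x' \<in> car X \<Longrightarrow> y \<in> car Y \<Longrightarrow> A (x + x', y) = A (x, y) + A (x', y)"
    and add2: "\<And>x y y'. x \<in> car X \<Longrightarrow> y \<in> car Y \<Longrightarrow> y' \<in> car Y \<Longrightarrow> A (x, y + y') = A (x, y) + A (x, y')"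
    and bd: "\<And>x y. x \<in> car X \<Longrightarrow> y \<in> car Y \<Longrightarrow> norm (A (x, y)) \<le> M * nrm X x * nrm Y y" and M: "0 < M"
  shows "continuous_map (prod_topology (norm_topology X) (norm_topology Y)) euclidean A"
  unfolding mtopology_is_euclidean[symmetric] Met_TC.continuous_map_to_metric
proof (intro ballI allI impI)
  fix z and \<epsilon> :: real
  assume "z \<in> topspace (prod_topology (norm_topology X) (norm_topology Y))" and \<epsilon>: "0 < \<epsilon>"
  then obtain x y where z: "z = (x, y)" and x: "x \<in> car X" and y: "y \<in> car Y"
    using X Y by auto
  \<comment> \<open>The cap 1 bounds \<open>nrm Y y'\<close> by \<open>nrm Y y + 1\<close>; the 2 in
    the denominator makes the final inequality strict.\<close>
  define \<delta> where "\<delta> = min 1 (\<epsilon> / (2 * M * (nrm X x + nrm Y y + 2)))"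
  have xy: "0 \<le> nrm X x" "0 \<le> nrm Y y" using normed_spaceD(5)[OF X x] normed_spaceD(5)[OF Y y] by auto
  have \<delta>: "0 < \<delta>" "\<delta> \<le> 1" "M * (nrm X x + nrm Y y + 2) * \<delta> < \<epsilon>"
  proof -
    have D: "0 < 2 * M * (nrm X x + nrm Y y + 2)" using xy M by (intro mult_pos_pos) auto
    then show "0 < \<delta>" "\<delta> \<le> 1" using \<epsilon> by (auto simp: \<delta>_def)
    have "\<delta> \<le> \<epsilon> / (2 * M * (nrm X x + nrm Y y + 2))" by (simp add: \<delta>_def)
    then have "\<delta> * (2 * M * (nrm X x + nrm Y y + 2)) \<le> \<epsilon>" using D by (simp add: pos_le_divide_eq)
    then have "2 * (M * (nrm X x + nrm Y y + 2) * \<delta>) \<le> \<epsilon>" by (simp add: mult_ac)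
    then show "M * (nrm X x + nrm Y y + 2) * \<delta> < \<epsilon>" using \<epsilon> by linarith
  qed
  let ?U = "{x' \<in> car X. nrm X (x - x') < \<delta>}" and ?W = "{y' \<in> car Y. nrm Y (y - y') < \<delta>}"
  have "dist (A (x, y)) (A (x', y')) < \<epsilon>" if "x' \<in> ?U" "y' \<in> ?W" for x' y'
  proof -
    have x': "x' \<in> car X" "nrm X (x - x') < \<delta>" and y': "y' \<in> car Y" "nrm Y (y - y') < \<delta>" using that by auto
    have dx: "x - x' \<in> car X" and dy: "y - y' \<in> car Y"
      using normed_spaceD(3)[OF X x x'(1)] normed_spaceD(3)[OF Y y y'(1)] by auto
    have tri: "nrm Y y' \<le> nrm Y y + nrm Y (y - y')"
    proof -
      have "nrm Y (y + - (y - y')) \<le> nrm Y y + nrm Y (- (y - y'))"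
        using Y y normed_spaceD(3)[OF Y normed_spaceD(1)[OF Y] dy] unfolding normed_space_def by force
      then show ?thesis using nrm_minus[OF Y dy] by simp
    qed
    have "A (x, y) = A (x, y - y') + A (x, y')" using add2[OF x dy y'(1)] by simp
    also have "A (x, y') = A (x - x', y') + A (x', y')" using add1[OF dx x'(1) y'(1)] by simp
    finally have "dist (A (x, y)) (A (x', y')) = norm (A (x, y - y') + A (x - x', y'))"
      by (simp add: dist_norm)
    also have "\<dots> \<le> norm (A (x, y - y')) + norm (A (x - x', y'))" by (rule norm_triangle_ineq)
    also have "\<dots> \<le> M * nrm X x * nrm Y (y - y') + M * nrm X (x - x') * nrm Y y'"
      by (intro add_mono bd x dy dx y'(1))
    also have "\<dots> \<le> M * nrm X x * \<delta> + M * \<delta> * (nrm Y y + 1)"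
      using M xy \<delta> x'(2) y'(2) tri normed_spaceD(5)[OF Y y'(1)] normed_spaceD(5)[OF X dx]
      by (intro add_mono mult_left_mono mult_mono) auto
    also have "\<dots> = M * (nrm X x + nrm Y y + 1) * \<delta>" by (simp add: algebra_simps)
    also have "\<dots> \<le> M * (nrm X x + nrm Y y + 2) * \<delta>" using M \<delta> by (intro mult_right_mono mult_left_mono) auto
    also have "\<dots> < \<epsilon>" by (rule \<delta>(3))
    finally show ?thesis .
  qed
  moreover have "openin (prod_topology (norm_topology X) (norm_topology Y)) (?U \<times> ?W)"
    using openin_norm_ball[OF X x] openin_norm_ball[OF Y y] by (simp add: openin_prod_Times_iff)
  moreover have "z \<in> ?U \<times> ?W" using x y \<delta> normed_spaceD(7)[OF X] normed_spaceD(7)[OF Y] by (simp add: z)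
  ultimately show "\<exists>U. openin (prod_topology (norm_topology X) (norm_topology Y)) U \<and> z \<in> U
      \<and> (\<forall>w\<in>U. A w \<in> Met_TC.mball (A z) \<epsilon>)"
    unfolding z by (intro exI[of _ "?U \<times> ?W"]) auto
qed

section \<open>Sequence spaces\<close>

text \<open>Extends convexity of the power function to arguments equal to 0, a value that
  coordinates of sequences may take.\<close>

lemma powr_convex_combination:
  fixes s t \<alpha> \<beta> p :: real
  assumes "1 \<le> p" "0 \<le> s" "0 \<le> t" "0 \<le> \<alpha>" "0 \<le> \<beta>" "\<alpha> + \<beta> = 1"
  shows "(\<alpha> * s + \<beta> * t) powr p \<le> \<alpha> * s powr p + \<beta> * t powr p"
proof -
  have le: "(\<gamma> * u) powr p \<le> \<gamma> * u powr p" if "0 \<le> \<gamma>" "\<gamma> \<le> 1" "0 \<le> u" for \<gamma> u :: real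
  proof -
    have "\<gamma> powr p \<le> \<gamma> powr 1" using that assms by (intro powr_mono') auto
    then show ?thesis using that by (simp add: powr_mult mult_right_mono)
  qed
  consider "s = 0" | "t = 0" | "0 < s" "0 < t" using assms by linarith
  then show ?thesis
  proof cases
    case 1
    then show ?thesis using le[of \<beta> t] assms by simp
  next
    case 2
    then show ?thesis using le[of \<alpha> s] assms by simp
  next
    case 3
    moreover have "\<alpha> = 1 - \<beta>" using assms by simp
    ultimately show ?thesis
      using convex_onD[OF powr_convex[OF assms(1)], of \<beta> s t] assms(4,5) by simp
  qed
qed

lemma lp_simps [simp]:
  "car (lp p :: ('k::real_or_complex, nat \<Rightarrow> 'k) nspace) = {x. summable (\<lambda>n. norm (x n) powr p)}"
  "nrm (lp p :: ('k::real_or_complex, nat \<Rightarrow> 'k) nspace) x = (\<Sum>n. norm (x n) powr p) powr (1 / p)"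
  "scl (lp p :: ('k::real_or_complex, nat \<Rightarrow> 'k) nspace) c x = (\<lambda>n. c * x n)"
  by (simp_all add: lp_def)

text \<open>u + v is (a + b) times a convex combination of u / a and v / b. Summed over the
  coordinates, with a and b the norms of the two sequences, this becomes Minkowski's inequality;
  with a = b = 1 it gives summability of the sum.\<close>

lemma lp_pointwise_Minkowski:
  fixes u v :: "'k::real_or_complex"
  assumes "1 \<le> p" "0 < a" "0 < b"
  shows "norm (u + v) powr p
    \<le> (a + b) powr p * (a / (a + b) * (norm u powr p / a powr p) + b / (a + b) * (norm v powr p / b powr p))"
proof -
  have "norm (u + v) powr p \<le> (norm u + norm v) powr p"
    using assms by (intro powr_mono2 norm_triangle_ineq) auto
  also have "norm u + norm v = (a + b) * (a / (a + b) * (norm u / a) + b / (a + b) * (norm v / b))"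
    using assms by (simp add: distrib_left)
  also have "\<dots> powr p = (a + b) powr p * (a / (a + b) * (norm u / a) + b / (a + b) * (norm v / b)) powr p"
    by (rule powr_mult)
  also have "\<dots> \<le> (a + b) powr p * (a / (a + b) * (norm u / a) powr p + b / (a + b) * (norm v / b) powr p)"
    using assms by (intro mult_left_mono powr_convex_combination) (auto simp flip: add_divide_distrib)
  finally show ?thesis by (simp add: powr_divide)
qed

lemma lp_summable_add:
  fixes x y :: "nat \<Rightarrow> 'k::real_or_complex"
  assumes "1 \<le> p" "summable (\<lambda>n. norm (x n) powr p)" "summable (\<lambda>n. norm (y n) powr p)"
  shows "summable (\<lambda>n. norm (x n + y n) powr p)"
proof (rule summable_comparison_test')
  show "summable (\<lambda>n. (1 + 1) powr p * (1 / (1 + 1) * (norm (x n) powr p / 1 powr p) + 1 / (1 + 1) * (norm (y n) powr p / 1 powr p)))"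
    using assms by (intro summable_mult summable_add summable_divide)
  show "norm (norm (x n + y n) powr p) \<le> (1 + 1) powr p * (1 / (1 + 1) * (norm (x n) powr p / 1 powr p) + 1 / (1 + 1) * (norm (y n) powr p / 1 powr p))" for n
    using lp_pointwise_Minkowski[OF assms(1), of 1 1 "x n" "y n"] by simp
qed

lemma lp_nrm_powr:
  fixes x :: "nat \<Rightarrow> 'k::real_or_complex"
  assumes "0 < p" "summable (\<lambda>n. norm (x n) powr p)"
  shows "(nrm (lp p) x) powr p = (\<Sum>n. norm (x n) powr p)"
  using assms by (simp add: powr_powr suminf_nonneg)

lemma lp_nrm_eq_0:
  fixes x :: "nat \<Rightarrow> 'k::real_or_complex"
  assumes "summable (\<lambda>n. norm (x n) powr p)"
  shows "nrm (lp p) x = 0 \<longleftrightarrow> x = 0"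
  using suminf_eq_zero_iff[OF assms] by (auto simp: fun_eq_iff)

lemma lp_triangle:
  fixes x y :: "nat \<Rightarrow> 'k::real_or_complex"
  assumes p: "1 \<le> p" and x: "summable (\<lambda>n. norm (x n) powr p)" and y: "summable (\<lambda>n. norm (y n) powr p)"
  shows "nrm (lp p) (x + y) \<le> nrm (lp p) x + nrm (lp p) y"
proof -
  let ?a = "nrm (lp p) x" and ?b = "nrm (lp p) y"
  have nn: "0 \<le> nrm (lp p) z" for z :: "nat \<Rightarrow> 'k" by simp
  consider "?a = 0" | "?b = 0" | "0 < ?a" "0 < ?b" by (metis lp_simps(2) less_le powr_ge_zero)
  then show ?thesis
  proof cases
    case 1
    then show ?thesis using lp_nrm_eq_0[OF x] nn by (simp del: lp_simps)
  next
    case 2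
    then show ?thesis using lp_nrm_eq_0[OF y] nn by (simp del: lp_simps)
  next
    case 3
    let ?f = "\<lambda>n. (?a + ?b) powr p * (?a / (?a + ?b) * (norm (x n) powr p / ?a powr p)
      + ?b / (?a + ?b) * (norm (y n) powr p / ?b powr p))"
    have s: "?f sums ((?a + ?b) powr p * (?a / (?a + ?b) * ((\<Sum>n. norm (x n) powr p) / ?a powr p)
      + ?b / (?a + ?b) * ((\<Sum>n. norm (y n) powr p) / ?b powr p)))"
      using x y by (intro sums_mult sums_add sums_divide summable_sums)
    have "nrm (lp p) (x + y) powr p = (\<Sum>n. norm (x n + y n) powr p)"
      using lp_nrm_powr[of p "x + y"] p lp_summable_add[OF p x y] by simp
    also have "\<dots> \<le> suminf ?f"
      using 3 p s lp_summable_add[OF p x y] by (intro suminf_le lp_pointwise_Minkowski) (auto simp: sums_iff)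
    also have "\<dots> = (?a + ?b) powr p * (?a / (?a + ?b) + ?b / (?a + ?b))"
      using s 3 p by (simp only: sums_iff lp_nrm_powr[OF _ x, symmetric] lp_nrm_powr[OF _ y, symmetric]) simp
    also have "\<dots> = (?a + ?b) powr p"
      using 3 by (simp del: lp_simps flip: add_divide_distrib)
    finally have le: "nrm (lp p) (x + y) powr p \<le> (?a + ?b) powr p" .
    show ?thesis
    proof (rule ccontr)
      assume "\<not> ?thesis"
      then have "(?a + ?b) powr p < nrm (lp p) (x + y) powr p"
        using p 3 by (intro powr_less_mono2) (simp_all del: lp_simps)
      then show False using le by linarith
    qed
  qed
qed

lemma normed_space_lp:
  assumes p: "1 \<le> p"
  shows "normed_space (lp p :: ('k::real_or_complex, nat \<Rightarrow> 'k) nspace)"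
proof -
  let ?X = "lp p :: ('k, nat \<Rightarrow> 'k) nspace"
  have vs: "vector_space (scl ?X)"
    by unfold_locales (auto simp: fun_eq_iff algebra_simps)
  interpret vector_space "scl ?X" by (rule vs)
  have mult: "summable (\<lambda>n. norm (c * x n) powr p)" if "summable (\<lambda>n. norm (x n) powr p)" for c and x :: "nat \<Rightarrow> 'k"
    using summable_mult[OF that, of "norm c powr p"] by (simp add: norm_mult powr_mult)
  have "nrm ?X (scl ?X c x) = norm c * nrm ?X x" if "x \<in> car ?X" for c x
    using that p suminf_mult[of "\<lambda>n. norm (x n) powr p" "norm c powr p"]
    by (simp add: norm_mult powr_mult powr_powr)
  moreover have "subspace (car ?X)"
  proof (rule subspaceI)
    show "x + y \<in> car ?X" if "x \<in> car ?X" "y \<in> car ?X" for x y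
      using that lp_summable_add[OF p, of x y] by simp
  qed (use mult in auto)
  moreover have "nrm ?X x = 0 \<longleftrightarrow> x = 0" if "x \<in> car ?X" for x
    using lp_nrm_eq_0[of x p] that by simp
  moreover have "nrm ?X (x + y) \<le> nrm ?X x + nrm ?X y" if "x \<in> car ?X" "y \<in> car ?X" for x y
    using lp_triangle[OF p, of x y] that by simp
  moreover have "0 \<le> nrm ?X x" for x by simp
  ultimately show ?thesis
    unfolding normed_space_def using vs by (intro conjI ballI allI) blast+
qed

section \<open>Truncation and the inclusion of l_p1 in l_p\<close>

definition trunc :: "nat \<Rightarrow> (nat \<Rightarrow> 'k::zero) \<Rightarrow> nat \<Rightarrow> 'k" where
  "trunc N x = (\<lambda>n. if n < N then x n else 0)"

lemma finite_support_sums: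
  fixes f :: "'k::real_or_complex \<Rightarrow> real"
  assumes "f 0 = 0"
  shows "(\<lambda>n. f (trunc N x n)) sums (\<Sum>n<N. f (x n))"
proof -
  have "(\<lambda>n. f (trunc N x n)) sums (\<Sum>n<N. f (trunc N x n))"
    by (rule sums_finite) (auto simp: trunc_def assms)
  then show ?thesis by (simp add: trunc_def)
qed

lemma trunc_in_lp: "trunc N x \<in> car (lp p :: ('k::real_or_complex, nat \<Rightarrow> 'k) nspace)"
  using finite_support_sums[of "\<lambda>t. norm t powr p" N x] by (auto simp: sums_iff)

lemma nrm_trunc: "nrm (lp p) (trunc N x) = (\<Sum>n<N. norm (x n) powr p) powr (1 / p)"
  for x :: "nat \<Rightarrow> 'k::real_or_complex"
  using finite_support_sums[of "\<lambda>t. norm t powr p" N x] by (auto simp: sums_iff)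

lemma lp_partial_sum_le:
  fixes x :: "nat \<Rightarrow> 'k::real_or_complex"
  assumes "0 < p" "x \<in> car (lp p)"
  shows "(\<Sum>n<N. norm (x n) powr p) powr (1 / p) \<le> nrm (lp p) x"
  using assms by (auto intro!: powr_mono2 sum_nonneg sum_le_suminf)

text \<open>Each coordinate is at most the l_p1 norm, called a below, so its p-th power is at most
  a^(p - p1) times its p1-th power.\<close>

lemma lp_subset:
  fixes x :: "nat \<Rightarrow> 'k::real_or_complex"
  assumes "0 < p1" "p1 \<le> p" and x: "x \<in> car (lp p1)"
  shows "x \<in> car (lp p)" "nrm (lp p) x \<le> nrm (lp p1) x"
proof -
  let ?a = "nrm (lp p1) x"
  have s: "summable (\<lambda>n. norm (x n) powr p1)" using x by simp
  have a0: "0 \<le> ?a" by simp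
  have le: "norm (x n) \<le> ?a" for n
  proof -
    have "norm (x n) powr p1 \<le> (\<Sum>n. norm (x n) powr p1)"
      using sum_le_suminf[OF s, of "{n}"] by simp
    then have "(norm (x n) powr p1) powr (1 / p1) \<le> ?a"
      using assms by (auto intro!: powr_mono2)
    then show ?thesis using assms by (simp add: powr_powr)
  qed
  have pw: "norm (x n) powr p \<le> ?a powr (p - p1) * norm (x n) powr p1" for n
  proof -
    have "norm (x n) powr p = norm (x n) powr (p - p1) * norm (x n) powr p1"
      by (simp flip: powr_add)
    also have "\<dots> \<le> ?a powr (p - p1) * norm (x n) powr p1"
      using le[of n] assms by (intro mult_right_mono powr_mono2) auto
    finally show ?thesis .
  qed
  have s2: "summable (\<lambda>n. norm (x n) powr p)"
    by (rule summable_comparison_test'[OF summable_mult[OF s, of "?a powr (p - p1)"]]) (use pw in simp)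
  then show "x \<in> car (lp p)" by simp
  have "(\<Sum>n. norm (x n) powr p) \<le> (\<Sum>n. ?a powr (p - p1) * norm (x n) powr p1)"
    by (intro suminf_le pw s2 summable_mult s)
  also have "\<dots> = ?a powr (p - p1) * ?a powr p1"
    using suminf_mult[OF s] lp_nrm_powr[OF _ s] assms by simp
  also have "\<dots> = ?a powr p" by (simp flip: powr_add)
  finally have "(\<Sum>n. norm (x n) powr p) powr (1 / p) \<le> (?a powr p) powr (1 / p)"
    using assms s2 by (intro powr_mono2 suminf_nonneg) auto
  then show "nrm (lp p) x \<le> ?a" using assms a0 by (simp add: powr_powr del: lp_simps) (simp only: lp_simps)
qed

lemma trunc_tendsto:
  fixes x :: "nat \<Rightarrow> 'k::real_or_complex"
  assumes p: "0 < p" and x: "x \<in> car (lp p)"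
  shows "(\<lambda>N. nrm (lp p) (x - trunc N x)) \<longlonglongrightarrow> 0"
proof -
  have s: "summable (\<lambda>n. norm (x n) powr p)" using x by simp
  have "(\<Sum>n. norm ((x - trunc N x) n) powr p) = (\<Sum>n. norm (x (n + N)) powr p)" for N
  proof -
    have "summable (\<lambda>n. norm ((x - trunc N x) n) powr p)"
      by (rule summable_comparison_test'[OF s]) (auto simp: trunc_def)
    from suminf_split_initial_segment[OF this, of N] show ?thesis by (simp add: trunc_def)
  qed
  moreover have "(\<lambda>N. \<Sum>n. norm (x (n + N)) powr p) \<longlonglongrightarrow> 0"
    using suminf_exist_split2[OF s] .
  then have "(\<lambda>N. (\<Sum>n. norm (x (n + N)) powr p) powr (1 / p)) \<longlonglongrightarrow> 0"
    using p by (intro tendsto_zero_powrI[where b = "1 / p"]) (auto intro!: suminf_nonneg always_eventually simp: summable_ignore_initial_segment[OF s])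
  ultimately show ?thesis by simp
qed

declare lp_simps [simp del]

section \<open>Operators from Hilbert space into sequence spaces\<close>

lemma weighted_geometric_mean_le:
  fixes u v \<theta> :: real
  assumes "0 < \<theta>" "\<theta> \<le> 1" "0 \<le> u" "0 \<le> v"
  shows "u powr \<theta> * v powr (1 - \<theta>) \<le> \<theta> * u + (1 - \<theta>) * v"
proof (cases "u = 0 \<or> v = 0")
  case True
  then show ?thesis using assms by auto
next
  case False
  then show ?thesis using assms by (intro Youngs_inequality_0) auto
qed

lemma powr_le_one:
  fixes x e :: real
  assumes "0 \<le> x" "x \<le> 1" "0 \<le> e"
  shows "x powr e \<le> 1"
  using powr_mono2[of e x 1] assms by simp

text \<open>The weighted geometric mean inequality after both sums are normalised to 1; the
  exponents are 1 / \<theta> and 1 / (1 - \<theta>). The value \<theta> = 1 occurs below for l_1: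
  since \<open>0 powr 0 = 0\<close>, both sides vanish when all h i do.\<close>

lemma Hoelder_sum:
  fixes f h :: "'i \<Rightarrow> real"
  assumes \<theta>: "0 < \<theta>" "\<theta> \<le> 1" and f: "\<And>i. i \<in> I \<Longrightarrow> 0 \<le> f i" and h: "\<And>i. i \<in> I \<Longrightarrow> 0 \<le> h i" and I: "finite I"
  shows "(\<Sum>i\<in>I. f i powr \<theta> * h i powr (1 - \<theta>)) \<le> (\<Sum>i\<in>I. f i) powr \<theta> * (\<Sum>i\<in>I. h i) powr (1 - \<theta>)"
proof (cases "(\<Sum>i\<in>I. f i) = 0 \<or> (\<Sum>i\<in>I. h i) = 0")
  case True
  then have "(\<forall>i\<in>I. f i = 0) \<or> (\<forall>i\<in>I. h i = 0)"
    using sum_nonneg_eq_0_iff[OF I] f h by metis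
  then have "(\<Sum>i\<in>I. f i powr \<theta> * h i powr (1 - \<theta>)) = 0" by (intro sum.neutral) auto
  then show ?thesis by simp
next
  case False
  define F H where "F = (\<Sum>i\<in>I. f i)" and "H = (\<Sum>i\<in>I. h i)"
  have pos: "0 < F" "0 < H" using False f h by (auto simp: F_def H_def less_le sum_nonneg)
  have "f i powr \<theta> * h i powr (1 - \<theta>)
      \<le> F powr \<theta> * H powr (1 - \<theta>) * (\<theta> * (f i / F) + (1 - \<theta>) * (h i / H))" if "i \<in> I" for i
  proof -
    have "f i powr \<theta> * h i powr (1 - \<theta>)
        = F powr \<theta> * H powr (1 - \<theta>) * ((f i / F) powr \<theta> * (h i / H) powr (1 - \<theta>))"
      using pos by (simp add: powr_divide)
    also have "\<dots> \<le> F powr \<theta> * H powr (1 - \<theta>) * (\<theta> * (f i / F) + (1 - \<theta>) * (h i / H))"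
      using pos f[OF that] h[OF that] \<theta> by (intro mult_left_mono weighted_geometric_mean_le) auto
    finally show ?thesis .
  qed
  then have "(\<Sum>i\<in>I. f i powr \<theta> * h i powr (1 - \<theta>))
      \<le> (\<Sum>i\<in>I. F powr \<theta> * H powr (1 - \<theta>) * (\<theta> * (f i / F) + (1 - \<theta>) * (h i / H)))"
    by (rule sum_mono)
  also have "\<dots> = F powr \<theta> * H powr (1 - \<theta>) * (\<theta> * (F / F) + (1 - \<theta>) * (H / H))"
    by (simp add: sum.distrib flip: sum_distrib_left sum_divide_distrib F_def H_def)
  also have "\<dots> = F powr \<theta> * H powr (1 - \<theta>)" using pos by simp
  finally show ?thesis by (simp add: F_def H_def)
qed

lemma norm_sum_mult_le:
  fixes c z :: "'i \<Rightarrow> 'k::real_or_complex"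
  assumes "(\<Sum>j\<in>I. (norm (c j))\<^sup>2) \<le> 1"
  shows "norm (\<Sum>j\<in>I. c j * z j) \<le> sqrt (\<Sum>j\<in>I. (norm (z j))\<^sup>2)"
proof (rule real_le_rsqrt)
  have "norm (\<Sum>j\<in>I. c j * z j) \<le> (\<Sum>j\<in>I. norm (c j) * norm (z j))"
    by (intro order_trans[OF norm_sum] sum_mono) (simp add: norm_mult)
  then have "(norm (\<Sum>j\<in>I. c j * z j))\<^sup>2 \<le> (\<Sum>j\<in>I. norm (c j) * norm (z j))\<^sup>2"
    by (intro power_mono) auto
  also have "\<dots> \<le> (\<Sum>j\<in>I. (norm (c j))\<^sup>2) * (\<Sum>j\<in>I. (norm (z j))\<^sup>2)"
    by (rule Cauchy_Schwarz_ineq_sum)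
  also have "\<dots> \<le> 1 * (\<Sum>j\<in>I. (norm (z j))\<^sup>2)"
    using assms by (intro mult_right_mono sum_nonneg) auto
  finally show "(norm (\<Sum>j\<in>I. c j * z j))\<^sup>2 \<le> (\<Sum>j\<in>I. (norm (z j))\<^sup>2)" by simp
qed

text \<open>Equivalently, the rows of \<open>a\<close> have weak 2-norm at most 1 in \<open>N\<close>-dimensional \<open>\<ell>\<^sub>q\<close>.\<close>

definition l2_into_lq :: "nat \<Rightarrow> nat \<Rightarrow> real \<Rightarrow> (nat \<Rightarrow> nat \<Rightarrow> 'k::real_or_complex) \<Rightarrow> bool" where
  "l2_into_lq m N q a \<longleftrightarrow>
     (\<forall>c. (\<Sum>j<m. (norm (c j))\<^sup>2) \<le> 1 \<longrightarrow> (\<Sum>k<N. norm (\<Sum>j<m. c j * a j k) powr q) \<le> 1)"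

text \<open>It suffices to test against the norming functionals \<open>k \<mapsto> \<bar>s k\<bar>\<^sup>q / s k\<close> of elements \<open>s\<close> of \<open>\<ell>\<^sub>q\<close>.\<close>

lemma l2_into_lqI:
  fixes a :: "nat \<Rightarrow> nat \<Rightarrow> 'k::real_or_complex"
  assumes q: "1 \<le> q"
    and test: "\<And>s :: nat \<Rightarrow> 'k. 0 < (\<Sum>k<N. norm (s k) powr q) \<Longrightarrow>
      sqrt (\<Sum>j<m. (norm (\<Sum>k<N. of_real (norm (s k) powr q) / s k * a j k))\<^sup>2)
        \<le> (\<Sum>k<N. norm (s k) powr q) powr (1 - 1 / q)"
  shows "l2_into_lq m N q a"
  unfolding l2_into_lq_def
proof (intro allI impI)
  fix c :: "nat \<Rightarrow> 'k" assume c: "(\<Sum>j<m. (norm (c j))\<^sup>2) \<le> 1"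
  define s where "s k = (\<Sum>j<m. c j * a j k)" for k
  define S where "S = (\<Sum>k<N. norm (s k) powr q)"
  have "S \<le> 1"
  proof (cases "S = 0")
    case False
    then have pos: "0 < S" by (simp add: S_def less_le sum_nonneg)
    let ?\<phi> = "\<lambda>k. of_real (norm (s k) powr q) / s k"
    \<comment> \<open>True also for \<open>s k = 0\<close>, where both sides are 0.\<close>
    have "?\<phi> k * s k = of_real (norm (s k) powr q)" for k by simp
    then have "of_real S = (\<Sum>k<N. ?\<phi> k * s k)" by (simp add: S_def del: times_divide_eq_left)
    also have "\<dots> = (\<Sum>k<N. \<Sum>j<m. c j * (?\<phi> k * a j k))"
      by (simp only: s_def[of _] sum_distrib_left mult.left_commute)
    also have "\<dots> = (\<Sum>j<m. \<Sum>k<N. c j * (?\<phi> k * a j k))" by (rule sum.swap)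
    also have "\<dots> = (\<Sum>j<m. c j * (\<Sum>k<N. ?\<phi> k * a j k))" by (simp only: sum_distrib_left)
    finally have "norm (of_real S :: 'k) = norm (\<Sum>j<m. c j * (\<Sum>k<N. ?\<phi> k * a j k))" by simp
    also have "\<dots> \<le> sqrt (\<Sum>j<m. (norm (\<Sum>k<N. ?\<phi> k * a j k))\<^sup>2)"
      by (rule norm_sum_mult_le[OF c])
    also have "\<dots> \<le> S powr (1 - 1 / q)"
      using test[of s] pos by (simp add: S_def)
    also have "S powr (1 - 1 / q) = S / S powr (1 / q)" using pos by (simp add: powr_diff)
    \<comment> \<open>S is bounded by a smaller power of itself, which is divided out.\<close>
    finally have "S powr (1 / q) \<le> 1" using pos by (simp add: field_simps)
    then have "(S powr (1 / q)) powr q \<le> 1 powr q" using q by (intro powr_mono2) auto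
    then show "S \<le> 1" using q pos by (simp add: powr_powr)
  qed simp
  then show "(\<Sum>k<N. norm (\<Sum>j<m. c j * a j k) powr q) \<le> 1" by (simp add: S_def s_def)
qed

lemma sum_single_coordinate:
  fixes a :: "nat \<Rightarrow> 'k::real_or_complex"
  assumes "j < m"
  shows "(\<Sum>i<m. (if i = j then 1 else 0) * a i) = a j"
    and "(\<Sum>i<m. (norm (if i = j then 1 else 0 :: 'k))\<^sup>2) = 1"
proof -
  have "(\<Sum>i<m. (if i = j then 1 else 0) * a i) = (\<Sum>i<m. if i = j then a i else 0)"
    by (intro sum.cong) auto
  then show "(\<Sum>i<m. (if i = j then 1 else 0) * a i) = a j" using assms by simp
  have "(\<Sum>i<m. (norm (if i = j then 1 else 0 :: 'k))\<^sup>2) = (\<Sum>i<m. if i = j then 1 else 0)"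
    by (intro sum.cong) auto
  then show "(\<Sum>i<m. (norm (if i = j then 1 else 0 :: 'k))\<^sup>2) = 1" using assms by simp
qed

lemma l2_into_lq_row:
  fixes a :: "nat \<Rightarrow> nat \<Rightarrow> 'k::real_or_complex"
  assumes "l2_into_lq m N q a" "j < m"
  shows "(\<Sum>k<N. norm (a j k) powr q) \<le> 1"
  using assms(1)[unfolded l2_into_lq_def, rule_format, of "\<lambda>i. if i = j then 1 else 0"]
  by (simp add: sum_single_coordinate[OF assms(2)])

text \<open>The witness is the conjugate of a divided by its l_2 norm \<sigma>. In the abstract
  field the conjugate is written |z|^2 / z, which is 0 at z = 0.\<close>

lemma l2_norming_vector:
  fixes a :: "nat \<Rightarrow> 'k::real_or_complex"
  obtains c :: "nat \<Rightarrow> 'k" where "(\<Sum>j<m. (norm (c j))\<^sup>2) \<le> 1"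
    "(norm (\<Sum>j<m. c j * a j))\<^sup>2 = (\<Sum>j<m. (norm (a j))\<^sup>2)"
proof (cases "(\<Sum>j<m. (norm (a j))\<^sup>2) = 0")
  case True
  then show ?thesis by (intro that[of "\<lambda>_. 0"]) auto
next
  case False
  define \<sigma> where "\<sigma> = sqrt (\<Sum>j<m. (norm (a j))\<^sup>2)"
  have nn: "0 \<le> (\<Sum>j<m. (norm (a j))\<^sup>2)" by (simp add: sum_nonneg)
  then have \<sigma>: "0 < \<sigma>" "\<sigma>\<^sup>2 = (\<Sum>j<m. (norm (a j))\<^sup>2)"
    using False by (simp_all add: \<sigma>_def)
  let ?c = "\<lambda>j. of_real ((norm (a j))\<^sup>2 / \<sigma>) / a j"
  have "norm (?c j) = norm (a j) / \<sigma>" for j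
    using \<sigma>(1) by (cases "a j = 0") (simp_all add: norm_divide norm_mult norm_power power2_eq_square)
  then have "(norm (?c j))\<^sup>2 = (norm (a j))\<^sup>2 / \<sigma>\<^sup>2" for j
    by (simp only: power_divide)
  then have "(\<Sum>j<m. (norm (?c j))\<^sup>2) = 1"
    using \<sigma> False by (simp flip: sum_divide_distrib)
  moreover have "?c j * a j = of_real ((norm (a j))\<^sup>2 / \<sigma>)" for j by simp
  then have "(\<Sum>j<m. ?c j * a j) = of_real (\<sigma>\<^sup>2 / \<sigma>)"
    by (simp only: \<sigma>(2) sum_divide_distrib of_real_sum)
  then have "(norm (\<Sum>j<m. ?c j * a j))\<^sup>2 = \<sigma>\<^sup>2"
    using \<sigma>(1) by (simp add: power2_eq_square)
  ultimately show ?thesis using \<sigma>(2) by (intro that[of ?c]) auto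
qed

text \<open>A column represents the functional that takes c to the k-th coordinate of its image. Its
  l_2 norm is the norm of that functional, attained at a norming vector.\<close>

lemma l2_into_lq_column:
  fixes a :: "nat \<Rightarrow> nat \<Rightarrow> 'k::real_or_complex"
  assumes "l2_into_lq m N q a" "k < N" and q: "0 < q"
  shows "(\<Sum>j<m. (norm (a j k))\<^sup>2) \<le> 1"
proof -
  obtain c :: "nat \<Rightarrow> 'k" where c: "(\<Sum>j<m. (norm (c j))\<^sup>2) \<le> 1"
    "(norm (\<Sum>j<m. c j * a j k))\<^sup>2 = (\<Sum>j<m. (norm (a j k))\<^sup>2)"
    using l2_norming_vector[where a = "\<lambda>j. a j k"] by blast
  have "norm (\<Sum>j<m. c j * a j k) powr q \<le> (\<Sum>k<N. norm (\<Sum>j<m. c j * a j k) powr q)"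
    using assms(2) by (intro member_le_sum) auto
  also have "\<dots> \<le> 1" using assms(1) c(1) by (simp add: l2_into_lq_def)
  finally have "norm (\<Sum>j<m. c j * a j k) \<le> 1"
    using q by (metis norm_ge_zero not_le powr_one_eq_one powr_less_mono2 zero_le_one)
  then show ?thesis using c(2) by (metis norm_ge_zero power_le_one)
qed

lemma sum_fun_apply: "(\<Sum>i<n. f i) x = (\<Sum>i<n. f i x)" for f :: "nat \<Rightarrow> 'a \<Rightarrow> 'b::comm_monoid_add"
  by (induction n) auto

text \<open>Once the weights are divided out, the matrix is bounded from l_2 into l_2, so its rows
  and its columns are bounded in l_2. Later estimates use only these sums, so \<open>b\<close> keeps
  just absolute values. The constant 8 bounds the square root of 8^(2/q), as q >= 1.\<close>

lemma l2_into_lq_factor: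
  fixes a :: "nat \<Rightarrow> nat \<Rightarrow> 'k::real_or_complex"
  assumes q: "1 \<le> q" "q < 2" and a: "l2_into_lq m N q a"
  obtains \<kappa> :: "nat \<Rightarrow> real" and b :: "nat \<Rightarrow> nat \<Rightarrow> real" where
    "\<And>k. 0 \<le> \<kappa> k" "(\<Sum>k<N. \<kappa> k) \<le> 1" "\<And>j k. 0 \<le> b j k"
    "\<And>j k. j < m \<Longrightarrow> k < N \<Longrightarrow> norm (a j k) = 8 * \<kappa> k powr (1 / q - 1 / 2) * b j k"
    "\<And>j. j < m \<Longrightarrow> (\<Sum>k<N. (b j k)\<^sup>2) \<le> 1" "\<And>k. k < N \<Longrightarrow> (\<Sum>j<m. (b j k)\<^sup>2) \<le> 1"
proof -
  \<comment> \<open>Only the first m coordinates enter, so this is a seminorm on all sequences. It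
    has type 2 with constant 1 because the signs are orthogonal.\<close>
  let ?X = "\<lparr>car = UNIV, nrm = \<lambda>c. sqrt (\<Sum>j<m. (norm (c j))\<^sup>2), scl = \<lambda>t c j. t * c j\<rparr> :: ('k, nat \<Rightarrow> 'k) nspace"
  let ?T = "\<lambda>c k. \<Sum>j<m. c j * a j k"
  have sq: "(sqrt (\<Sum>j<m. (norm (c j))\<^sup>2))\<^sup>2 = (\<Sum>j<m. (norm (c j))\<^sup>2)" for c :: "nat \<Rightarrow> 'k"
    by (simp add: sum_nonneg)
  have nrm_scl: "sqrt (\<Sum>j<m. (norm (t * c j))\<^sup>2) = norm t * sqrt (\<Sum>j<m. (norm (c j))\<^sup>2)" for t :: 'k and c
    by (simp add: norm_mult power_mult_distrib real_sqrt_mult flip: sum_distrib_left)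
  have type2: "measure_pmf.expectation (rademacher n) (\<lambda>\<epsilon>. (nrm ?X (\<Sum>i<n. scl ?X (\<epsilon> i) (x i)))\<^sup>2)
      \<le> 1\<^sup>2 * (\<Sum>i<n. (nrm ?X (x i))\<^sup>2)" for n x
  proof -
    have "measure_pmf.expectation (rademacher n) (\<lambda>\<epsilon>. (nrm ?X (\<Sum>i<n. scl ?X (\<epsilon> i) (x i)))\<^sup>2)
        = (\<Sum>j<m. measure_pmf.expectation (rademacher n) (\<lambda>\<epsilon>. (norm (\<Sum>i<n. \<epsilon> i * x i j))\<^sup>2))"
      by (simp add: sq sum_fun_apply)
    also have "\<dots> = (\<Sum>j<m. \<Sum>i<n. (norm (x i j))\<^sup>2)" by (simp add: rademacher_second_moment)
    also have "\<dots> = (\<Sum>i<n. \<Sum>j<m. (norm (x i j))\<^sup>2)" by (rule sum.swap)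
    finally show ?thesis by (simp add: sq)
  qed
  have bounded: "(\<Sum>k<N. norm (?T c k) powr q) \<le> (1 * sqrt (\<Sum>j<m. (norm (c j))\<^sup>2)) powr q" for c
  proof (cases "(\<Sum>j<m. (norm (c j))\<^sup>2) = 0")
    case True
    then have "c j = 0" if "j < m" for j
      using that sum_nonneg_eq_0_iff[of "{..<m}" "\<lambda>j. (norm (c j))\<^sup>2"] by simp
    then show ?thesis by simp
  next
    case False
    define \<sigma> where "\<sigma> = sqrt (\<Sum>j<m. (norm (c j))\<^sup>2)"
    have nn: "0 \<le> (\<Sum>j<m. (norm (c j))\<^sup>2)" by (simp add: sum_nonneg)
    then have \<sigma>: "0 < \<sigma>" "\<sigma>\<^sup>2 = (\<Sum>j<m. (norm (c j))\<^sup>2)" using False by (simp_all add: \<sigma>_def)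
    have "(\<Sum>j<m. (norm (of_real (1 / \<sigma>) * c j))\<^sup>2) = (\<Sum>j<m. (norm (c j))\<^sup>2) / \<sigma>\<^sup>2"
      using \<sigma>(1) by (simp add: norm_divide power_divide sum_divide_distrib)
    then have "(\<Sum>j<m. (norm (of_real (1 / \<sigma>) * c j))\<^sup>2) \<le> 1"
      using \<sigma> by simp
    then have le: "(\<Sum>k<N. norm (?T (\<lambda>j. of_real (1 / \<sigma>) * c j) k) powr q) \<le> 1"
      using a by (auto simp only: l2_into_lq_def)
    have "norm (?T (\<lambda>j. of_real (1 / \<sigma>) * c j) k) powr q = norm (?T c k) powr q / \<sigma> powr q" for k
    proof -
      have "?T (\<lambda>j. of_real (1 / \<sigma>) * c j) k = of_real (1 / \<sigma>) * ?T c k"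
        by (simp only: sum_distrib_left mult.assoc)
      then show ?thesis using \<sigma>(1) by (simp add: norm_divide powr_divide)
    qed
    then have "(\<Sum>k<N. norm (?T c k) powr q) / \<sigma> powr q \<le> 1"
      using le by (simp only: sum_divide_distrib)
    then show ?thesis using \<sigma>(1) by (simp add: field_simps flip: \<sigma>_def)
  qed
  have M: thesis if main: "\<And>\<kappa>. (\<And>k. 0 \<le> \<kappa> k) \<Longrightarrow> (\<Sum>k<N. \<kappa> k) \<le> 1 \<Longrightarrow>
      (\<And>c k. c \<in> car ?X \<Longrightarrow> nrm ?X c \<le> 1 \<Longrightarrow> k < N \<Longrightarrow> \<kappa> k = 0 \<Longrightarrow> ?T c k = 0) \<Longrightarrow>
      (\<And>c. c \<in> car ?X \<Longrightarrow> nrm ?X c \<le> 1 \<Longrightarrow>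
         (\<Sum>k<N. (norm (?T c k))\<^sup>2 * \<kappa> k powr (1 - 2 / q)) \<le> 8 powr (2 / q) * (1 * 1)\<^sup>2) \<Longrightarrow> thesis" for thesis
  proof (rule maurey_factorization[where X = ?X and T = ?T and q = q and B = 1 and R = 1 and N = N])
    show "nrm ?X (scl ?X t c) \<le> norm t * nrm ?X c" for t c by (simp add: nrm_scl)
    show "(\<Sum>k<N. norm (?T c k) powr q) \<le> (1 * nrm ?X c) powr q" for c using bounded by simp
    show "?T (scl ?X t c) k = t * ?T c k" for t c k by (simp add: sum_distrib_left mult.assoc)
    show thesis if h: "\<And>k. 0 \<le> \<kappa> k" "(\<Sum>k<N. \<kappa> k) \<le> 1"
        "\<And>c k. c \<in> car ?X \<Longrightarrow> nrm ?X c \<le> 1 \<Longrightarrow> k < N \<Longrightarrow> \<kappa> k = 0 \<Longrightarrow> ?T c k = 0"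
        "\<And>c. c \<in> car ?X \<Longrightarrow> nrm ?X c \<le> 1 \<Longrightarrow>
           (\<Sum>k<N. (norm (?T c k))\<^sup>2 * \<kappa> k powr (1 - 2 / q)) \<le> 8 powr (2 / q) * (1 * 1)\<^sup>2" for \<kappa>
      by (rule main[OF h])
  qed (use q type2 in \<open>auto simp: sum.distrib distrib_right sum_nonneg\<close>)
  obtain \<kappa> :: "nat \<Rightarrow> real" where \<kappa>: "\<And>k. 0 \<le> \<kappa> k" "(\<Sum>k<N. \<kappa> k) \<le> 1"
    and zero: "\<And>c k. sqrt (\<Sum>j<m. (norm (c j))\<^sup>2) \<le> 1 \<Longrightarrow> k < N \<Longrightarrow> \<kappa> k = 0 \<Longrightarrow> ?T c k = 0"
    and sum: "\<And>c. sqrt (\<Sum>j<m. (norm (c j))\<^sup>2) \<le> 1 \<Longrightarrow>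
      (\<Sum>k<N. (norm (?T c k))\<^sup>2 * \<kappa> k powr (1 - 2 / q)) \<le> 8 powr (2 / q) * (1 * 1)\<^sup>2"
    by (rule M, rule that) simp_all
  define b where "b j k = \<kappa> k powr (1 / 2 - 1 / q) * norm (a j k) / 8" for j k
  have "8 powr (2 / q) \<le> (8::real) powr 2" using q by (intro powr_mono) (auto simp: field_simps)
  then have sum64: "(\<Sum>k<N. (norm (?T c k))\<^sup>2 * \<kappa> k powr (1 - 2 / q)) \<le> 64"
    if "(\<Sum>j<m. (norm (c j))\<^sup>2) \<le> 1" for c
    using sum[of c] that by simp
  have b2: "(b j k)\<^sup>2 = (norm (a j k))\<^sup>2 * \<kappa> k powr (1 - 2 / q) / 64" for j k
  proof -
    have "(\<kappa> k powr (1 / 2 - 1 / q))\<^sup>2 = \<kappa> k powr (1 - 2 / q)"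
      by (simp add: power2_eq_square flip: powr_add)
    then show ?thesis by (simp add: b_def power_mult_distrib power_divide)
  qed
  show ?thesis
  proof (rule that[of \<kappa> b])
    show "0 \<le> b j k" for j k by (simp add: b_def)
    show "norm (a j k) = 8 * \<kappa> k powr (1 / q - 1 / 2) * b j k" if "j < m" "k < N" for j k
    proof (cases "\<kappa> k = 0")
      case True
      \<comment> \<open>A weight 0 makes the right-hand side 0, so the entry itself must vanish;
        this is what the clause on vanishing weights provides.\<close>
      then have "a j k = 0"
        using zero[of "\<lambda>i. if i = j then 1 else 0" k] that
        by (simp add: sum_single_coordinate(1)[of j m "\<lambda>i. a i k"] sum_single_coordinate(2)[of j m])
      then show ?thesis by (simp add: b_def)
    next
      case False
      then have "\<kappa> k powr (1 / q - 1 / 2) * \<kappa> k powr (1 / 2 - 1 / q) = 1"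
        using \<kappa>(1)[of k] by (simp flip: powr_add)
      then show ?thesis by (simp add: b_def flip: mult.assoc)
    qed
    show "(\<Sum>k<N. (b j k)\<^sup>2) \<le> 1" if "j < m" for j
      using sum64[of "\<lambda>i. if i = j then 1 else 0"] that
      by (simp add: b2 sum_single_coordinate[OF that] flip: sum_divide_distrib)
    show "(\<Sum>j<m. (b j k)\<^sup>2) \<le> 1" if "k < N" for k
    proof -
      \<comment> \<open>A vector attaining the norm of column k. Keeping only the k-th term of the
        weighted sum then leaves the column sum of \<open>b\<close>.\<close>
      obtain c :: "nat \<Rightarrow> 'k" where c: "(\<Sum>j<m. (norm (c j))\<^sup>2) \<le> 1"
        "(norm (?T c k))\<^sup>2 = (\<Sum>j<m. (norm (a j k))\<^sup>2)"
        using l2_norming_vector[where a = "\<lambda>j. a j k"] by blast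
      have "(norm (?T c k))\<^sup>2 * \<kappa> k powr (1 - 2 / q) \<le> (\<Sum>k<N. (norm (?T c k))\<^sup>2 * \<kappa> k powr (1 - 2 / q))"
        using that by (intro member_le_sum[of k "{..<N}" "\<lambda>k. (norm (?T c k))\<^sup>2 * \<kappa> k powr (1 - 2 / q)"]) auto
      also have "\<dots> \<le> 64" by (rule sum64[OF c(1)])
      finally show ?thesis
        by (simp add: b2 c(2) flip: sum_divide_distrib sum_distrib_right)
    qed
  qed (use \<kappa> in auto)
qed

text \<open>By Hoelder, the row condition bounds the sum over k of \<kappa>^(1 - 2/\<sigma>) g^2 for
  each j; the column condition bounds the sum over j and k of \<kappa> g^2. Hoelder within each row
  combines the two with exponents 1 - \<theta> and \<theta>. The condition on \<eta> says that
  \<kappa>^\<eta> is at most the combined weight, since \<kappa> <= 1.\<close>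

lemma interpolated_row_sums:
  fixes \<kappa> :: "nat \<Rightarrow> real" and g :: "nat \<Rightarrow> nat \<Rightarrow> real"
  assumes \<theta>: "0 < \<theta>" "\<theta> \<le> 1" and \<sigma>: "2 \<le> \<sigma>" and \<eta>: "\<theta> + (1 - \<theta>) * (1 - 2 / \<sigma>) \<le> \<eta>"
    and \<kappa>: "\<And>k. 0 \<le> \<kappa> k" "(\<Sum>k<N. \<kappa> k) \<le> 1" and g: "\<And>j k. 0 \<le> g j k"
    and rows: "\<And>j. j < m \<Longrightarrow> (\<Sum>k<N. g j k powr \<sigma>) \<le> 1"
    and cols: "\<And>k. k < N \<Longrightarrow> (\<Sum>j<m. (g j k)\<^sup>2) \<le> 1"
  shows "(\<Sum>j<m. (\<Sum>k<N. \<kappa> k powr \<eta> * (g j k)\<^sup>2) powr (1 / \<theta>)) \<le> 1"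
proof -
  have \<kappa>1: "\<kappa> k \<le> 1" if "k < N" for k
  proof -
    have "\<kappa> k \<le> (\<Sum>k<N. \<kappa> k)" using that \<kappa>(1) by (intro member_le_sum) auto
    then show ?thesis using \<kappa>(2) by simp
  qed
  have "(\<Sum>k<N. \<kappa> k powr \<eta> * (g j k)\<^sup>2) powr (1 / \<theta>) \<le> (\<Sum>k<N. \<kappa> k * (g j k)\<^sup>2)" if j: "j < m" for j
  proof -
    let ?h = "\<lambda>k. \<kappa> k powr (1 - 2 / \<sigma>) * (g j k)\<^sup>2"
    have "(\<Sum>k<N. ?h k) = (\<Sum>k<N. (g j k powr \<sigma>) powr (2 / \<sigma>) * \<kappa> k powr (1 - 2 / \<sigma>))"
      using \<sigma> g by (simp add: powr_powr mult.commute)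
    also have "\<dots> \<le> (\<Sum>k<N. g j k powr \<sigma>) powr (2 / \<sigma>) * (\<Sum>k<N. \<kappa> k) powr (1 - 2 / \<sigma>)"
      using \<sigma> \<kappa>(1) by (intro Hoelder_sum) auto
    also have "\<dots> \<le> 1 * 1"
      using \<sigma> \<kappa> rows[OF j] by (intro mult_mono powr_le_one) (auto intro!: sum_nonneg)
    finally have h1: "(\<Sum>k<N. ?h k) \<le> 1" by simp
    have "\<kappa> k powr \<eta> * (g j k)\<^sup>2 \<le> (\<kappa> k * (g j k)\<^sup>2) powr \<theta> * ?h k powr (1 - \<theta>)" if "k < N" for k
    proof (cases "\<kappa> k = 0 \<or> g j k = 0")
      case False
      then have pos: "0 < \<kappa> k" "0 < (g j k)\<^sup>2" using \<kappa>(1)[of k] by auto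
      have "(\<kappa> k * (g j k)\<^sup>2) powr \<theta> * ?h k powr (1 - \<theta>)
          = (\<kappa> k powr \<theta> * \<kappa> k powr ((1 - 2 / \<sigma>) * (1 - \<theta>))) * (((g j k)\<^sup>2) powr \<theta> * ((g j k)\<^sup>2) powr (1 - \<theta>))"
        by (simp only: powr_mult powr_powr mult_ac)
      also have "\<dots> = \<kappa> k powr (\<theta> + (1 - \<theta>) * (1 - 2 / \<sigma>)) * (g j k)\<^sup>2"
        using pos by (simp add: mult.commute flip: powr_add)
      also have "\<dots> \<ge> \<kappa> k powr \<eta> * (g j k)\<^sup>2"
        using pos \<kappa>1[OF that] \<eta> by (intro mult_right_mono powr_mono') auto
      finally show ?thesis .
    qed auto
    then have "(\<Sum>k<N. \<kappa> k powr \<eta> * (g j k)\<^sup>2) \<le> (\<Sum>k<N. (\<kappa> k * (g j k)\<^sup>2) powr \<theta> * ?h k powr (1 - \<theta>))"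
      by (intro sum_mono) simp
    also have "\<dots> \<le> (\<Sum>k<N. \<kappa> k * (g j k)\<^sup>2) powr \<theta> * (\<Sum>k<N. ?h k) powr (1 - \<theta>)"
      using \<theta> \<kappa>(1) by (intro Hoelder_sum) auto
    also have "\<dots> \<le> (\<Sum>k<N. \<kappa> k * (g j k)\<^sup>2) powr \<theta> * 1"
      using h1 \<theta> \<kappa>(1) by (intro mult_left_mono powr_le_one) (auto intro!: sum_nonneg)
    finally have "(\<Sum>k<N. \<kappa> k powr \<eta> * (g j k)\<^sup>2) powr (1 / \<theta>) \<le> ((\<Sum>k<N. \<kappa> k * (g j k)\<^sup>2) powr \<theta>) powr (1 / \<theta>)"
      using \<theta> by (intro powr_mono2) (auto intro!: sum_nonneg)
    then show ?thesis using \<theta> \<kappa>(1) by (simp add: powr_powr sum_nonneg)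
  qed
  then have "(\<Sum>j<m. (\<Sum>k<N. \<kappa> k powr \<eta> * (g j k)\<^sup>2) powr (1 / \<theta>)) \<le> (\<Sum>j<m. \<Sum>k<N. \<kappa> k * (g j k)\<^sup>2)"
    by (intro sum_mono) simp
  also have "\<dots> = (\<Sum>k<N. \<kappa> k * (\<Sum>j<m. (g j k)\<^sup>2))"
    unfolding sum_distrib_left by (rule sum.swap)
  also have "\<dots> \<le> (\<Sum>k<N. \<kappa> k * 1)" using cols \<kappa>(1) by (intro sum_mono mult_left_mono) auto
  finally show ?thesis using \<kappa>(2) by simp
qed

lemma sum_mult_le_sqrt:
  fixes b x :: "'i \<Rightarrow> real"
  assumes "(\<Sum>k\<in>I. (b k)\<^sup>2) \<le> 1"
  shows "(\<Sum>k\<in>I. b k * x k) \<le> sqrt (\<Sum>k\<in>I. (x k)\<^sup>2)"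
  using norm_sum_mult_le[where I = I and c = b and z = x] assms by (simp add: abs_le_iff)

text \<open>The matrices with exponent below 2 are factored: only \<open>a\<close> if p <= 2, both
  if p1 < 2 < p, only \<open>d\<close> if p1 >= 2. Cauchy-Schwarz against the l_2 rows of one factor
  leaves a weighted square sum for \<open>interpolated_row_sums\<close>, where the exponent \<sigma>
  of the remaining rows is p', 2 or p1. The constant 128 is that of the second case.\<close>

lemma paired_rows_bound:
  fixes a d :: "nat \<Rightarrow> nat \<Rightarrow> 'k::real_or_complex"
  assumes p: "1 < p" "1 / p + 1 / p' = 1" and p1: "1 \<le> p1" "p1 < p"
    and \<theta>: "\<theta> = (1 / p1 - 1 / p) * p'"
    and a: "l2_into_lq m N p1 a" and d: "l2_into_lq m N p' d"
  shows "(\<Sum>j<m. (norm (\<Sum>k<N. a j k * d j k) / 128) powr (2 / \<theta>)) \<le> 1"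
proof -
  have p': "1 < p'" "p' = p / (p - 1)"
  proof -
    have "1 / p' = (p - 1) / p" using p by (simp add: field_simps)
    then show "p' = p / (p - 1)" by (metis inverse_divide inverse_eq_divide inverse_inverse_eq)
    then show "1 < p'" using p by simp
  qed
  \<comment> \<open>With the conjugate exponent p1' of p1 this reads \<theta> = 1 - p' /
    p1'.\<close>
  have \<theta>_eq: "\<theta> = 1 - p' * (1 - 1 / p1)"
  proof -
    have "\<theta> = p' * (1 / p1) - p' * (1 / p)" by (simp add: \<theta> algebra_simps)
    also have "1 / p = 1 - 1 / p'" using p(2) by linarith
    also have "p' * (1 - 1 / p') = p' - 1" using p'(1) by (simp add: right_diff_distrib)
    finally show ?thesis by (simp add: algebra_simps)
  qed
  have \<theta>01: "0 < \<theta>" "\<theta> \<le> 1"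
  proof -
    have "1 / p < 1 / p1" using p1 by (simp add: field_simps)
    then show "0 < \<theta>" using p'(1) by (simp add: \<theta>)
    have "0 \<le> 1 - 1 / p1" using p1 by simp
    then show "\<theta> \<le> 1" using p'(1) by (simp add: \<theta>_eq)
  qed
  have conclude: ?thesis
    if t: "\<And>j. j < m \<Longrightarrow> norm (\<Sum>k<N. a j k * d j k) / 128 \<le> sqrt (\<Sum>k<N. \<kappa> k powr \<eta> * (g j k)\<^sup>2)"
      and "2 \<le> \<sigma>" "\<theta> + (1 - \<theta>) * (1 - 2 / \<sigma>) \<le> \<eta>"
        "\<And>k. 0 \<le> \<kappa> k" "(\<Sum>k<N. \<kappa> k) \<le> 1" "\<And>j k. 0 \<le> g j k"
        "\<And>j. j < m \<Longrightarrow> (\<Sum>k<N. g j k powr \<sigma>) \<le> 1" "\<And>k. k < N \<Longrightarrow> (\<Sum>j<m. (g j k)\<^sup>2) \<le> 1"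
    for \<kappa> g \<sigma> \<eta>
  proof -
    have "(norm (\<Sum>k<N. a j k * d j k) / 128) powr (2 / \<theta>) \<le> (\<Sum>k<N. \<kappa> k powr \<eta> * (g j k)\<^sup>2) powr (1 / \<theta>)"
      if "j < m" for j
    proof -
      let ?Q = "\<Sum>k<N. \<kappa> k powr \<eta> * (g j k)\<^sup>2"
      have Q: "0 \<le> ?Q" by (intro sum_nonneg) auto
      have "(norm (\<Sum>k<N. a j k * d j k) / 128) powr (2 / \<theta>) \<le> sqrt ?Q powr (2 / \<theta>)"
        using t[OF that] \<theta>01 by (intro powr_mono2) auto
      also have "\<dots> = ?Q powr (1 / \<theta>)"
        using Q by (simp add: powr_powr flip: powr_half_sqrt)
      finally show ?thesis .
    qed
    then have "(\<Sum>j<m. (norm (\<Sum>k<N. a j k * d j k) / 128) powr (2 / \<theta>))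
        \<le> (\<Sum>j<m. (\<Sum>k<N. \<kappa> k powr \<eta> * (g j k)\<^sup>2) powr (1 / \<theta>))"
      by (intro sum_mono) simp
    also have "\<dots> \<le> 1" using that(2-) \<theta>01 by (intro interpolated_row_sums[where \<sigma> = \<sigma>]) auto
    finally show ?thesis .
  qed
  have factor_bound: "norm (\<Sum>k<N. a j k * d j k) / 128 \<le> sqrt (\<Sum>k<N. \<kappa> k powr \<eta> * (g j k)\<^sup>2)"
    if b: "(\<Sum>k<N. (b j k)\<^sup>2) \<le> 1" and pw: "\<And>k. k < N \<Longrightarrow> norm (a j k * d j k) \<le> 128 * (b j k * (\<kappa> k powr (\<eta> / 2) * g j k))"
    for b g :: "nat \<Rightarrow> nat \<Rightarrow> real" and \<kappa> \<eta> j
  proof -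
    have "norm (\<Sum>k<N. a j k * d j k) \<le> (\<Sum>k<N. 128 * (b j k * (\<kappa> k powr (\<eta> / 2) * g j k)))"
      using pw by (intro sum_norm_le) auto
    also have "\<dots> \<le> 128 * sqrt (\<Sum>k<N. (\<kappa> k powr (\<eta> / 2) * g j k)\<^sup>2)"
      unfolding sum_distrib_left[symmetric] using b by (intro mult_left_mono sum_mult_le_sqrt) auto
    also have "(\<Sum>k<N. (\<kappa> k powr (\<eta> / 2) * g j k)\<^sup>2) = (\<Sum>k<N. \<kappa> k powr \<eta> * (g j k)\<^sup>2)"
    proof -
      have "(\<kappa> k powr (\<eta> / 2))\<^sup>2 = \<kappa> k powr \<eta>" for k
        by (simp add: power2_eq_square flip: powr_add)
      then show ?thesis by (simp add: power_mult_distrib)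
    qed
    finally show ?thesis by simp
  qed
  consider "p \<le> 2" | "2 < p" "p1 < 2" | "2 \<le> p1" "2 < p" using p1 by linarith
  then show ?thesis
  proof cases
    case 1
    then have q: "p1 < 2" "2 \<le> p'" using p1 p p' by (auto simp: pos_le_divide_eq)
    obtain \<kappa> :: "nat \<Rightarrow> real" and b :: "nat \<Rightarrow> nat \<Rightarrow> real" where \<kappa>: "\<And>k. 0 \<le> \<kappa> k" "(\<Sum>k<N. \<kappa> k) \<le> 1"
      and b0: "\<And>j k. 0 \<le> b j k"
      and ab: "\<And>j k. j < m \<Longrightarrow> k < N \<Longrightarrow> norm (a j k) = 8 * \<kappa> k powr (1 / p1 - 1 / 2) * b j k"
      and b: "\<And>j. j < m \<Longrightarrow> (\<Sum>k<N. (b j k)\<^sup>2) \<le> 1" "\<And>k. k < N \<Longrightarrow> (\<Sum>j<m. (b j k)\<^sup>2) \<le> 1"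
      using l2_into_lq_factor[OF p1(1) q(1) a] by metis
    show ?thesis
    proof (rule conclude)
      \<comment> \<open>Both sides are equal: the factorization yields exactly the weight that the
        interpolation requires.\<close>
      show "\<theta> + (1 - \<theta>) * (1 - 2 / p') \<le> 2 / p1 - 1"
      proof -
        have "(1 - \<theta>) / p' = 1 - 1 / p1" using p'(1) by (simp add: \<theta>_eq)
        moreover have "\<theta> + (1 - \<theta>) * (1 - 2 / p') = 1 - 2 * ((1 - \<theta>) / p')"
          by (simp add: algebra_simps)
        ultimately show ?thesis by simp
      qed
      show "norm (\<Sum>k<N. a j k * d j k) / 128 \<le> sqrt (\<Sum>k<N. \<kappa> k powr (2 / p1 - 1) * (norm (d j k))\<^sup>2)" if j: "j < m" for j
      proof (rule factor_bound[where b = b and j = j, OF b(1)[OF j]])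
        fix k assume "k < N"
        have e: "(2 / p1 - 1) / 2 = 1 / p1 - 1 / 2" by (simp add: field_simps)
        have "norm (a j k * d j k) = 8 * (b j k * (\<kappa> k powr (1 / p1 - 1 / 2) * norm (d j k)))"
          by (simp add: norm_mult ab[OF j \<open>k < N\<close>])
        also have "\<dots> \<le> 128 * (b j k * (\<kappa> k powr (1 / p1 - 1 / 2) * norm (d j k)))"
          using b0 by (intro mult_right_mono) auto
        finally show "norm (a j k * d j k) \<le> 128 * (b j k * (\<kappa> k powr ((2 / p1 - 1) / 2) * norm (d j k)))"
          by (simp only: e)
      qed
    qed (use q \<kappa> l2_into_lq_row[OF d] l2_into_lq_column[OF d] in auto)
  next
    case 2
    then have q: "1 \<le> p'" "p' < 2" using p' by (auto simp: pos_divide_less_eq)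
    obtain \<kappa> :: "nat \<Rightarrow> real" and b :: "nat \<Rightarrow> nat \<Rightarrow> real" where \<kappa>: "\<And>k. 0 \<le> \<kappa> k" "(\<Sum>k<N. \<kappa> k) \<le> 1"
      and b0: "\<And>j k. 0 \<le> b j k"
      and ab: "\<And>j k. j < m \<Longrightarrow> k < N \<Longrightarrow> norm (a j k) = 8 * \<kappa> k powr (1 / p1 - 1 / 2) * b j k"
      and b: "\<And>j. j < m \<Longrightarrow> (\<Sum>k<N. (b j k)\<^sup>2) \<le> 1" "\<And>k. k < N \<Longrightarrow> (\<Sum>j<m. (b j k)\<^sup>2) \<le> 1"
      using l2_into_lq_factor[OF p1(1) 2(2) a] by metis
    obtain \<nu> :: "nat \<Rightarrow> real" and g :: "nat \<Rightarrow> nat \<Rightarrow> real" where \<nu>: "\<And>k. 0 \<le> \<nu> k" "(\<Sum>k<N. \<nu> k) \<le> 1"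
      and g0: "\<And>j k. 0 \<le> g j k"
      and dg: "\<And>j k. j < m \<Longrightarrow> k < N \<Longrightarrow> norm (d j k) = 8 * \<nu> k powr (1 / p' - 1 / 2) * g j k"
      and g: "\<And>j. j < m \<Longrightarrow> (\<Sum>k<N. (g j k)\<^sup>2) \<le> 1" "\<And>k. k < N \<Longrightarrow> (\<Sum>j<m. (g j k)\<^sup>2) \<le> 1"
      using l2_into_lq_factor[OF q d] by metis
    \<comment> \<open>The two families of weights are merged: \<kappa> and \<nu> are at most 2
      \<mu>, while the sum of \<mu> stays at most 1. The resulting factor 2^(e + e') <= 2 is the 2
      in 128 = 8 * 8 * 2.\<close>
    define \<mu> where "\<mu> k = (\<kappa> k + \<nu> k) / 2" for k
    define e e' where "e = 1 / p1 - 1 / 2" and "e' = 1 / p' - 1 / 2"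
    have e: "0 \<le> e" "0 \<le> e'" "e + e' \<le> 1"
    proof -
      show "0 \<le> e" using p1 2 by (simp add: e_def field_simps)
      show "0 \<le> e'" using q by (simp add: e'_def field_simps)
      have "1 / p1 \<le> 1" "1 / p' \<le> 1" using p1 q by auto
      then show "e + e' \<le> 1" unfolding e_def e'_def by linarith
    qed
    show ?thesis
    proof (rule conclude)
      \<comment> \<open>For \<sigma> = 2 the second term vanishes, and \<theta> = p' (e + e') is at
        most 2 (e + e') because p' < 2.\<close>
      show "\<theta> + (1 - \<theta>) * (1 - 2 / 2) \<le> 2 * (e + e')"
      proof -
        have "\<theta> / p' = 1 / p1 - 1 / p" using p'(1) by (simp add: \<theta>)
        then have "\<theta> / p' = e + e'" using p(2) unfolding e_def e'_def by linarith
        then have "\<theta> = p' * (e + e')" using p'(1) by (simp add: divide_eq_eq mult.commute)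
        also have "\<dots> \<le> 2 * (e + e')" using q e by (intro mult_right_mono) auto
        finally show ?thesis by simp
      qed
      show "norm (\<Sum>k<N. a j k * d j k) / 128 \<le> sqrt (\<Sum>k<N. \<mu> k powr (2 * (e + e')) * (g j k)\<^sup>2)" if j: "j < m" for j
      proof (rule factor_bound[where b = b and j = j, OF b(1)[OF j]])
        fix k assume k: "k < N"
        have "\<kappa> k powr e * \<nu> k powr e' \<le> (2 * \<mu> k) powr e * (2 * \<mu> k) powr e'"
          using e \<kappa>(1)[of k] \<nu>(1)[of k] by (intro mult_mono powr_mono2) (auto simp: \<mu>_def)
        also have "\<dots> = 2 powr (e + e') * \<mu> k powr (e + e')"
          by (simp add: powr_add powr_mult)
        also have "\<dots> \<le> 2 * \<mu> k powr (e + e')"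
          using e powr_mono[of "e + e'" 1 "2::real"] by (intro mult_right_mono) auto
        finally have w: "\<kappa> k powr e * \<nu> k powr e' \<le> 2 * \<mu> k powr (e + e')" .
        have "norm (a j k * d j k) = 64 * (b j k * g j k) * (\<kappa> k powr e * \<nu> k powr e')"
          by (simp add: norm_mult ab[OF j k] dg[OF j k] e_def e'_def)
        also have "\<dots> \<le> 64 * (b j k * g j k) * (2 * \<mu> k powr (e + e'))"
          using b0 g0 w by (intro mult_left_mono) auto
        finally have "norm (a j k * d j k) \<le> 128 * (b j k * (\<mu> k powr (e + e') * g j k))"
          by (simp add: mult_ac)
        moreover have "2 * (e + e') / 2 = e + e'" by simp
        ultimately show "norm (a j k * d j k) \<le> 128 * (b j k * (\<mu> k powr (2 * (e + e') / 2) * g j k))"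
          by (simp only:)
      qed
      show "(\<Sum>k<N. \<mu> k) \<le> 1"
        using \<kappa>(2) \<nu>(2) by (simp add: \<mu>_def sum.distrib flip: sum_divide_distrib)
      show "(\<Sum>k<N. g j k powr 2) \<le> 1" if "j < m" for j
        using g(1)[OF that] g0 by simp
    qed (use \<kappa> \<nu> g g0 in \<open>auto simp: \<mu>_def\<close>)
  next
    case 3
    then have q: "1 \<le> p'" "p' < 2" using p' by (auto simp: pos_divide_less_eq)
    obtain \<nu> :: "nat \<Rightarrow> real" and g :: "nat \<Rightarrow> nat \<Rightarrow> real" where \<nu>: "\<And>k. 0 \<le> \<nu> k" "(\<Sum>k<N. \<nu> k) \<le> 1"
      and g0: "\<And>j k. 0 \<le> g j k"
      and dg: "\<And>j k. j < m \<Longrightarrow> k < N \<Longrightarrow> norm (d j k) = 8 * \<nu> k powr (1 / p' - 1 / 2) * g j k"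
      and g: "\<And>j. j < m \<Longrightarrow> (\<Sum>k<N. (g j k)\<^sup>2) \<le> 1" "\<And>k. k < N \<Longrightarrow> (\<Sum>j<m. (g j k)\<^sup>2) \<le> 1"
      using l2_into_lq_factor[OF q d] by metis
    show ?thesis
    proof (rule conclude)
      show "\<theta> + (1 - \<theta>) * (1 - 2 / p1) \<le> 2 / p' - 1"
      proof -
        \<comment> \<open>In these variables the condition becomes x (1 - x) <= y (1 - y), which
          holds because x < y <= 1/2.\<close>
        define x y where "x = 1 / p" and "y = 1 / p1"
        have xy: "0 < x" "x < y" "y \<le> 1 / 2"
          using 3 p1 p by (auto simp: x_def y_def field_simps)
        have P: "p' = 1 / (1 - x)"
          using p by (simp add: p'(2) x_def field_simps)
        have "x * (1 - x) \<le> y * (1 - y)"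
        proof -
          have "0 \<le> (y - x) * (1 - x - y)" using xy by (intro mult_nonneg_nonneg) auto
          then show ?thesis by (simp add: algebra_simps)
        qed
        then have "x \<le> y * (1 - y) / (1 - x)" using xy by (simp add: pos_le_divide_eq)
        moreover have "\<theta> + (1 - \<theta>) * (1 - 2 * y) = 1 - 2 * (y * (1 - y) / (1 - x))"
        proof -
          have z: "1 - \<theta> = (1 - y) / (1 - x)" by (simp add: \<theta>_eq P y_def)
          have "\<theta> + (1 - \<theta>) * (1 - 2 * y) = 1 - 2 * (y * (1 - \<theta>))" by (simp add: algebra_simps)
          then show ?thesis by (simp only: z times_divide_eq_right)
        qed
        moreover have "2 / p' - 1 = 1 - 2 * x" unfolding P by simp
        ultimately have "\<theta> + (1 - \<theta>) * (1 - 2 * y) \<le> 2 / p' - 1" by linarith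
        moreover have "2 * y = 2 / p1" by (simp add: y_def)
        ultimately show ?thesis by (simp only:)
      qed
      show "norm (\<Sum>k<N. a j k * d j k) / 128 \<le> sqrt (\<Sum>k<N. \<nu> k powr (2 / p' - 1) * (norm (a j k))\<^sup>2)" if j: "j < m" for j
      proof (rule factor_bound[where b = g and j = j, OF g(1)[OF j]])
        fix k assume "k < N"
        have e: "(2 / p' - 1) / 2 = 1 / p' - 1 / 2" by (simp add: field_simps)
        have "norm (a j k * d j k) = 8 * (g j k * (\<nu> k powr (1 / p' - 1 / 2) * norm (a j k)))"
          by (simp add: norm_mult dg[OF j \<open>k < N\<close>])
        also have "\<dots> \<le> 128 * (g j k * (\<nu> k powr (1 / p' - 1 / 2) * norm (a j k)))"
          using g0 by (intro mult_right_mono) auto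
        finally show "norm (a j k * d j k) \<le> 128 * (g j k * (\<nu> k powr ((2 / p' - 1) / 2) * norm (a j k)))"
          by (simp only: e)
      qed
    qed (use 3 p1 \<nu> l2_into_lq_row[OF a] l2_into_lq_column[OF a] in auto)
  qed
qed

section \<open>Summing bilinear forms\<close>

lemma weak_norm_bound:
  assumes X: "normed_space X" and x: "\<And>j. j < m \<Longrightarrow> x j \<in> car X" and \<phi>: "\<phi> \<in> car (dual X)" and q: "0 < q"
  shows "(\<Sum>j<m. norm (\<phi> (x j)) powr q) powr (1 / q) \<le> weak_norm q X m x * nrm (dual X) \<phi>"
proof (cases "nrm (dual X) \<phi> = 0")
  case True
  then have "\<phi> (x j) = 0" if "j < m" for j
    using dual_bound[OF X \<phi> x[OF that]] by simp
  then show ?thesis using True by simp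
next
  case False
  let ?L = "nrm (dual X) \<phi>"
  have L: "0 < ?L" using False nrm_dual_nonneg[OF X \<phi>] by simp
  let ?\<psi> = "scl (dual X) (of_real (1 / ?L)) \<phi>"
  have "nrm (dual X) ?\<psi> \<le> 1"
    using dual_scl(2)[OF X \<phi>, of "of_real (1 / ?L)"] L by (simp add: norm_divide)
  from weak_norm_upper[OF X x dual_scl(1)[OF X \<phi>] this q]
  have "(\<Sum>j<m. norm (?\<psi> (x j)) powr q) powr (1 / q) \<le> weak_norm q X m x" by simp
  moreover have "norm (?\<psi> (x j)) powr q = norm (\<phi> (x j)) powr q / ?L powr q" for j
    using L by (simp add: dual_def norm_mult norm_divide powr_divide)
  then have "(\<Sum>j<m. norm (?\<psi> (x j)) powr q) = (\<Sum>j<m. norm (\<phi> (x j)) powr q) / ?L powr q"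
    by (simp only: sum_divide_distrib)
  then have "(\<Sum>j<m. norm (?\<psi> (x j)) powr q) powr (1 / q)
      = (\<Sum>j<m. norm (\<phi> (x j)) powr q) powr (1 / q) / ?L"
    using L q by (simp add: powr_divide powr_powr)
  ultimately have "(\<Sum>j<m. norm (\<phi> (x j)) powr q) powr (1 / q) / ?L \<le> weak_norm q X m x"
    by (simp only:)
  then show ?thesis using L by (simp only: pos_divide_le_eq)
qed

text \<open>\<open>maurey_factorization\<close> with q = 1 for the evaluations at the y j; the
  exponent 1 - 2/q = -1 makes the weight a divisor. \<open>R\<close> is chosen before the family
  because the summing constant has to be uniform. \<open>W\<close> may exceed the weak norm, so that
  it can be taken positive. Indices with \<mu> j = 0 need a clause of their own because division by
  0 gives 0.\<close>

lemma weakly_summable_factorization: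
  fixes E :: "('k::real_or_complex, 'e::ab_group_add) nspace"
  assumes E: "normed_space E" and type2: "has_type 2 (dual E)"
  obtains R where "0 < R"
    "\<And>m y W. (\<And>j. j < m \<Longrightarrow> y j \<in> car E) \<Longrightarrow> weak_norm 1 E m y \<le> W \<Longrightarrow>
      \<exists>\<mu>. (\<forall>j. 0 \<le> \<mu> j) \<and> (\<Sum>j<m. \<mu> j) \<le> 1 \<and> (\<forall>\<phi>\<in>car (dual E).
        (\<forall>j<m. \<mu> j = 0 \<longrightarrow> \<phi> (y j) = 0) \<and>
        (\<Sum>j<m. (norm (\<phi> (y j)))\<^sup>2 / \<mu> j) \<le> (8 * W * R * nrm (dual E) \<phi>)\<^sup>2)"
proof -
  obtain R where R: "0 < R" and type: "\<forall>m x. (\<forall>j<m. x j \<in> car (dual E)) \<longrightarrow>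
      sqrt (measure_pmf.expectation (rademacher m) (\<lambda>\<epsilon>. (nrm (dual E) (\<Sum>j<m. scl (dual E) (\<epsilon> j) (x j)))\<^sup>2))
        \<le> R * (\<Sum>j<m. nrm (dual E) (x j) powr 2) powr (1 / 2)"
    using type2 unfolding has_type_def by (elim exE conjE) (rule that)
  have type': "measure_pmf.expectation (rademacher m) (\<lambda>\<epsilon>. (nrm (dual E) (\<Sum>j<m. scl (dual E) (\<epsilon> j) (x j)))\<^sup>2)
        \<le> R\<^sup>2 * (\<Sum>j<m. (nrm (dual E) (x j))\<^sup>2)" if x: "\<And>j. j < m \<Longrightarrow> x j \<in> car (dual E)" for m x
  proof -
    have "(\<Sum>j<m. nrm (dual E) (x j) powr 2) = (\<Sum>j<m. (nrm (dual E) (x j))\<^sup>2)"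
      using nrm_dual_nonneg[OF E x] by (intro sum.cong) auto
    then have "sqrt (measure_pmf.expectation (rademacher m) (\<lambda>\<epsilon>. (nrm (dual E) (\<Sum>j<m. scl (dual E) (\<epsilon> j) (x j)))\<^sup>2))
        \<le> R * sqrt (\<Sum>j<m. (nrm (dual E) (x j))\<^sup>2)"
      using type[rule_format, of m x] x by (simp add: powr_half_sqrt sum_nonneg)
    also have "\<dots> = sqrt (R\<^sup>2 * (\<Sum>j<m. (nrm (dual E) (x j))\<^sup>2))"
      using R by (simp add: real_sqrt_mult)
    finally show ?thesis by simp
  qed
  show ?thesis
  proof (rule that[OF R])
    fix m y W assume y: "\<And>j. j < m \<Longrightarrow> y j \<in> car E" and W: "weak_norm 1 E m y \<le> W"
    have W0: "0 \<le> W" using W weak_norm_nonneg[of E m y 1, OF E y] by simp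
    have bounded: "(\<Sum>j<m. norm (\<phi> (y j)) powr 1) \<le> (W * nrm (dual E) \<phi>) powr 1" if \<phi>: "\<phi> \<in> car (dual E)" for \<phi>
    proof -
      have "(\<Sum>j<m. norm (\<phi> (y j))) \<le> weak_norm 1 E m y * nrm (dual E) \<phi>"
        using weak_norm_bound[of E m y \<phi> 1, OF E y \<phi>] by (simp add: sum_nonneg)
      also have "\<dots> \<le> W * nrm (dual E) \<phi>"
        using W nrm_dual_nonneg[OF E \<phi>] by (rule mult_right_mono)
      finally show ?thesis using W0 nrm_dual_nonneg[OF E \<phi>] by simp
    qed
    have app: "(0 :: 'e \<Rightarrow> 'k) (y j) = 0" "(\<phi> + \<psi>) (y j) = \<phi> (y j) + \<psi> (y j)"
      "scl (dual E) c \<phi> (y j) = c * \<phi> (y j)" for \<phi> \<psi> :: "'e \<Rightarrow> 'k" and c j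
      by (simp_all add: dual_def)
    have one_less_two: "(1::real) < 2" by simp
    obtain \<mu> :: "nat \<Rightarrow> real" where \<mu>: "\<And>j. 0 \<le> \<mu> j" "(\<Sum>j<m. \<mu> j) \<le> 1"
      "\<And>\<phi> j. \<phi> \<in> car (dual E) \<Longrightarrow> nrm (dual E) \<phi> \<le> 1 \<Longrightarrow> j < m \<Longrightarrow> \<mu> j = 0 \<Longrightarrow> \<phi> (y j) = 0"
      "\<And>\<phi>. \<phi> \<in> car (dual E) \<Longrightarrow> nrm (dual E) \<phi> \<le> 1 \<Longrightarrow>
        (\<Sum>j<m. (norm (\<phi> (y j)))\<^sup>2 * \<mu> j powr (1 - 2 / 1)) \<le> 8 powr (2 / 1) * (W * R)\<^sup>2"
    proof (rule maurey_factorization[where X = "dual E" and T = "\<lambda>\<phi> j. \<phi> (y j)" and N = m,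
            OF zero_less_one one_less_two W0 R type' dual_zero[OF E] app(1) dual_add[OF E] app(2)
              dual_scl(1)[OF E] app(3) nrm_dual_nonneg[OF E] dual_scl(2)[OF E] bounded])
      fix \<mu> :: "nat \<Rightarrow> real"
      assume "\<And>j. 0 \<le> \<mu> j" "(\<Sum>j<m. \<mu> j) \<le> 1"
        "\<And>\<phi> j. \<phi> \<in> car (dual E) \<Longrightarrow> nrm (dual E) \<phi> \<le> 1 \<Longrightarrow> j < m \<Longrightarrow> \<mu> j = 0 \<Longrightarrow> \<phi> (y j) = 0"
        "\<And>\<phi>. \<phi> \<in> car (dual E) \<Longrightarrow> nrm (dual E) \<phi> \<le> 1 \<Longrightarrow>
          (\<Sum>j<m. (norm (\<phi> (y j)))\<^sup>2 * \<mu> j powr (1 - 2 / 1)) \<le> 8 powr (2 / 1) * (W * R)\<^sup>2"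
      then show thesis by (rule that)
    qed
    have "(\<forall>j<m. \<mu> j = 0 \<longrightarrow> \<phi> (y j) = 0) \<and>
        (\<Sum>j<m. (norm (\<phi> (y j)))\<^sup>2 / \<mu> j) \<le> (8 * W * R * nrm (dual E) \<phi>)\<^sup>2" if \<phi>: "\<phi> \<in> car (dual E)" for \<phi>
    proof (cases "nrm (dual E) \<phi> = 0")
      case True
      then have "\<phi> (y j) = 0" if "j < m" for j
        using dual_bound[OF E \<phi> y[OF that]] by simp
      then show ?thesis by simp
    next
      case False
      let ?L = "nrm (dual E) \<phi>"
      have L: "0 < ?L" using False nrm_dual_nonneg[OF E \<phi>] by simp
      define c where "c = (of_real (1 / ?L) :: 'k)"
      have c: "c \<noteq> 0" "norm c = 1 / ?L" using L by (simp_all add: c_def norm_divide)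
      let ?\<psi> = "scl (dual E) c \<phi>"
      have \<psi>: "?\<psi> \<in> car (dual E)" by (rule dual_scl(1)[OF E \<phi>])
      have nrm: "nrm (dual E) ?\<psi> \<le> 1"
        using dual_scl(2)[OF E \<phi>, of c] L by (simp add: c)
      have app: "?\<psi> z = c * \<phi> z" for z by (simp add: dual_def)
      have "\<forall>j<m. \<mu> j = 0 \<longrightarrow> \<phi> (y j) = 0"
        using \<mu>(3)[OF \<psi> nrm] c by (simp add: app)
      moreover have "(norm (?\<psi> (y j)))\<^sup>2 * \<mu> j powr (1 - 2 / 1) = (norm (\<phi> (y j)))\<^sup>2 / \<mu> j / ?L\<^sup>2" for j
        using L \<mu>(1)[of j] by (simp add: app c norm_mult power_divide powr_minus_divide)
      then have "(\<Sum>j<m. (norm (\<phi> (y j)))\<^sup>2 / \<mu> j) / ?L\<^sup>2 \<le> 8 powr (2 / 1) * (W * R)\<^sup>2"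
        using \<mu>(4)[OF \<psi> nrm] by (simp only: sum_divide_distrib)
      then have "(\<Sum>j<m. (norm (\<phi> (y j)))\<^sup>2 / \<mu> j) \<le> (8 * W * R * ?L)\<^sup>2"
        using L by (simp add: field_simps power_mult_distrib)
      ultimately show ?thesis by blast
    qed
    then show "\<exists>\<mu>. (\<forall>j. 0 \<le> \<mu> j) \<and> (\<Sum>j<m. \<mu> j) \<le> 1 \<and> (\<forall>\<phi>\<in>car (dual E).
        (\<forall>j<m. \<mu> j = 0 \<longrightarrow> \<phi> (y j) = 0) \<and>
        (\<Sum>j<m. (norm (\<phi> (y j)))\<^sup>2 / \<mu> j) \<le> (8 * W * R * nrm (dual E) \<phi>)\<^sup>2)"
      using \<mu>(1,2) by blast
  qed
qed

lemma norming_sequence_norm: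
  fixes z :: "'k::real_or_complex"
  shows "norm (of_real (norm z powr q) / z) = norm z powr (q - 1)"
  by (cases "z = 0") (simp_all add: norm_divide powr_diff)

text \<open>A norming functional on the first N coordinates is a functional on l_q, of norm at most
  S^(1 - 1/q) by Hoelder. Testing the weak 2-norm of the x j on it yields the condition of
  \<open>l2_into_lqI\<close>.\<close>

lemma lp_weak_norm_l2_into_lq:
  fixes x :: "nat \<Rightarrow> nat \<Rightarrow> 'k::real_or_complex"
  assumes q: "1 \<le> q" and x: "\<And>j. j < m \<Longrightarrow> x j \<in> car (lp q)"
    and V: "0 < V" "weak_norm 2 (lp q) m x \<le> V"
  shows "l2_into_lq m N q (\<lambda>j k. x j k / of_real V)"
proof (rule l2_into_lqI[OF q])
  fix s :: "nat \<Rightarrow> 'k" assume pos: "0 < (\<Sum>k<N. norm (s k) powr q)"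
  let ?S = "\<Sum>k<N. norm (s k) powr q" and ?\<phi> = "\<lambda>k. of_real (norm (s k) powr q) / s k"
  let ?X = "lp q :: ('k, nat \<Rightarrow> 'k) nspace"
  \<comment> \<open>Set to 0 off the carrier, as the encoding of functionals in \<open>dual\<close>
    demands.\<close>
  define \<Phi> where "\<Phi> z = (if z \<in> car ?X then \<Sum>k<N. ?\<phi> k * z k else 0)" for z
  note X = normed_space_lp[OF q]
  have bd: "norm (\<Phi> z) \<le> ?S powr (1 - 1 / q) * nrm ?X z" if z: "z \<in> car ?X" for z
  proof -
    have "norm (\<Phi> z) \<le> (\<Sum>k<N. norm (?\<phi> k * z k))" using z by (simp add: \<Phi>_def norm_sum)
    also have "\<dots> = (\<Sum>k<N. (norm (z k) powr q) powr (1 / q) * (norm (s k) powr q) powr (1 - 1 / q))"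
    proof (intro sum.cong refl)
      fix k
      have "q * (1 - 1 / q) = q - 1" using q by (simp add: right_diff_distrib)
      then have "(norm (s k) powr q) powr (1 - 1 / q) = norm (?\<phi> k)"
        by (simp only: powr_powr norming_sequence_norm)
      moreover have "(norm (z k) powr q) powr (1 / q) = norm (z k)" using q by (simp add: powr_powr)
      ultimately show "norm (?\<phi> k * z k) = (norm (z k) powr q) powr (1 / q) * (norm (s k) powr q) powr (1 - 1 / q)"
        by (simp only: norm_mult mult.commute)
    qed
    also have "\<dots> \<le> (\<Sum>k<N. norm (z k) powr q) powr (1 / q) * ?S powr (1 - 1 / q)"
      using q by (intro Hoelder_sum) auto
    also have "\<dots> \<le> nrm ?X z * ?S powr (1 - 1 / q)"
      using q z by (intro mult_right_mono lp_partial_sum_le) auto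
    finally show ?thesis by (simp add: mult.commute)
  qed
  have add: "\<Phi> (z + w) = \<Phi> z + \<Phi> w" if "z \<in> car ?X" "w \<in> car ?X" for z w
    using that normed_spaceD(2)[OF X that]
    by (simp add: \<Phi>_def distrib_left sum.distrib del: times_divide_eq_left)
  have scl: "\<Phi> (scl ?X c z) = c * \<Phi> z" if "z \<in> car ?X" for c z
    using that normed_spaceD(4)[OF X that, of c]
    by (simp add: \<Phi>_def sum_distrib_left lp_simps(3) mult_ac)
  have off: "\<Phi> z = 0" if "z \<notin> car ?X" for z using that by (simp add: \<Phi>_def)
  have \<Phi>: "\<Phi> \<in> car (dual ?X)" "nrm (dual ?X) \<Phi> \<le> ?S powr (1 - 1 / q)"
    using dual_memI[OF X add scl bd _ off] by simp_all
  have "sqrt (\<Sum>j<m. (norm (\<Phi> (x j)))\<^sup>2) = (\<Sum>j<m. norm (\<Phi> (x j)) powr 2) powr (1 / 2)"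
    by (simp add: powr_half_sqrt sum_nonneg)
  also have "\<dots> \<le> weak_norm 2 ?X m x * nrm (dual ?X) \<Phi>"
    using x by (intro weak_norm_bound[OF X _ \<Phi>(1)]) auto
  also have "\<dots> \<le> V * ?S powr (1 - 1 / q)"
    using V \<Phi> nrm_dual_nonneg[OF X \<Phi>(1)] by (intro mult_mono) auto
  finally have le: "sqrt (\<Sum>j<m. (norm (\<Phi> (x j)))\<^sup>2) \<le> V * ?S powr (1 - 1 / q)" .
  have "(\<Sum>j<m. (norm (\<Sum>k<N. ?\<phi> k * (x j k / of_real V)))\<^sup>2) = (\<Sum>j<m. (norm (\<Phi> (x j)))\<^sup>2 / V\<^sup>2)"
  proof (intro sum.cong refl)
    fix j assume "j \<in> {..<m}"
    then have "(\<Sum>k<N. ?\<phi> k * (x j k / of_real V)) = \<Phi> (x j) / of_real V"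
      using x by (simp add: \<Phi>_def sum_divide_distrib)
    then show "(norm (\<Sum>k<N. ?\<phi> k * (x j k / of_real V)))\<^sup>2 = (norm (\<Phi> (x j)))\<^sup>2 / V\<^sup>2"
      by (simp only: norm_divide power_divide norm_of_real power2_abs)
  qed
  then have "sqrt (\<Sum>j<m. (norm (\<Sum>k<N. ?\<phi> k * (x j k / of_real V)))\<^sup>2) = sqrt (\<Sum>j<m. (norm (\<Phi> (x j)))\<^sup>2) / V"
    using V by (simp add: real_sqrt_divide flip: sum_divide_distrib)
  then show "sqrt (\<Sum>j<m. (norm (\<Sum>k<N. ?\<phi> k * (x j k / of_real V)))\<^sup>2) \<le> ?S powr (1 - 1 / q)"
    using le V by (simp add: pos_divide_le_eq mult.commute)
qed

definition unit_seq :: "nat \<Rightarrow> nat \<Rightarrow> 'k::zero_neq_one" where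
  "unit_seq k n = (if n = k then 1 else 0)"

lemma bilinear_formD:
  assumes "A \<in> bilinear_forms X Y"
  shows "\<And>x x' y. x \<in> car X \<Longrightarrow> x' \<in> car X \<Longrightarrow> y \<in> car Y \<Longrightarrow> A (x + x', y) = A (x, y) + A (x', y)"
    "\<And>x y y'. x \<in> car X \<Longrightarrow> y \<in> car Y \<Longrightarrow> y' \<in> car Y \<Longrightarrow> A (x, y + y') = A (x, y) + A (x, y')"
    "\<And>c x y. x \<in> car X \<Longrightarrow> y \<in> car Y \<Longrightarrow> A (scl X c x, y) = c * A (x, y)"
    "\<And>c x y. x \<in> car X \<Longrightarrow> y \<in> car Y \<Longrightarrow> A (x, scl Y c y) = c * A (x, y)"
  using assms by (auto simp: bilinear_forms_def)

lemma unit_seq_in_lp: "unit_seq k \<in> car (lp p :: ('k::real_or_complex, nat \<Rightarrow> 'k) nspace)"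
proof -
  have "unit_seq k = trunc (Suc k) (unit_seq k :: nat \<Rightarrow> 'k)"
    by (auto simp: unit_seq_def trunc_def)
  then show ?thesis by (metis trunc_in_lp)
qed

lemma bilinear_form_trunc:
  fixes A :: "(nat \<Rightarrow> 'k::real_or_complex) \<times> 'e::ab_group_add \<Rightarrow> 'k"
  assumes p: "1 \<le> p" and A: "A \<in> bilinear_forms (lp p) E" and y: "y \<in> car E"
  shows "A (trunc N x, y) = (\<Sum>k<N. x k * A (unit_seq k, y))"
proof (induction N)
  case 0
  have "trunc 0 x = scl (lp p) 0 (trunc 0 x)" by (simp add: lp_simps trunc_def)
  then show ?case using bilinear_formD(3)[OF A trunc_in_lp y, of 0 0 x] by simp
next
  case (Suc N)
  have "trunc (Suc N) x = trunc N x + scl (lp p) (x N) (unit_seq N)"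
    by (auto simp: lp_simps trunc_def unit_seq_def fun_eq_iff less_Suc_eq)
  moreover have "scl (lp p) (x N) (unit_seq N) \<in> car (lp p)"
    by (rule normed_spaceD(4)[OF normed_space_lp[OF p] unit_seq_in_lp])
  ultimately have "A (trunc (Suc N) x, y) = A (trunc N x, y) + A (scl (lp p) (x N) (unit_seq N), y)"
    using bilinear_formD(1)[OF A trunc_in_lp _ y] by (simp only:)
  then show ?case by (simp add: Suc bilinear_formD(3)[OF A unit_seq_in_lp y])
qed

lemma bilinear_form_section:
  assumes X: "normed_space X" and E: "normed_space E" and A: "A \<in> bilinear_forms X E"
    and M: "0 < M" "\<And>x y. x \<in> car X \<Longrightarrow> y \<in> car E \<Longrightarrow> norm (A (x, y)) \<le> M * nrm X x * nrm E y"
    and x: "x \<in> car X"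
  shows "(\<lambda>y. if y \<in> car E then A (x, y) else 0) \<in> car (dual E)"
    "nrm (dual E) (\<lambda>y. if y \<in> car E then A (x, y) else 0) \<le> M * nrm X x"
  by (rule dual_memI[OF E, where M = "M * nrm X x"];
      use M x normed_spaceD(2,4)[OF E] normed_spaceD(5)[OF X x] bilinear_formD(2,4)[OF A] in simp)+

text \<open>Duality between l_p and l_p': a norming sequence for l_p', read as an element of l_p,
  turns A into a functional on E of norm at most M times its l_p norm, and \<open>fact\<close>
  controls this functional along the y j. Dividing row j by sqrt (\<mu> j) gives \<open>fact\<close>
  the unweighted form of an l_2 bound.\<close>

lemma bilinear_form_l2_into_lq:
  fixes A :: "(nat \<Rightarrow> 'k::real_or_complex) \<times> 'e::ab_group_add \<Rightarrow> 'k"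
  assumes E: "normed_space E" and p: "1 < p" "1 / p + 1 / p' = 1" and A: "A \<in> bilinear_forms (lp p) E"
    and M: "0 < M" "\<And>x y. x \<in> car (lp p) \<Longrightarrow> y \<in> car E \<Longrightarrow> norm (A (x, y)) \<le> M * nrm (lp p) x * nrm E y"
    and y: "\<And>j. j < m \<Longrightarrow> y j \<in> car E" and \<mu>: "\<And>j. 0 \<le> \<mu> j" and K: "0 < K"
    and fact: "\<And>\<phi>. \<phi> \<in> car (dual E) \<Longrightarrow>
        (\<Sum>j<m. (norm (\<phi> (y j)))\<^sup>2 / \<mu> j) \<le> (K * nrm (dual E) \<phi>)\<^sup>2"
  shows "l2_into_lq m N p' (\<lambda>j k. A (unit_seq k, y j) / of_real (sqrt (\<mu> j) * (K * M)))"
proof (rule l2_into_lqI)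
  have X: "normed_space (lp p :: ('k, nat \<Rightarrow> 'k) nspace)" using p by (intro normed_space_lp) auto
  have p': "1 < p'" "p' = p / (p - 1)"
  proof -
    have "1 / p' = (p - 1) / p" using p by (simp add: field_simps)
    then show "p' = p / (p - 1)" by (metis inverse_divide inverse_eq_divide inverse_inverse_eq)
    then show "1 < p'" using p by simp
  qed
  then show "1 \<le> p'" by simp
  fix s :: "nat \<Rightarrow> 'k" assume pos: "0 < (\<Sum>k<N. norm (s k) powr p')"
  let ?S = "\<Sum>k<N. norm (s k) powr p'" and ?\<phi> = "\<lambda>k. of_real (norm (s k) powr p') / s k"
  define \<psi> where "\<psi> = (\<lambda>z. if z \<in> car E then A (trunc N ?\<phi>, z) else 0)"
  have \<psi>: "\<psi> \<in> car (dual E)" "nrm (dual E) \<psi> \<le> M * nrm (lp p) (trunc N ?\<phi>)"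
    unfolding \<psi>_def using bilinear_form_section[OF X E A M trunc_in_lp] by blast+
  \<comment> \<open>This identity makes the l_p norm of the norming sequence equal to S^(1/p) = S^(1
    - 1/p').\<close>
  have "(p' - 1) * p = p'" using p by (simp add: p'(2) field_simps)
  then have "norm (?\<phi> k) powr p = norm (s k) powr p'" for k
    by (simp only: norming_sequence_norm powr_powr)
  then have "nrm (lp p) (trunc N ?\<phi>) = ?S powr (1 / p)"
    by (simp only: nrm_trunc)
  also have "1 / p = 1 - 1 / p'" using p(2) by linarith
  finally have nrm: "nrm (dual E) \<psi> \<le> M * ?S powr (1 - 1 / p')" using \<psi>(2) by simp
  have "(\<Sum>j<m. (norm (\<psi> (y j)))\<^sup>2 / \<mu> j) \<le> (K * nrm (dual E) \<psi>)\<^sup>2" by (rule fact[OF \<psi>(1)])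
  also have "\<dots> \<le> (K * (M * ?S powr (1 - 1 / p')))\<^sup>2"
    using nrm nrm_dual_nonneg[OF E \<psi>(1)] K by (intro power_mono mult_left_mono) auto
  finally have le: "(\<Sum>j<m. (norm (\<psi> (y j)))\<^sup>2 / \<mu> j) \<le> (K * M * ?S powr (1 - 1 / p'))\<^sup>2"
    by (simp add: mult.assoc)
  have "(\<Sum>j<m. (norm (\<Sum>k<N. ?\<phi> k * (A (unit_seq k, y j) / of_real (sqrt (\<mu> j) * (K * M)))))\<^sup>2)
      = (\<Sum>j<m. (norm (\<psi> (y j)))\<^sup>2 / \<mu> j / (K * M)\<^sup>2)"
  proof (intro sum.cong refl)
    fix j assume "j \<in> {..<m}"
    then have "\<psi> (y j) = (\<Sum>k<N. ?\<phi> k * A (unit_seq k, y j))"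
      using y p by (simp add: \<psi>_def bilinear_form_trunc[OF _ A])
    then have "(\<Sum>k<N. ?\<phi> k * (A (unit_seq k, y j) / of_real (sqrt (\<mu> j) * (K * M)))) = \<psi> (y j) / of_real (sqrt (\<mu> j) * (K * M))"
      by (simp only: sum_divide_distrib times_divide_eq_right)
    then show "(norm (\<Sum>k<N. ?\<phi> k * (A (unit_seq k, y j) / of_real (sqrt (\<mu> j) * (K * M)))))\<^sup>2
        = (norm (\<psi> (y j)))\<^sup>2 / \<mu> j / (K * M)\<^sup>2"
      using \<mu>[of j] by (simp only: norm_divide norm_of_real power_divide power2_abs power_mult_distrib real_sqrt_pow2 divide_divide_eq_left)
  qed
  also have "\<dots> = (\<Sum>j<m. (norm (\<psi> (y j)))\<^sup>2 / \<mu> j) / (K * M)\<^sup>2"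
    by (simp only: sum_divide_distrib)
  also have "\<dots> \<le> (?S powr (1 - 1 / p'))\<^sup>2"
  proof -
    have "0 < (K * M)\<^sup>2" using K M by simp
    moreover have "(K * M * ?S powr (1 - 1 / p'))\<^sup>2 = (?S powr (1 - 1 / p'))\<^sup>2 * (K * M)\<^sup>2"
      by (simp only: power_mult_distrib mult_ac)
    ultimately show ?thesis using le by (simp only: pos_divide_le_eq)
  qed
  finally show "sqrt (\<Sum>j<m. (norm (\<Sum>k<N. ?\<phi> k * (A (unit_seq k, y j) / of_real (sqrt (\<mu> j) * (K * M)))))\<^sup>2)
      \<le> ?S powr (1 - 1 / p')"
    by (simp add: real_le_lsqrt)
qed

section \<open>Passage to l_p1 and to infinitely many coordinates\<close>

lemma restrict_bilinear_form:
  fixes A :: "(nat \<Rightarrow> 'k::real_or_complex) \<times> 'e::ab_group_add \<Rightarrow> 'k"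
  assumes E: "normed_space E" and p: "1 \<le> p1" "p1 \<le> p" and A: "A \<in> bilinear_forms (lp p) E"
  shows "restrict A (car (lp p1) \<times> car E) \<in> bilinear_forms (lp p1) E"
proof -
  let ?X = "lp p1 :: ('k, nat \<Rightarrow> 'k) nspace" and ?Y = "lp p :: ('k, nat \<Rightarrow> 'k) nspace"
  let ?B = "restrict A (car ?X \<times> car E)"
  have X: "normed_space ?X" and Y: "normed_space ?Y" using p by (auto intro: normed_space_lp)
  have sub: "x \<in> car ?Y" "nrm ?Y x \<le> nrm ?X x" if "x \<in> car ?X" for x
    using lp_subset[of p1 p x] p that by auto
  obtain M where M: "0 < M" "\<And>x y. x \<in> car ?Y \<Longrightarrow> y \<in> car E \<Longrightarrow> norm (A (x, y)) \<le> M * nrm ?Y x * nrm E y"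
    using bilinear_form_bounded[OF Y E A] by blast
  have scl: "scl ?X c x = scl ?Y c x" for c x by (simp add: lp_simps)
  \<comment> \<open>The inclusion of l_p1 in l_p has norm at most 1, so the bound \<open>M\<close>
    is inherited; continuity in the topology of l_p1 follows from it.\<close>
  have bd: "norm (?B (x, y)) \<le> M * nrm ?X x * nrm E y" if "x \<in> car ?X" "y \<in> car E" for x y
  proof -
    have "norm (A (x, y)) \<le> M * nrm ?Y x * nrm E y" using M(2) sub that by simp
    also have "\<dots> \<le> M * nrm ?X x * nrm E y"
      using sub[OF that(1)] M(1) normed_spaceD(5)[OF E that(2)] by (intro mult_right_mono mult_left_mono) auto
    finally show ?thesis using that by simp
  qed
  have add1: "?B (x + x', y) = ?B (x, y) + ?B (x', y)" if "x \<in> car ?X" "x' \<in> car ?X" "y \<in> car E" for x x' y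
    using that sub normed_spaceD(2)[OF X] bilinear_formD(1)[OF A] by simp
  have add2: "?B (x, y + y') = ?B (x, y) + ?B (x, y')" if "x \<in> car ?X" "y \<in> car E" "y' \<in> car E" for x y y'
    using that sub normed_spaceD(2)[OF E] bilinear_formD(2)[OF A] by simp
  have scl1: "?B (scl ?X c x, y) = c * ?B (x, y)" if "x \<in> car ?X" "y \<in> car E" for c x y
    using that sub normed_spaceD(4)[OF X that(1), of c] bilinear_formD(3)[OF A] by (simp add: scl)
  have scl2: "?B (x, scl E c y) = c * ?B (x, y)" if "x \<in> car ?X" "y \<in> car E" for c x y
    using that sub normed_spaceD(4)[OF E] bilinear_formD(4)[OF A] by simp
  show ?thesis
    unfolding bilinear_forms_def
    using add1 add2 scl1 scl2 bilinear_form_continuous[OF X E add1 add2 bd M(1)] by blast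
qed

lemma trunc_bilinear_form_tendsto:
  fixes A :: "(nat \<Rightarrow> 'k::real_or_complex) \<times> 'e::ab_group_add \<Rightarrow> 'k"
  assumes p: "1 \<le> p" and E: "normed_space E" and A: "A \<in> bilinear_forms (lp p) E"
    and x: "x \<in> car (lp p)" and y: "y \<in> car E"
  shows "(\<lambda>N. A (trunc N x, y)) \<longlonglongrightarrow> A (x, y)"
proof -
  note X = normed_space_lp[OF p]
  obtain M where M: "0 < M" "\<And>x y. x \<in> car (lp p) \<Longrightarrow> y \<in> car E \<Longrightarrow> norm (A (x, y)) \<le> M * nrm (lp p) x * nrm E y"
    using bilinear_form_bounded[OF X E A] by blast
  have d: "x - trunc N x \<in> car (lp p)" for N
    by (rule normed_spaceD(3)[OF X x trunc_in_lp])
  have "A (x, y) = A (x - trunc N x, y) + A (trunc N x, y)" for N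
    using bilinear_formD(1)[OF A d[of N] trunc_in_lp[of N x] y] by simp
  then have "A (x, y) - A (trunc N x, y) = A (x - trunc N x, y)" for N
    by (simp add: diff_eq_eq)
  then have le: "dist (A (trunc N x, y)) (A (x, y)) \<le> M * nrm (lp p) (x - trunc N x) * nrm E y" for N
    using M(2)[OF d y, of N] by (simp add: dist_norm norm_minus_commute[of "A (trunc N x, y)"])
  have "(\<lambda>N. nrm (lp p) (x - trunc N x)) \<longlonglongrightarrow> 0"
    using trunc_tendsto[OF _ x] p by simp
  then have lim: "(\<lambda>N. M * nrm (lp p) (x - trunc N x) * nrm E y) \<longlonglongrightarrow> 0"
    by (intro tendsto_mult_left_zero tendsto_mult_right_zero)
  have "(\<lambda>N. dist (A (trunc N x, y)) (A (x, y))) \<longlonglongrightarrow> 0"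
    by (rule tendsto_sandwich[OF always_eventually always_eventually tendsto_const lim]) (simp_all add: le)
  then show ?thesis by (rule tendsto_dist_iff[THEN iffD2])
qed

theorem theorem4p5:
  fixes E :: "('k::real_or_complex, 'e::ab_group_add) nspace"
    and p p' p1 r :: real
    and A :: "(nat \<Rightarrow> 'k) \<times> 'e \<Rightarrow> 'k"
  assumes "banach_space E"
    and "has_type 2 (dual E)"
    and "1 < p"
    and "1 / p + 1 / p' = 1"
    and "1 \<le> p1" and "p1 < p"
    and "1 / r = 1 / 2 + (1 / p1 - 1 / p) * (p' / 2)"
    and "A \<in> bilinear_forms (lp p) E"
  shows "restrict A (car (lp p1) \<times> car E) \<in> summing_forms r 2 1 (lp p1) E"
proof -
  note p = assms(3,4) and p1 = assms(5,6) and A = assms(8)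
  have E: "normed_space E" using assms(1) by (simp add: banach_space_def)
  let ?X = "lp p1 :: ('k, nat \<Rightarrow> 'k) nspace" and ?Y = "lp p :: ('k, nat \<Rightarrow> 'k) nspace"
  let ?B = "restrict A (car ?X \<times> car E)"
  have X: "normed_space ?X" and Y: "normed_space ?Y" using p p1 by (auto intro: normed_space_lp)
  define \<theta> where "\<theta> = (1 / p1 - 1 / p) * p'"
  have \<theta>: "0 < \<theta>"
  proof -
    have "1 / p < 1" "1 / p < 1 / p1" using p p1 by (simp_all add: field_simps)
    then have "0 < 1 / p'" using p(2) by linarith
    with \<open>1 / p < 1 / p1\<close> show ?thesis by (simp add: \<theta>_def)
  qed
  have "1 / r = (1 + \<theta>) / 2" using assms(7) by (simp add: \<theta>_def add_divide_distrib)
  then have r_eq: "r = 2 / (1 + \<theta>)" by (metis inverse_divide inverse_eq_divide inverse_inverse_eq)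
  \<comment> \<open>1/r = 1/2 + \<theta>/2, so r is the Hoelder exponent for products of sequences
    in l_2 and l_(2/\<theta>); r/2 and 1 - r/2 are the weights of the geometric mean below.\<close>
  have r: "0 < r" "r < 2" "1 - r / 2 = r * \<theta> / 2"
    using \<theta> by (simp_all add: r_eq field_simps)
  obtain M where M: "0 < M" "\<And>x y. x \<in> car ?Y \<Longrightarrow> y \<in> car E \<Longrightarrow> norm (A (x, y)) \<le> M * nrm ?Y x * nrm E y"
    using bilinear_form_bounded[OF Y E A] by blast
  obtain R where R: "0 < R"
    "\<And>m y W. (\<And>j. j < m \<Longrightarrow> y j \<in> car E) \<Longrightarrow> weak_norm 1 E m y \<le> W \<Longrightarrow>
      \<exists>\<mu>. (\<forall>j. 0 \<le> \<mu> j) \<and> (\<Sum>j<m. \<mu> j) \<le> 1 \<and> (\<forall>\<phi>\<in>car (dual E).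
        (\<forall>j<m. \<mu> j = 0 \<longrightarrow> \<phi> (y j) = 0) \<and>
        (\<Sum>j<m. (norm (\<phi> (y j)))\<^sup>2 / \<mu> j) \<le> (8 * W * R * nrm (dual E) \<phi>)\<^sup>2)"
    using weakly_summable_factorization[OF E assms(2)] by blast
  \<comment> \<open>Positive upper bounds V and W stand for the weak norms, which may be 0, because
    the matrices are scaled by dividing by them.\<close>
  have bound: "(\<Sum>j<m. norm (A (x j, y j)) powr r) powr (1 / r) \<le> 1024 * R * M * (V * W)"
    if x: "\<And>j. j < m \<Longrightarrow> x j \<in> car ?X" and y: "\<And>j. j < m \<Longrightarrow> y j \<in> car E"
      and V: "0 < V" "weak_norm 2 ?X m x \<le> V" and W: "0 < W" "weak_norm 1 E m y \<le> W" for m x y V W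
  proof -
    have xY: "x j \<in> car ?Y" if "j < m" for j
      using lp_subset[of p1 p "x j"] p1 x[OF that] by auto
    obtain \<mu> :: "nat \<Rightarrow> real" where \<mu>: "\<And>j. 0 \<le> \<mu> j" "(\<Sum>j<m. \<mu> j) \<le> 1"
      and \<mu>0: "\<And>\<phi> j. \<phi> \<in> car (dual E) \<Longrightarrow> j < m \<Longrightarrow> \<mu> j = 0 \<Longrightarrow> \<phi> (y j) = 0"
      and fact: "\<And>\<phi>. \<phi> \<in> car (dual E) \<Longrightarrow> (\<Sum>j<m. (norm (\<phi> (y j)))\<^sup>2 / \<mu> j) \<le> (8 * W * R * nrm (dual E) \<phi>)\<^sup>2"
      using R(2)[OF y W(2)] by blast
    define K where "K = 8 * W * R"
    have K: "0 < K" using W R by (simp add: K_def)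
    have trunc_bound: "(\<Sum>j<m. norm (A (trunc N (x j), y j)) powr r) \<le> (128 * V * K * M) powr r" for N
    proof -
      define a where "a j k = x j k / of_real V" for j k
      define d where "d j k = A (unit_seq k, y j) / of_real (sqrt (\<mu> j) * (K * M))" for j k
      define u where "u j = norm (\<Sum>k<N. a j k * d j k) / 128" for j
      have "l2_into_lq m N p1 a"
        unfolding a_def using lp_weak_norm_l2_into_lq[OF p1(1) x V] by simp
      moreover have "l2_into_lq m N p' d"
        unfolding d_def using fact by (intro bilinear_form_l2_into_lq[OF E p A M y \<mu>(1) K]) (auto simp: K_def)
      ultimately have u: "(\<Sum>j<m. u j powr (2 / \<theta>)) \<le> 1"
        unfolding u_def by (rule paired_rows_bound[OF p p1 \<theta>_def])
      have eq: "norm (A (trunc N (x j), y j)) = (128 * V * K * M) * (sqrt (\<mu> j) * u j)" if j: "j < m" for j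
      proof -
        \<comment> \<open>If \<mu> j = 0, the division in d gave 0. The equation survives because A
          with unit_seq k fixed is a functional on E, and all functionals vanish at y j.\<close>
        have "A (unit_seq k, y j) = of_real (sqrt (\<mu> j) * (K * M)) * d j k" for k
        proof (cases "\<mu> j = 0")
          case True
          have "A (unit_seq k, y j) = 0"
            using \<mu>0[OF bilinear_form_section(1)[OF Y E A M unit_seq_in_lp] j True] y[OF j] by simp
          then show ?thesis by (simp add: True)
        next
          case False
          then show ?thesis using K M by (simp add: d_def)
        qed
        moreover have "x j k = of_real V * a j k" for k using V by (simp add: a_def)
        ultimately have "A (trunc N (x j), y j)
            = (\<Sum>k<N. of_real V * a j k * (of_real (sqrt (\<mu> j) * (K * M)) * d j k))"
          using bilinear_form_trunc[OF _ A y[OF j], of N "x j"] p by simp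
        also have "\<dots> = of_real (V * (sqrt (\<mu> j) * (K * M))) * (\<Sum>k<N. a j k * d j k)"
          by (simp add: sum_distrib_left mult_ac)
        finally have "norm (A (trunc N (x j), y j)) = V * (sqrt (\<mu> j) * (K * M)) * (128 * u j)"
          using V K M \<mu>(1)[of j] by (simp only: norm_mult norm_of_real) (simp add: u_def)
        then show ?thesis by (simp add: mult_ac)
      qed
      \<comment> \<open>Hoelder's inequality in additive form: the sums of \<mu> j and of u
        j^(2/\<theta>) are both at most 1, hence so is the sum of their weighted means.\<close>
      have "(sqrt (\<mu> j) * u j) powr r \<le> r / 2 * \<mu> j + (1 - r / 2) * u j powr (2 / \<theta>)" for j
      proof -
        have "(sqrt (\<mu> j) * u j) powr r = \<mu> j powr (r / 2) * (u j powr (2 / \<theta>)) powr (1 - r / 2)"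
          using \<mu>(1)[of j] \<theta> unfolding r(3) by (simp add: powr_mult powr_powr flip: powr_half_sqrt)
        also have "\<dots> \<le> r / 2 * \<mu> j + (1 - r / 2) * u j powr (2 / \<theta>)"
          using r \<mu>(1) by (intro weighted_geometric_mean_le) auto
        finally show ?thesis .
      qed
      then have "(\<Sum>j<m. (sqrt (\<mu> j) * u j) powr r) \<le> (\<Sum>j<m. r / 2 * \<mu> j + (1 - r / 2) * u j powr (2 / \<theta>))"
        by (intro sum_mono) simp
      also have "\<dots> = r / 2 * (\<Sum>j<m. \<mu> j) + (1 - r / 2) * (\<Sum>j<m. u j powr (2 / \<theta>))"
        by (simp only: sum.distrib sum_distrib_left)
      also have "\<dots> \<le> r / 2 * 1 + (1 - r / 2) * 1"
        using r \<mu>(2) u by (intro add_mono mult_left_mono) auto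
      finally have le1: "(\<Sum>j<m. (sqrt (\<mu> j) * u j) powr r) \<le> 1" by simp
      have "(\<Sum>j<m. norm (A (trunc N (x j), y j)) powr r)
          = (128 * V * K * M) powr r * (\<Sum>j<m. (sqrt (\<mu> j) * u j) powr r)"
        unfolding sum_distrib_left by (intro sum.cong refl) (simp only: eq lessThan_iff powr_mult[of "128 * V * K * M"])
      also have "\<dots> \<le> (128 * V * K * M) powr r * 1"
        using le1 by (intro mult_left_mono) auto
      finally show ?thesis by simp
    qed
    have "(\<lambda>N. \<Sum>j<m. norm (A (trunc N (x j), y j)) powr r) \<longlonglongrightarrow> (\<Sum>j<m. norm (A (x j, y j)) powr r)"
      using r p xY y by (intro tendsto_sum tendsto_powr' tendsto_norm tendsto_const trunc_bilinear_form_tendsto[OF _ E A]) auto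
    then have "(\<Sum>j<m. norm (A (x j, y j)) powr r) \<le> (128 * V * K * M) powr r"
      by (rule LIMSEQ_le_const2) (use trunc_bound in blast)
    then have "(\<Sum>j<m. norm (A (x j, y j)) powr r) powr (1 / r) \<le> ((128 * V * K * M) powr r) powr (1 / r)"
      using r by (intro powr_mono2) (auto intro: sum_nonneg)
    also have "\<dots> = 128 * V * K * M"
    proof -
      have "0 < 128 * V * K * M" using V K M by simp
      then show ?thesis using r by (simp add: powr_powr)
    qed
    also have "\<dots> = 1024 * R * M * (V * W)" by (simp add: K_def)
    finally show ?thesis .
  qed
  have "(\<Sum>j<m. norm (?B (x j, y j)) powr r) powr (1 / r)
      \<le> 1024 * R * M * (weak_norm 2 ?X m x * weak_norm 1 E m y)"
    if xy: "\<forall>j<m. x j \<in> car ?X \<and> y j \<in> car E" for m x y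
  proof -
    let ?v = "weak_norm 2 ?X m x" and ?w = "weak_norm 1 E m y"
    have v: "0 \<le> ?v" using xy by (intro weak_norm_nonneg[OF X]) auto
    have w: "0 \<le> ?w" using xy by (intro weak_norm_nonneg[OF E]) auto
    \<comment> \<open>A positive null sequence added to both weak norms makes them admissible in
      \<open>bound\<close>, even when they vanish; then it is sent to 0.\<close>
    let ?h = "\<lambda>n. inverse (real (Suc n))"
    have "(\<lambda>n. 1024 * R * M * ((?v + ?h n) * (?w + ?h n))) \<longlonglongrightarrow> 1024 * R * M * ((?v + 0) * (?w + 0))"
      by (intro tendsto_intros LIMSEQ_inverse_real_of_nat)
    moreover have "(\<Sum>j<m. norm (A (x j, y j)) powr r) powr (1 / r) \<le> 1024 * R * M * ((?v + ?h n) * (?w + ?h n))" for n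
      using xy v w by (intro bound) (auto intro: add_nonneg_pos)
    ultimately have "(\<Sum>j<m. norm (A (x j, y j)) powr r) powr (1 / r) \<le> 1024 * R * M * ((?v + 0) * (?w + 0))"
      by (intro LIMSEQ_le_const) auto
    then show ?thesis using xy by simp
  qed
  moreover have "?B \<in> bilinear_forms ?X E"
    using p1 by (intro restrict_bilinear_form[OF E _ _ A]) auto
  moreover have "0 < 1024 * R * M" using R M by simp
  ultimately show ?thesis
    unfolding summing_forms_def by blast
qed

end
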